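(* The set $\mathcal{F}:=\{u\in W^{1,1}(G): u=T(u)\}$ of fixed points of $T$ is a bounded subset of $W^{1,2}(G)$.
   Context: Setting. $\Omega\subset\mathbb{R}^2$ is a bounded Lipschitz domain. $C_1,\dots,C_N\subset\Omega$ ($N\ge 1$) are finitely many disjoint open Lipschitz domains, $C_i\neq\Omega$, with $\mathrm{dist}(C_i,C_j)>0$ for $i\ne j$. Put $C:=\bigcup_{i=1}^N C_i$, $K:=\overline{C}$, $G:=\Omega\setminus K$, and assume $K$ is a compact subset of $\Omega$ (so $\partial K\subset\partial G$). The function $f: C\to[0,1]$ is of class $W^{1,2}(C)$; a fixed extension of it to a function in $W^{1,2}(\Omega)$ is also denoted $f$. The map $D:\mathbb{R}^2\to\mathbb{R}^{2\times2}$ is continuous, $D(p)$ is symmetric for every $p\in\mathbb{R}^2$, and there are constants $\lambda,c_1,c_2>0$ with $$c_1\left(1+\frac{|p|^2}{\lambda^2}\right)^{-1/2}|q|^2\le D(p)q\cdot q\le c_2|q|^2\quad\text{for all }p,q\in\mathbb{R}^2.$$ A parameter $\sigma>0$ is fixed. For $w\in L^1(G)$ set $w_\sigma(x):=\int_G k_\sigma(x-z)w(z)\,dz$, $x\in\mathbb{R}^2$, where $k_\sigma(z)=\frac{1}{2\pi\sigma^2}\exp\left(-\frac{|z|^2}{2\sigma^2}\right)$. Operator $T$. Let $\mathcal{C}:=\{v\in W^{1,2}(G): v=f \text{ on }\partial K\text{ in the trace sense}\}$. For $w\in W^{1,1}(G)$ and $v\in W^{1,2}(G)$ let $J_w(v):=\int_G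 D(\nabla w_\sigma)\nabla v\cdot\nabla v\,dx$. For $w\in W^{1,1}(G)$, $T(w)$ is defined as the unique minimiser of $J_w$ in $\mathcal{C}$; this defines $T:W^{1,1}(G)\to W^{1,1}(G)$. *)

theory Defs
  imports "HOL-Analysis.Analysis"
begin

text \<open>Near each boundary point, in suitable orthonormal coordinates, the set is the part of a
  ball lying strictly above the graph of a Lipschitz function.\<close>

definition lipschitz_domain :: "(real^2) set \<Rightarrow> bool" where
  "lipschitz_domain U \<longleftrightarrow> open U \<and> connected U \<and> U \<noteq> {} \<and> bounded U \<and>
     (\<forall>x0\<in>frontier U. \<exists>r>0. \<exists>e1 e2. \<exists>\<gamma>::real \<Rightarrow> real. \<exists>L.
        norm e1 = 1 \<and> norm e2 = 1 \<and> e1 \<bullet> e2 = 0 \<and> lipschitz_on L UNIV \<gamma> \<and>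
        U \<inter> ball x0 r = {x \<in> ball x0 r. \<gamma> (x \<bullet> e1) < x \<bullet> e2})"

definition grad :: "(real^'n \<Rightarrow> real) \<Rightarrow> real^'n \<Rightarrow> real^'n" where
  "grad h x = (THE d. GDERIV h x :> d)"

primrec C_k :: "nat \<Rightarrow> (real^'n \<Rightarrow> real) \<Rightarrow> bool" where
  "C_k 0 \<phi> \<longleftrightarrow> continuous_on UNIV \<phi>"
| "C_k (Suc k) \<phi> \<longleftrightarrow>
     (\<exists>g. (\<forall>x. GDERIV \<phi> x :> g x) \<and> (\<forall>i. C_k k (\<lambda>x. g x $ i)))"

definition test_function :: "(real^'n) set \<Rightarrow> (real^'n \<Rightarrow> real) \<Rightarrow> bool" where
  "test_function U \<phi> \<longleftrightarrow>
     (\<forall>k. C_k k \<phi>) \<and> compact (closure {x. \<phi> x \<noteq> 0}) \<and> closure {x. \<phi> x \<noteq> 0} \<subseteq> U"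

text \<open>Elements of Lebesgue and Sobolev spaces are represented by functions on the whole space,
  of which only the values on \<open>U\<close>, up to null sets, are relevant.\<close>

definition L_p :: "nat \<Rightarrow> (real^'n) set \<Rightarrow> (real^'n \<Rightarrow> 'b::euclidean_space) set" where
  "L_p p U = {u. set_borel_measurable lebesgue U u \<and>
                 set_integrable lebesgue U (\<lambda>x. norm (u x) ^ p)}"

definition L1_loc :: "(real^'n) set \<Rightarrow> (real^'n \<Rightarrow> 'b::euclidean_space) set" where
  "L1_loc U = {u. \<forall>A. compact A \<and> A \<subseteq> U \<longrightarrow> set_integrable lebesgue A u}"

definition weak_gradient ::
    "(real^'n) set \<Rightarrow> (real^'n \<Rightarrow> real) \<Rightarrow> (real^'n \<Rightarrow> real^'n) \<Rightarrow> bool" where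
  "weak_gradient U u g \<longleftrightarrow> u \<in> L1_loc U \<and> g \<in> L1_loc U \<and>
     (\<forall>\<phi>. test_function U \<phi> \<longrightarrow>
        (LINT x:U|lebesgue. u x *\<^sub>R grad \<phi> x) = - (LINT x:U|lebesgue. \<phi> x *\<^sub>R g x))"

definition W1p :: "nat \<Rightarrow> (real^'n) set \<Rightarrow> (real^'n \<Rightarrow> real) set" where
  "W1p p U = {u \<in> L_p p U. \<exists>g \<in> L_p p U. weak_gradient U u g}"

text \<open>Weak gradients are unique up to null sets, so the choice is immaterial under integrals.\<close>

definition wgrad :: "(real^'n) set \<Rightarrow> (real^'n \<Rightarrow> real) \<Rightarrow> real^'n \<Rightarrow> real^'n" where
  "wgrad U u = (SOME g. weak_gradient U u g)"

definition W1p_norm :: "nat \<Rightarrow> (real^'n) set \<Rightarrow> (real^'n \<Rightarrow> real) \<Rightarrow> real" where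
  "W1p_norm p U u =
     root p ((LINT x:U|lebesgue. \<bar>u x\<bar> ^ p) + (LINT x:U|lebesgue. norm (wgrad U u x) ^ p))"

definition bounded_in_W1p :: "nat \<Rightarrow> (real^'n) set \<Rightarrow> (real^'n \<Rightarrow> real) set \<Rightarrow> bool" where
  "bounded_in_W1p p U F \<longleftrightarrow> F \<subseteq> W1p p U \<and> (\<exists>M. \<forall>u\<in>F. W1p_norm p U u \<le> M)"

text \<open>One-dimensional Hausdorff measure.  The Hausdorff outer measure is a metric outer measure,
  hence countably additive on the Borel sets, so \<open>measure_of\<close> does not degenerate to zero.\<close>

definition hausdorff1_outer :: "(real^2) set \<Rightarrow> ennreal" where
  "hausdorff1_outer A =
     (SUP \<delta>\<in>{0<..}. INF E\<in>{E :: nat \<Rightarrow> (real^2) set. A \<subseteq> (\<Union>i. E i) \<and>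
                                 (\<forall>i. bounded (E i) \<and> diameter (E i) \<le> (\<delta>::real))}.
        (\<Sum>i. ennreal (diameter (E i))))"

definition hausdorff1 :: "(real^2) measure" where
  "hausdorff1 = measure_of UNIV (sets borel) hausdorff1_outer"

text \<open>The trace operator on \<open>W\<^sup>1\<^sup>,\<^sup>2(U)\<close>, restricted to a part \<open>S\<close> of the boundary, is the continuous
  extension, with values in \<open>L\<^sup>2(S)\<close>, of the restriction map \<open>\<phi> \<mapsto> \<phi>|\<^sub>S\<close> defined on
  \<open>W\<^sup>1\<^sup>,\<^sup>2(U) \<inter> C(closure U)\<close>.  The predicate below is the graph of this operator.\<close>

definition has_trace ::
    "(real^2) set \<Rightarrow> (real^2) set \<Rightarrow> (real^2 \<Rightarrow> real) \<Rightarrow> (real^2 \<Rightarrow> real) \<Rightarrow> bool" where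
  "has_trace U S u g \<longleftrightarrow> u \<in> W1p 2 U \<and> set_borel_measurable borel S g \<and>
     (\<exists>\<phi> :: nat \<Rightarrow> real^2 \<Rightarrow> real.
        (\<forall>n. \<phi> n \<in> W1p 2 U \<and> continuous_on (closure U) (\<phi> n)) \<and>
        (\<lambda>n. W1p_norm 2 U (\<lambda>x. \<phi> n x - u x)) \<longlonglongrightarrow> 0 \<and>
        (\<lambda>n. \<integral>\<^sup>+x\<in>S. ennreal ((\<phi> n x - g x)\<^sup>2) \<partial>hausdorff1) \<longlonglongrightarrow> 0)"

definition trace_eq ::
    "(real^2) set \<Rightarrow> (real^2) set \<Rightarrow> (real^2 \<Rightarrow> real) \<Rightarrow> (real^2 \<Rightarrow> real) \<Rightarrow> bool" where
  "trace_eq U S u v \<longleftrightarrow> (\<exists>g. has_trace U S u g \<and> has_trace U S v g)"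

definition gauss :: "real \<Rightarrow> real^2 \<Rightarrow> real" where
  "gauss \<sigma> z = 1 / (2 * pi * \<sigma>\<^sup>2) * exp (- (norm z)\<^sup>2 / (2 * \<sigma>\<^sup>2))"

definition smoothed :: "real \<Rightarrow> (real^2) set \<Rightarrow> (real^2 \<Rightarrow> real) \<Rightarrow> real^2 \<Rightarrow> real" where
  "smoothed \<sigma> G w x = (LINT z:G|lebesgue. gauss \<sigma> (x - z) * w z)"

definition energy ::
    "(real^2 \<Rightarrow> real^2^2) \<Rightarrow> real \<Rightarrow> (real^2) set \<Rightarrow> (real^2 \<Rightarrow> real) \<Rightarrow> (real^2 \<Rightarrow> real) \<Rightarrow> real" where
  "energy D \<sigma> G w v =
     (LINT x:G|lebesgue. (D (grad (smoothed \<sigma> G w) x) *v wgrad G v x) \<bullet> wgrad G v x)"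

definition admissible ::
    "(real^2) set \<Rightarrow> (real^2) set \<Rightarrow> (real^2 \<Rightarrow> real) \<Rightarrow> (real^2 \<Rightarrow> real) set" where
  "admissible G K f = {v \<in> W1p 2 G. trace_eq G (frontier K) v f}"

definition minimisers ::
    "(real^2 \<Rightarrow> real^2^2) \<Rightarrow> real \<Rightarrow> (real^2) set \<Rightarrow> (real^2) set \<Rightarrow> (real^2 \<Rightarrow> real) \<Rightarrow>
     (real^2 \<Rightarrow> real) \<Rightarrow> (real^2 \<Rightarrow> real) set" where
  "minimisers D \<sigma> G K f w =
     {v \<in> admissible G K f. \<forall>v'\<in>admissible G K f. energy D \<sigma> G w v \<le> energy D \<sigma> G w v'}"

text \<open>\<open>T_eq D \<sigma> G K f w v\<close> means \<open>v = T(w)\<close> as elements of \<open>W\<^sup>1\<^sup>,\<^sup>1(G)\<close>, i.e. \<open>v\<close> is the unique minimiser,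
  where uniqueness is up to equality almost everywhere in \<open>G\<close>.  A relation is used because
  \<open>T(w)\<close> is an equivalence class of functions.\<close>

definition T_eq ::
    "(real^2 \<Rightarrow> real^2^2) \<Rightarrow> real \<Rightarrow> (real^2) set \<Rightarrow> (real^2) set \<Rightarrow> (real^2 \<Rightarrow> real) \<Rightarrow>
     (real^2 \<Rightarrow> real) \<Rightarrow> (real^2 \<Rightarrow> real) \<Rightarrow> bool" where
  "T_eq D \<sigma> G K f w v \<longleftrightarrow> v \<in> minimisers D \<sigma> G K f w \<and>
     (\<forall>v'\<in>minimisers D \<sigma> G K f w. AE x in lebesgue. x \<in> G \<longrightarrow> v' x = v x)"

definition T_fixed_points ::
    "(real^2 \<Rightarrow> real^2^2) \<Rightarrow> real \<Rightarrow> (real^2) set \<Rightarrow> (real^2) set \<Rightarrow> (real^2 \<Rightarrow> real) \<Rightarrow>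
     (real^2 \<Rightarrow> real) set" where
  "T_fixed_points D \<sigma> G K f = {u \<in> W1p 1 G. T_eq D \<sigma> G K f u u}"

end

theory Submission
  imports Defs "HOL-Probability.Probability_Measure"
begin

text \<open>
  Why the fixed points are bounded.  The only obstacle is the degeneracy of \<open>D\<close> for large arguments:
  the ellipticity constant in \<open>J\<^sub>u\<close> is \<open>c\<^sub>1 (1 + M\<^sup>2 / \<lambda>\<^sup>2)\<^sup>-\<^sup>1\<^sup>/\<^sup>2\<close> where \<open>M\<close> bounds \<open>\<nabla>u\<^sub>\<sigma>\<close>, and
  \<open>\<nabla>u\<^sub>\<sigma>\<close> is controlled by the \<open>L\<^sup>1\<close> norm of \<open>u\<close> on \<open>G\<close>.  So a pointwise bound on \<open>u\<close> that depends on
  nothing but the data suffices: with it, \<open>c \<integral>|\<nabla>u|\<^sup>2 \<le> J\<^sub>u(u) \<le> J\<^sub>u(f) \<le> c\<^sub>2 \<integral>|\<nabla>f|\<^sup>2\<close>, because \<open>f\<close> is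
  itself a competitor.

  The pointwise bound is a maximum principle.  Let \<open>\<beta>\<close> be a bounded \<open>C\<^sup>1\<close> function with
  \<open>0 \<le> \<beta>' \<le> 1\<close> and \<open>\<beta>(s) = s\<close> on \<open>[0, 1]\<close>.  Composition with \<open>\<beta>\<close> multiplies the gradient by
  \<open>\<beta>'(u)\<close> and so does not increase the energy (\<open>energy_compose_le\<close>).  If \<open>\<beta>(u)\<close> is admissible, it is
  therefore another minimiser, and uniqueness gives \<open>u = \<beta>(u)\<close>, which is bounded.  A smooth \<open>\<beta>\<close>
  is as good here as cutting off sharply at \<open>0\<close> and \<open>1\<close>, and its chain rule is simpler.

  Admissibility of \<open>\<beta>(u)\<close> is where the boundary enters.  Let \<open>\<tau>\<close> be a common trace of \<open>u\<close> and \<open>f\<close>.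
  Then \<open>\<beta>(u)\<close> has the trace \<open>\<beta>(\<tau>)\<close> (\<open>has_trace_compose\<close>), and what has to be shown is that \<open>f\<close> has this
  trace as well.  The difference \<open>h = f - \<beta>(f)\<close> belongs to \<open>W\<^sup>1\<^sup>,\<^sup>2(\<Omega>)\<close> and vanishes on every \<open>C\<^sub>i\<close>, because
  \<open>f\<close> takes values in \<open>[0, 1]\<close> there.  Such an \<open>h\<close> is a limit in \<open>W\<^sup>1\<^sup>,\<^sup>2(G)\<close> of continuous functions that
  vanish identically on \<open>\<partial>K\<close> (\<open>vanishing_approx_complement\<close>); adding them to the truncated
  approximations of \<open>f\<close> gives what is needed (\<open>has_trace_truncated\<close>), since on \<open>\<partial>K\<close> nothing changes.

  To approximate \<open>h\<close>, it is localised by a partition of unity along \<open>\<partial>K\<close>.  Near a boundary point, \<open>K\<close> is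
  the region above a Lipschitz graph, so for a small ball \<open>Q\<close> around the upward unit vector and \<open>t > 0\<close> the
  set \<open>x + t Q\<close> lies in \<open>C\<^sub>i\<close> whenever \<open>x\<close> lies on the graph.  The averages of \<open>h\<close> over \<open>x + t Q\<close>
  are continuous in \<open>x\<close>, vanish on \<open>\<partial>K\<close>, and converge to \<open>h\<close> in \<open>W\<^sup>1\<^sup>,\<^sup>2\<close> as \<open>t\<close> tends to \<open>0\<close>
  (\<open>local_vanishing_approx\<close>).

  The calculus of weak derivatives is built on such averages, for an arbitrary probability measure of bounded
  support (locale \<open>averaging\<close>).  The measure on a segment yields the difference quotients of \<open>w\<close> as
  averages of its weak derivative (\<open>difference_eq_segment_avg\<close>); they converge in \<open>L\<^sup>2\<close>, and passing to
  the limit in the difference quotients of \<open>\<beta>(w)\<close> gives the chain rule.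
\<close>


section \<open>Smooth functions\<close>

abbreviation smooth :: "(real^'n \<Rightarrow> real) \<Rightarrow> bool" where
  "smooth \<phi> \<equiv> \<forall>k. C_k k \<phi>"

lemma GDERIV_unique:
  fixes d d' :: "real^'n"
  assumes "GDERIV f x :> d" "GDERIV f x :> d'"
  shows "d = d'"
proof -
  have "(\<lambda>h. h \<bullet> d) = (\<lambda>h. h \<bullet> d')"
    using assms unfolding gderiv_def by (rule has_derivative_unique)
  then show ?thesis
    by (metis inner_commute vector_eq_rdot)
qed

lemma grad_eqI:
  assumes "GDERIV f x :> d"
  shows "grad f x = d"
  unfolding grad_def using assms GDERIV_unique by blast

lemma GDERIV_grad:
  assumes "GDERIV f x :> d"
  shows "GDERIV f x :> grad f x"
  using assms grad_eqI by metis

lemma GDERIV_imp_isCont: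
  assumes "GDERIV f x :> d"
  shows "isCont f x"
  using assms unfolding gderiv_def by (rule has_derivative_continuous)

lemma C_k_imp_continuous: "C_k k f \<Longrightarrow> continuous_on UNIV f"
  by (cases k) (auto intro: continuous_at_imp_continuous_on dest: GDERIV_imp_isCont)

lemma C_k_Suc_D: "C_k (Suc k) f \<Longrightarrow> C_k k f"
proof (induction k arbitrary: f)
  case 0
  then show ?case
    using C_k_imp_continuous[OF 0] by simp
next
  case (Suc k)
  from Suc.prems obtain g where g: "\<forall>x. GDERIV f x :> g x" "\<forall>i. C_k (Suc k) (\<lambda>x. g x $ i)"
    unfolding C_k.simps(2)[of "Suc k"] by blast
  then show ?case
    using Suc.IH by (auto intro!: exI[of _ g] simp del: C_k.simps simp: C_k.simps(2)[of k])
qed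

lemma C_k_const: "C_k k (\<lambda>x. c)"
proof (induction k arbitrary: c)
  case (Suc k)
  then show ?case
    by (auto intro!: exI[of _ "\<lambda>_. 0"] GDERIV_const simp: zero_vec_def)
qed simp

lemma C_k_add: "C_k k f \<Longrightarrow> C_k k g \<Longrightarrow> C_k k (\<lambda>x. f x + g x)"
proof (induction k arbitrary: f g)
  case 0
  then show ?case by (auto intro: continuous_intros)
next
  case (Suc k)
  from Suc.prems obtain f' g' where *: "\<forall>x. GDERIV f x :> f' x" "\<forall>i. C_k k (\<lambda>x. f' x $ i)"
    "\<forall>x. GDERIV g x :> g' x" "\<forall>i. C_k k (\<lambda>x. g' x $ i)" by auto
  show ?case
    using * Suc.IH by (auto intro!: exI[of _ "\<lambda>x. f' x + g' x"] GDERIV_add)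
qed

lemma C_k_mult: "C_k k f \<Longrightarrow> C_k k g \<Longrightarrow> C_k k (\<lambda>x. f x * g x)"
proof (induction k arbitrary: f g)
  case 0
  then show ?case by (auto intro: continuous_intros)
next
  case (Suc k)
  from Suc.prems obtain f' g' where *: "\<forall>x. GDERIV f x :> f' x" "\<forall>i. C_k k (\<lambda>x. f' x $ i)"
    "\<forall>x. GDERIV g x :> g' x" "\<forall>i. C_k k (\<lambda>x. g' x $ i)" by auto
  have fg: "C_k k f" "C_k k g"
    using Suc.prems C_k_Suc_D by blast+
  show ?case
    using * Suc.IH fg
    by (auto intro!: exI[of _ "\<lambda>x. f x *\<^sub>R g' x + g x *\<^sub>R f' x"] GDERIV_mult C_k_add)
qed

lemma C_k_cmult: "C_k k f \<Longrightarrow> C_k k (\<lambda>x. c * f x)"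
  using C_k_mult[OF C_k_const] .

lemma C_k_diff: "C_k k f \<Longrightarrow> C_k k g \<Longrightarrow> C_k k (\<lambda>x. f x - g x)"
  using C_k_add[of k f "\<lambda>x. (-1) * g x"] C_k_cmult[of k g "-1"] by simp

lemma C_k_sum: "(\<And>i. i \<in> I \<Longrightarrow> C_k k (f i)) \<Longrightarrow> C_k k (\<lambda>x. \<Sum>i\<in>I. f i x)"
  by (induction I rule: infinite_finite_induct) (auto intro: C_k_const C_k_add)

lemma C_k_coord: "C_k k (\<lambda>x::real^'n. x $ i)"
proof (cases k)
  case (Suc m)
  have "GDERIV (\<lambda>x. x $ i) x :> axis i 1" for x :: "real^'n"
    unfolding gderiv_def inner_axis
    using bounded_linear_imp_has_derivative[OF bounded_linear_vec_nth] by simp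
  then show ?thesis
    unfolding Suc by (auto intro!: exI[of _ "\<lambda>x. axis i 1"] C_k_const)
qed (auto intro!: continuous_intros)

lemma C_k_inverse:
  assumes "\<And>x. f x \<noteq> 0"
  shows "C_k k f \<Longrightarrow> C_k k (\<lambda>x. inverse (f x))"
proof (induction k)
  case 0
  then show ?case using assms by (auto intro: continuous_intros)
next
  case (Suc k)
  from Suc.prems obtain f' where *: "\<forall>x. GDERIV f x :> f' x" "\<forall>i. C_k k (\<lambda>x. f' x $ i)"
    by auto
  have "C_k k (\<lambda>x. inverse (f x))"
    using Suc C_k_Suc_D by blast
  then have "C_k k (\<lambda>x. (- (inverse (f x))\<^sup>2 *\<^sub>R f' x) $ i)" for i
    using * C_k_cmult[OF C_k_mult[OF C_k_mult[of k "\<lambda>x. inverse (f x)" "\<lambda>x. inverse (f x)"]], of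
        "\<lambda>x. f' x $ i" "-1"]
    by (simp add: power2_eq_square)
  then show ?case
    using * assms by (auto intro!: exI[of _ "\<lambda>x. - (inverse (f x))\<^sup>2 *\<^sub>R f' x"] GDERIV_inverse)
qed

lemma GDERIV_translate:
  assumes "GDERIV f (x - a) :> d"
  shows "GDERIV (\<lambda>x. f (x - a)) x :> d"
proof -
  have "((\<lambda>x. x - a) has_derivative (\<lambda>h. h)) (at x)"
    by (auto intro!: derivative_eq_intros)
  from diff_chain_at[OF this assms[unfolded gderiv_def]] show ?thesis
    unfolding gderiv_def by (simp add: o_def)
qed

lemma C_k_translate: "C_k k f \<Longrightarrow> C_k k (\<lambda>x. f (x - a))"
proof (induction k arbitrary: f)
  case 0
  then show ?case
    by (auto intro!: continuous_on_compose2[of UNIV f] continuous_intros)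
next
  case (Suc k)
  from Suc.prems obtain f' where *: "\<forall>x. GDERIV f x :> f' x" "\<forall>i. C_k k (\<lambda>x. f' x $ i)"
    by auto
  show ?case
    using * Suc.IH by (auto intro!: exI[of _ "\<lambda>x. f' (x - a)"] GDERIV_translate)
qed

text \<open>The functions that arise from \<open>exp (- 1 / t)\<close>, extended by \<open>0\<close> to \<open>t \<le> 0\<close>, by repeated
  differentiation.  The polynomial \<open>p\<close> makes the family closed under differentiation.\<close>

definition flat :: "real poly \<Rightarrow> real \<Rightarrow> real" where
  "flat p t = (if t \<le> 0 then 0 else poly p (1 / t) * exp (- (1 / t)))"

text \<open>At \<open>0\<close> the difference quotient of a function of the family is again a polynomial in \<open>1 / t\<close> times
  \<open>exp (- 1 / t)\<close>, so every one-sided limit that occurs is of the following kind.\<close>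

lemma poly_times_exp_tendsto_0: "((\<lambda>s. poly p s * exp (- s)) \<longlongrightarrow> (0::real)) at_top"
proof (induction p)
  case 0
  then show ?case by simp
next
  case (pCons a p)
  have mono: "((\<lambda>s. s ^ k * exp (- s)) \<longlongrightarrow> (0::real)) at_top" for k
    using tendsto_power_div_exp_0[of k] by (simp add: exp_minus divide_inverse)
  have "((\<lambda>s. \<Sum>i\<le>degree (pCons a p). coeff (pCons a p) i * (s ^ i * exp (- s))) \<longlongrightarrow>
      (\<Sum>i\<le>degree (pCons a p). coeff (pCons a p) i * 0)) at_top"
    by (intro tendsto_sum tendsto_mult tendsto_const mono)
  then show ?case
    by (simp add: poly_altdef sum_distrib_right mult.assoc)
qed

lemma flat_has_derivative:
  "(flat p has_real_derivative flat (monom 1 2 * (p - pderiv p)) t) (at t)"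
proof -
  consider "t > 0" | "t < 0" | "t = 0" by linarith
  then show ?thesis
  proof cases
    case 1
    have "((\<lambda>t. poly p (1 / t) * exp (- (1 / t))) has_real_derivative
        flat (monom 1 2 * (p - pderiv p)) t) (at t)"
      using 1
      by (auto intro!: derivative_eq_intros simp: flat_def poly_monom field_simps power2_eq_square)
    then show ?thesis
      by (rule has_field_derivative_transform_within[of _ _ _ _ t])
          (use 1 in \<open>auto simp: flat_def dist_real_def\<close>)
  next
    case 2
    have "((\<lambda>t. 0) has_real_derivative flat (monom 1 2 * (p - pderiv p)) t) (at t)"
      using 2 by (auto simp: flat_def)
    then show ?thesis
      by (rule has_field_derivative_transform_within[of _ _ _ _ "-t"])
          (use 2 in \<open>auto simp: flat_def dist_real_def\<close>)
  next
    case 3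
    have "((\<lambda>h. flat p h / h) \<longlongrightarrow> 0) (at_right 0)"
    proof -
      have "((\<lambda>s. poly (monom 1 1 * p) s * exp (- s)) \<longlongrightarrow> (0::real)) at_top"
        by (rule poly_times_exp_tendsto_0)
      then have "((\<lambda>t. poly (monom 1 1 * p) (inverse t) * exp (- inverse t)) \<longlongrightarrow> (0::real)) (at_right 0)"
        by (rule filterlim_compose[OF _ filterlim_inverse_at_top_right])
      then show ?thesis
        by (rule Lim_transform_eventually)
          (auto simp: eventually_at_right_less flat_def poly_monom field_simps intro!:
              eventually_at_rightI[of 0 1])
    qed
    moreover have "((\<lambda>h. flat p h / h) \<longlongrightarrow> 0) (at_left 0)"
      by (rule Lim_transform_eventually[OF tendsto_const])
        (auto simp: flat_def intro!: eventually_at_leftI[of "-1" 0])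
    ultimately have "((\<lambda>h. flat p h / h) \<longlongrightarrow> 0) (at 0)"
      by (rule filterlim_split_at_real[rotated])
    then show ?thesis
      unfolding 3 by (simp add: DERIV_def) (simp add: flat_def)
  qed
qed

lemma C_k_flat:
  assumes "smooth q"
  shows "C_k k (\<lambda>x. flat p (q x))"
proof (induction k arbitrary: p)
  case 0
  have "continuous_on UNIV (flat p)"
    using flat_has_derivative by (blast intro: continuous_at_imp_continuous_on DERIV_isCont)
  moreover have "continuous_on UNIV q"
    using assms C_k_imp_continuous by blast
  ultimately show ?case
    by (auto intro: continuous_on_compose2)
next
  case (Suc k)
  have "C_k (Suc k) q" using assms by blast
  then obtain q' where q': "\<forall>x. GDERIV q x :> q' x" "\<forall>i. C_k k (\<lambda>x. q' x $ i)" by auto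
  have "GDERIV (\<lambda>x. flat p (q x)) x :> flat (monom 1 2 * (p - pderiv p)) (q x) *\<^sub>R q' x" for x
    using q' by (intro GDERIV_DERIV_compose flat_has_derivative) auto
  then show ?case
    using q' Suc
    by (auto intro!: exI[of _ "\<lambda>x. flat (monom 1 2 * (p - pderiv p)) (q x) *\<^sub>R q' x"] C_k_mult)
qed

lemma flat_one_pos: "0 < flat 1 t \<longleftrightarrow> 0 < t" and flat_one_nonneg: "0 \<le> flat 1 t"
  and flat_one_eq_0: "t \<le> 0 \<Longrightarrow> flat 1 t = 0"
  by (auto simp: flat_def)

lemma smooth_norm_sq: "smooth (\<lambda>x::real^'n. (norm (x - a))\<^sup>2)"
proof -
  have "(norm (x - a))\<^sup>2 = (\<Sum>i\<in>UNIV. (x $ i - a $ i) * (x $ i - a $ i))" for x :: "real^'n"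
    by (simp add: power2_norm_eq_inner inner_vec_def)
  then show ?thesis
    by (simp add: C_k_sum C_k_mult C_k_diff C_k_coord C_k_const)
qed

section \<open>Test functions\<close>

lemma test_functionD:
  assumes "test_function U \<phi>"
  shows "smooth \<phi>" "compact (closure {x. \<phi> x \<noteq> 0})" "closure {x. \<phi> x \<noteq> 0} \<subseteq> U"
  using assms unfolding test_function_def by auto

lemma outside_support: "x \<notin> closure {x. \<phi> x \<noteq> 0} \<Longrightarrow> \<phi> x = 0"
  using closure_subset[of "{x. \<phi> x \<noteq> 0}"] by auto

lemma test_functionI:
  assumes "smooth \<phi>" "compact A" "A \<subseteq> U" "\<And>x. x \<notin> A \<Longrightarrow> \<phi> x = 0"
  shows "test_function U \<phi>"
proof -
  have "closure {x. \<phi> x \<noteq> 0} \<subseteq> A"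
    using assms compact_imp_closed by (intro closure_minimal) auto
  moreover from this have "compact (closure {x. \<phi> x \<noteq> 0})"
    using compact_Int_closed[OF assms(2) closed_closure, of "{x. \<phi> x \<noteq> 0}"] by (simp add: Int_absorb1)
  ultimately show ?thesis
    using assms unfolding test_function_def by auto
qed

lemma test_function_mono: "test_function U \<phi> \<Longrightarrow> U \<subseteq> V \<Longrightarrow> test_function V \<phi>"
  unfolding test_function_def by auto

lemma test_function_outside:
  assumes "test_function U \<phi>" "x \<notin> U"
  shows "\<phi> x = 0"
proof -
  have "x \<notin> {x. \<phi> x \<noteq> 0}"
    using test_functionD(3)[OF assms(1)] assms(2) closure_subset[of "{x. \<phi> x \<noteq> 0}"] by (meson subsetD)
  then show ?thesis by simp
qed

lemma smooth_GDERIV: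
  assumes "smooth \<phi>"
  shows "GDERIV \<phi> x :> grad \<phi> x"
proof -
  have "C_k (Suc 0) \<phi>" using assms by blast
  then show ?thesis using GDERIV_grad by fastforce
qed

lemma smooth_grad:
  assumes "smooth \<phi>"
  shows "C_k k (\<lambda>x. grad \<phi> x $ i)"
proof -
  have "C_k (Suc k) \<phi>" using assms by blast
  then obtain g where g: "\<forall>x. GDERIV \<phi> x :> g x" "C_k k (\<lambda>x. g x $ i)" by auto
  then have "grad \<phi> = g" using grad_eqI by blast
  with g show ?thesis by simp
qed

lemma smooth_continuous: "smooth \<phi> \<Longrightarrow> continuous_on UNIV \<phi>"
  using C_k_imp_continuous by blast

lemma smooth_grad_continuous:
  assumes "smooth \<phi>"
  shows "continuous_on UNIV (grad \<phi>)"
  using C_k_imp_continuous[OF smooth_grad[OF assms]]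
  by (simp add: continuous_on_componentwise[of _ "grad \<phi>"] Basis_vec_def inner_axis)

lemma grad_outside_support:
  assumes "x \<notin> closure {x. \<phi> x \<noteq> 0}"
  shows "grad \<phi> x = 0"
proof -
  have "GDERIV (\<lambda>x. 0) x :> 0" by (rule GDERIV_const)
  then have "GDERIV \<phi> x :> 0"
    unfolding gderiv_def
    by (rule has_derivative_transform_within_open[of _ _ _ _ "- closure {x. \<phi> x \<noteq> 0}"])
      (use assms closure_subset[of "{x. \<phi> x \<noteq> 0}"] in auto)
  then show ?thesis by (rule grad_eqI)
qed

lemma test_function_mult:
  assumes "test_function U \<phi>" "smooth \<psi>"
  shows "test_function U (\<lambda>x. \<phi> x * \<psi> x)"
  using test_functionD[OF assms(1)] assms(2) closure_subset[of "{x. \<phi> x \<noteq> 0}"]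
  by (intro test_functionI[of _ "closure {x. \<phi> x \<noteq> 0}"]) (auto intro: C_k_mult)

lemma grad_mult:
  assumes "smooth \<phi>" "smooth \<psi>"
  shows "grad (\<lambda>x. \<phi> x * \<psi> x) x = \<phi> x *\<^sub>R grad \<psi> x + \<psi> x *\<^sub>R grad \<phi> x"
  using assms by (intro grad_eqI GDERIV_mult smooth_GDERIV)

lemma grad_translate:
  assumes "smooth \<phi>"
  shows "grad (\<lambda>x. \<phi> (x - a)) x = grad \<phi> (x - a)"
  using assms by (intro grad_eqI GDERIV_translate smooth_GDERIV)

lemma test_function_translate:
  assumes "test_function UNIV \<phi>"
  shows "test_function UNIV (\<lambda>x. \<phi> (x - a))"
proof (rule test_functionI)
  show "compact ((\<lambda>x. x + a) ` closure {x. \<phi> x \<noteq> 0})"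
    using test_functionD(2)[OF assms] by (intro compact_continuous_image continuous_intros)
  show "\<phi> (x - a) = 0" if "x \<notin> (\<lambda>x. x + a) ` closure {x. \<phi> x \<noteq> 0}" for x
    using that closure_subset[of "{x. \<phi> x \<noteq> 0}"] by (force simp: image_iff)
qed (use test_functionD(1)[OF assms] C_k_translate in auto)

lemma continuous_compact_support_bounded:
  fixes h :: "'a::topological_space \<Rightarrow> 'b::real_normed_vector"
  assumes "continuous_on UNIV h" "compact A" "\<And>x. x \<notin> A \<Longrightarrow> h x = 0"
  shows "\<exists>B\<ge>0. \<forall>x. norm (h x) \<le> B"
proof -
  have "bounded (h ` A)"
    using assms by (intro compact_imp_bounded compact_continuous_image) (auto intro: continuous_on_subset)
  then obtain B where B: "B > 0" "\<And>x. x \<in> A \<Longrightarrow> norm (h x) \<le> B"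
    unfolding bounded_pos by auto
  show ?thesis
    by (rule exI[of _ B]) (use B assms(3) in force)
qed

lemma test_function_bounded:
  assumes "test_function U \<phi>"
  shows "\<exists>B\<ge>0. \<forall>x. \<bar>\<phi> x\<bar> \<le> B \<and> norm (grad \<phi> x) \<le> B"
proof -
  note D = test_functionD[OF assms]
  obtain B1 where B1: "B1 \<ge> 0" "\<And>x. norm (\<phi> x) \<le> B1"
    using continuous_compact_support_bounded[OF smooth_continuous[OF D(1)] D(2)]
      closure_subset[of "{x. \<phi> x \<noteq> 0}"] by blast
  obtain B2 where B2: "B2 \<ge> 0" "\<And>x. norm (grad \<phi> x) \<le> B2"
    using continuous_compact_support_bounded[OF smooth_grad_continuous[OF D(1)] D(2)] grad_outside_support
    by blast
  show ?thesis
    by (rule exI[of _ "max B1 B2"]) (use B1 B2 in \<open>force simp: le_max_iff_disj\<close>)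
qed

text \<open>A quotient of flat functions of the distance to \<open>a\<close> is a smooth step from \<open>1\<close> to \<open>0\<close>.\<close>

lemma ball_cutoff:
  fixes a :: "real^'n"
  assumes "0 < r" "r < R"
  shows "\<exists>\<phi>. smooth \<phi> \<and> (\<forall>x. 0 \<le> \<phi> x \<and> \<phi> x \<le> 1) \<and> (\<forall>x\<in>cball a r. \<phi> x = 1) \<and>
    (\<forall>x. x \<notin> ball a R \<longrightarrow> \<phi> x = 0)"
proof -
  define f where "f x = flat 1 (R\<^sup>2 - (norm (x - a))\<^sup>2)" for x
  define g where "g x = flat 1 ((norm (x - a))\<^sup>2 - r\<^sup>2)" for x
  have "smooth f" "smooth g"
    unfolding f_def g_def by (auto intro!: C_k_flat C_k_diff C_k_const smooth_norm_sq[rule_format])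
  moreover have pos: "f x + g x > 0" for x
  proof -
    have "r\<^sup>2 < R\<^sup>2" using assms by (intro power_strict_mono) auto
    then have "R\<^sup>2 - (norm (x - a))\<^sup>2 > 0 \<or> (norm (x - a))\<^sup>2 - r\<^sup>2 > 0" by linarith
    then show ?thesis
      unfolding f_def g_def using flat_one_pos flat_one_nonneg
      by (metis add_nonneg_pos add_pos_nonneg)
  qed
  ultimately have "smooth (\<lambda>x. f x * inverse (f x + g x))"
    by (intro allI C_k_mult C_k_inverse C_k_add) (auto simp: less_imp_neq[symmetric])
  moreover have "0 \<le> f x * inverse (f x + g x) \<and> f x * inverse (f x + g x) \<le> 1" for x
    using pos[of x] flat_one_nonneg unfolding f_def g_def by (simp add: field_simps)
  moreover have "f x * inverse (f x + g x) = 1" if "x \<in> cball a r" for x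
  proof -
    have "(norm (x - a))\<^sup>2 \<le> r\<^sup>2"
      using that by (intro power_mono) (auto simp: dist_norm norm_minus_commute)
    then have "g x = 0" unfolding g_def by (intro flat_one_eq_0) simp
    then show ?thesis using pos[of x] by simp
  qed
  moreover have "f x * inverse (f x + g x) = 0" if "x \<notin> ball a R" for x
  proof -
    have "R\<^sup>2 \<le> (norm (x - a))\<^sup>2"
      using that assms by (intro power_mono) (auto simp: dist_norm norm_minus_commute)
    then have "f x = 0" unfolding f_def by (intro flat_one_eq_0) simp
    then show ?thesis by simp
  qed
  ultimately show ?thesis by (intro exI[of _ "\<lambda>x. f x * inverse (f x + g x)"]) auto
qed

text \<open>With \<open>q\<^sub>x\<close> a cut-off for a ball at \<open>x\<close>, the products \<open>q\<^sub>x \<Prod>(1 - q\<^sub>y)\<close> over the balls chosen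
  earlier telescope to \<open>1 - \<Prod>(1 - q\<^sub>x)\<close>, and on \<open>A\<close> one of the factors vanishes.\<close>

lemma smooth_partition_of_unity:
  fixes A :: "(real^'n) set"
  assumes "compact A" "\<forall>x\<in>A. r x > 0"
  shows "\<exists>I p V. finite I \<and> I \<subseteq> A \<and> open V \<and> A \<subseteq> V \<and> (\<forall>x\<in>I. test_function (ball x (r x)) (p x)) \<and>
    (\<forall>z. 0 \<le> (\<Sum>x\<in>I. p x z) \<and> (\<Sum>x\<in>I. p x z) \<le> 1) \<and> (\<forall>z\<in>V. (\<Sum>x\<in>I. p x z) = 1)"
proof -
  have "A \<subseteq> (\<Union>x\<in>A. ball x (r x / 3))" using assms(2) by force
  then obtain I where I: "I \<subseteq> A" "finite I" "A \<subseteq> (\<Union>x\<in>I. ball x (r x / 3))"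
    using compactE_image[OF assms(1), of A "\<lambda>x. ball x (r x / 3)"] by auto
  define V where "V = (\<Union>x\<in>I. ball x (r x / 3))"
  have "\<exists>\<phi>. smooth \<phi> \<and> (\<forall>z. 0 \<le> \<phi> z \<and> \<phi> z \<le> 1) \<and> (\<forall>z\<in>cball x (r x / 3). \<phi> z = 1) \<and>
    (\<forall>z. z \<notin> ball x (r x / 2) \<longrightarrow> \<phi> z = 0)" if "x \<in> I" for x
    using that I assms(2) by (intro ball_cutoff) auto
  then obtain q where q: "\<And>x. x \<in> I \<Longrightarrow> smooth (q x)" "\<And>x z. x \<in> I \<Longrightarrow> 0 \<le> q x z \<and> q x z \<le> 1"
    "\<And>x z. x \<in> I \<Longrightarrow> z \<in> cball x (r x / 3) \<Longrightarrow> q x z = 1"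
    "\<And>x z. x \<in> I \<Longrightarrow> z \<notin> ball x (r x / 2) \<Longrightarrow> q x z = 0"
    by metis
  have tf: "test_function (ball x (r x)) (\<lambda>z. q x z * s z)" if "x \<in> I" "smooth s" for x s
  proof (rule test_functionI[of _ "cball x (r x / 2)"])
    show "smooth (\<lambda>z. q x z * s z)" using that q(1) C_k_mult by blast
    show "cball x (r x / 2) \<subseteq> ball x (r x)" using that I assms(2) by fastforce
    show "q x z * s z = 0" if "z \<notin> cball x (r x / 2)" for z
      using that q(4)[OF \<open>x \<in> I\<close>] by auto
  qed auto
  have "\<exists>p. (\<forall>x\<in>J. test_function (ball x (r x)) (p x)) \<and>
      (\<forall>z. (\<Sum>x\<in>J. p x z) = 1 - (\<Prod>x\<in>J. (1 - q x z)))" if "finite J" "J \<subseteq> I" for J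
    using that
  proof (induction J)
    case empty
    then show ?case by auto
  next
    case (insert y J)
    then obtain p where p: "\<forall>x\<in>J. test_function (ball x (r x)) (p x)"
      "\<And>z. (\<Sum>x\<in>J. p x z) = 1 - (\<Prod>x\<in>J. (1 - q x z))" by auto
    have "smooth (\<lambda>z. \<Sum>x\<in>J. p x z)"
      using p(1) test_functionD(1) by (blast intro: C_k_sum)
    then have "smooth (\<lambda>z. \<Prod>x\<in>J. (1 - q x z))"
      using p(2) C_k_diff[OF C_k_const[of _ 1]] by fastforce
    with insert have "test_function (ball y (r y)) (\<lambda>z. q y z * (\<Prod>x\<in>J. (1 - q x z)))"
      by (intro tf) auto
    moreover have "(\<Sum>x\<in>J. (if x = y then (\<lambda>z. q y z * (\<Prod>x\<in>J. (1 - q x z))) else p x) z) = (\<Sum>x\<in>J. p x z)" for z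
      using insert by (intro sum.cong) auto
    ultimately show ?case
      using p insert by (intro exI[of _ "p(y := (\<lambda>z. q y z * (\<Prod>x\<in>J. (1 - q x z))))"])
        (auto simp: algebra_simps fun_upd_def)
  qed
  from this[OF I(2) order_refl] obtain p where p: "\<forall>x\<in>I. test_function (ball x (r x)) (p x)"
    "\<And>z. (\<Sum>x\<in>I. p x z) = 1 - (\<Prod>x\<in>I. (1 - q x z))" by blast
  have "0 \<le> (\<Prod>x\<in>I. (1 - q x z)) \<and> (\<Prod>x\<in>I. (1 - q x z)) \<le> 1" for z
    using q(2) by (auto intro!: prod_nonneg prod_le_1)
  moreover have "(\<Prod>x\<in>I. (1 - q x z)) = 0" if "z \<in> V" for z
    using that q(3) I(2) unfolding V_def by (subst prod_zero_iff) force+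
  moreover have "open V" "A \<subseteq> V" using I unfolding V_def by auto
  ultimately show ?thesis
    using I p by (intro exI[of _ I] exI[of _ p] exI[of _ V]) auto
qed

lemma test_function_sum:
  assumes "finite I" "\<And>i. i \<in> I \<Longrightarrow> test_function U (p i)"
  shows "test_function U (\<lambda>x. \<Sum>i\<in>I. p i x)"
proof (rule test_functionI[of _ "\<Union>i\<in>I. closure {x. p i x \<noteq> 0}"])
  show "smooth (\<lambda>x. \<Sum>i\<in>I. p i x)" using assms(2) test_functionD(1) by (blast intro: C_k_sum)
  show "compact (\<Union>i\<in>I. closure {x. p i x \<noteq> 0})" using assms test_functionD(2) by blast
  show "(\<Union>i\<in>I. closure {x. p i x \<noteq> 0}) \<subseteq> U" using assms(2) test_functionD(3) by blast
  show "(\<Sum>i\<in>I. p i x) = 0" if "x \<notin> (\<Union>i\<in>I. closure {x. p i x \<noteq> 0})" for x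
    using that by (intro sum.neutral ballI outside_support) auto
qed

lemma cutoff_exists:
  fixes A :: "(real^'n) set"
  assumes "compact A" "open U" "A \<subseteq> U"
  shows "\<exists>p V. test_function U p \<and> (\<forall>x. 0 \<le> p x \<and> p x \<le> 1) \<and> open V \<and> A \<subseteq> V \<and> (\<forall>x\<in>V. p x = 1)"
proof -
  have "\<exists>r>0. ball x r \<subseteq> U" if "x \<in> A" for x
    using assms that openE by blast
  then obtain r where r: "\<forall>x\<in>A. r x > 0" "\<And>x. x \<in> A \<Longrightarrow> ball x (r x) \<subseteq> U" by metis
  from smooth_partition_of_unity[OF assms(1) r(1)]
  obtain I p V where *: "finite I" "I \<subseteq> A" "open V" "A \<subseteq> V" "\<forall>x\<in>I. test_function (ball x (r x)) (p x)"
    "\<forall>z. 0 \<le> (\<Sum>x\<in>I. p x z) \<and> (\<Sum>x\<in>I. p x z) \<le> 1" "\<forall>z\<in>V. (\<Sum>x\<in>I. p x z) = 1" by (elim exE conjE)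
  have "test_function U (\<lambda>z. \<Sum>x\<in>I. p x z)"
    using *(2,5) r(2) by (intro test_function_sum *(1)) (meson subsetD test_function_mono)
  then show ?thesis using * by (intro exI[of _ "\<lambda>z. \<Sum>x\<in>I. p x z"] exI[of _ V]) auto
qed

section \<open>Translations and averages in \<open>L\<^sup>2\<close>\<close>

lemma integral_translate:
  fixes f :: "'a::euclidean_space \<Rightarrow> 'b::{banach, second_countable_topology}"
  shows "f \<in> borel_measurable borel \<Longrightarrow> (LBINT x. f (x + a)) = (LBINT x. f x)"
  using integral_distr[of "(+) a" lborel borel f] lborel_distr_plus[of a] by (simp add: add.commute)

lemma integrable_translate:
  fixes f :: "'a::euclidean_space \<Rightarrow> 'b::{banach, second_countable_topology}"
  assumes "integrable lborel f"
  shows "integrable lborel (\<lambda>x. f (x + a))"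
  using integrable_distr_eq[of "(+) a" lborel borel f] lborel_distr_plus[of a] assms
  by (simp add: add.commute borel_measurable_integrable)

lemma nn_integral_translate:
  fixes f :: "'a::euclidean_space \<Rightarrow> ennreal"
  assumes [measurable]: "f \<in> borel_measurable borel"
  shows "(\<integral>\<^sup>+x. f (x + a) \<partial>lborel) = (\<integral>\<^sup>+x. f x \<partial>lborel)"
  using nn_integral_distr[of "(+) a" lborel borel f] lborel_distr_plus[of a] by (simp add: add.commute)

text \<open>Squeeze \<open>A\<close> between a compact \<open>T\<close> and an open \<open>S\<close> of almost the same measure.  A small translate of
  \<open>T\<close> stays inside \<open>S\<close>, so the indicators of \<open>A\<close> and of its translate are both close to that of \<open>S\<close>.\<close>

lemma L1_translation_indicator:
  fixes A :: "'a::euclidean_space set"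
  assumes A: "A \<in> sets borel" "emeasure lborel A < \<infinity>" and e: "e > 0"
  shows "\<exists>d>0. \<forall>z. norm z < d \<longrightarrow> (LBINT x. \<bar>indicator A (x + z) - indicator A x\<bar>) < (e::real)"
proof -
  have AL: "A \<in> sets lebesgue" using A by simp
  have [measurable]: "A \<in> sets borel" using A by simp
  obtain S where S: "open S" "A \<subseteq> S" "emeasure lebesgue (S - A) < ennreal (e / 9)"
    using sets_lebesgue_outer_open[OF AL, of "e/9"] e by (metis zero_less_divide_iff zero_less_numeral)
  obtain T' where T': "closed T'" "T' \<subseteq> A" "emeasure lebesgue (A - T') < ennreal (e / 9)"
    using sets_lebesgue_inner_closed[OF AL, of "e/9"] e by (metis zero_less_divide_iff zero_less_numeral)
  have [measurable]: "S \<in> sets borel" "T' \<in> sets borel" using S T' by auto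
  have "(\<lambda>n. emeasure lborel (A - cball 0 (real n))) \<longlonglongrightarrow> emeasure lborel (\<Inter>n. A - cball 0 (real n))"
  proof (rule Lim_emeasure_decseq)
    show "decseq (\<lambda>n. A - cball 0 (real n))" by (auto simp: decseq_def)
    show "emeasure lborel (A - cball 0 (real n)) \<noteq> \<infinity>" for n
      using emeasure_mono[of "A - cball 0 (real n)" A lborel] A by (auto simp: top_unique)
  qed auto
  moreover have "(\<Inter>n. A - cball 0 (real n)) = {}"
    using real_arch_simple by auto
  ultimately have "(\<lambda>n. emeasure lborel (A - cball 0 (real n))) \<longlonglongrightarrow> 0"
    by (simp only: emeasure_empty)
  then have "\<forall>\<^sub>F n in sequentially. emeasure lborel (A - cball 0 (real n)) < ennreal (e / 9)"
    using e by (intro order_tendstoD) auto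
  then obtain n where n: "emeasure lborel (A - cball 0 (real n)) < ennreal (e / 9)"
    using eventually_happens'[OF sequentially_bot] by blast
  define T where "T = T' \<inter> cball 0 (real n)"
  have T: "compact T" "T \<subseteq> A" "T \<subseteq> S"
    using T' S unfolding T_def by (auto intro: closed_Int_compact)
  have [measurable]: "T \<in> sets borel" using compact_imp_closed[OF T(1)] by simp
  obtain d where d: "d > 0" "\<And>x y. x \<in> T \<Longrightarrow> norm y < d \<Longrightarrow> x + y \<in> S"
  proof -
    obtain d where d: "d > 0" "(\<Union>x\<in>T. ball x d) \<subseteq> S"
      using compact_subset_open_imp_ball_epsilon_subset[OF T(1) S(1) T(3)] .
    have "x + y \<in> S" if "x \<in> T" "norm y < d" for x y
      using d(2) that by (intro subsetD[OF d(2)] UN_I[of x]) (auto simp: dist_norm)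
    with d(1) show thesis by (rule that)
  qed
  have fin: "emeasure lborel A < \<infinity>" using A by simp
  have SA: "emeasure lborel (S - A) < ennreal (e / 9)" using S(3) by simp
  have finS: "emeasure lborel S < \<infinity>"
  proof -
    have "emeasure lborel S \<le> emeasure lborel A + emeasure lborel (S - A)"
      using emeasure_subadditive[of A lborel "S - A"] S(2) by (simp add: Un_absorb1)
    also have "\<dots> < \<infinity>" using fin SA by (auto simp: less_top[symmetric])
    finally show ?thesis .
  qed
  have finT: "emeasure lborel T < \<infinity>"
    using emeasure_mono[OF T(2), of lborel] fin by (auto simp: less_top[symmetric] top_unique)
  have mSA: "measure lborel S - measure lborel A < e / 9"
  proof -
    have "measure lborel (S - A) = measure lborel S - measure lborel A"
      using S(2) finS by (intro measure_Diff) auto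
    moreover have "measure lborel (S - A) < e / 9"
      using SA e unfolding measure_def by (cases "emeasure lborel (S - A)") (auto simp: ennreal_less_iff)
    ultimately show ?thesis by simp
  qed
  have mAT: "measure lborel A - measure lborel T < 2 * e / 9"
  proof -
    have "emeasure lborel (A - T) \<le> emeasure lborel (A - T') + emeasure lborel (A - cball 0 (real n))"
      unfolding T_def by (subst Diff_Int) (intro emeasure_subadditive; measurable)
    also have "\<dots> < ennreal (e / 9) + ennreal (e / 9)"
      using n T'(3) by (intro add_strict_mono) auto
    also have "\<dots> = ennreal (2 * e / 9)" using e by (simp add: ennreal_plus[symmetric] del: ennreal_plus)
    finally have "measure lborel (A - T) < 2 * e / 9"
      using e unfolding measure_def by (cases "emeasure lborel (A - T)") (auto simp: ennreal_less_iff)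
    moreover have "measure lborel (A - T) = measure lborel A - measure lborel T"
      using T(2) fin by (intro measure_Diff) auto
    ultimately show ?thesis by simp
  qed
  have i: "integrable lborel (indicator A :: 'a \<Rightarrow> real)" "integrable lborel (indicator S :: 'a \<Rightarrow> real)"
      "integrable lborel (indicator T :: 'a \<Rightarrow> real)"
    using fin finS finT by auto
  show ?thesis
  proof (intro exI[of _ d] conjI allI impI d(1))
    fix z :: 'a assume z: "norm z < d"
    have "(LBINT x. \<bar>indicator A (x + z) - indicator A x\<bar>) \<le>
      (LBINT x. (indicator S x - indicator A x :: real) + (indicator A (x + z) - indicator T (x + z)) +
          (indicator S x - indicator T (x + z)))"
    proof (intro integral_mono integrable_abs Bochner_Integration.integrable_add
        Bochner_Integration.integrable_diff i i[THEN integrable_translate])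
      fix x :: 'a
      have "x \<in> S" if "x + z \<in> T" using d(2)[OF that, of "- z"] z by simp
      then show "\<bar>indicator A (x + z) - indicator A x\<bar> \<le> (indicator S x - indicator A x :: real) +
          (indicator A (x + z) - indicator T (x + z)) + (indicator S x - indicator T (x + z))"
        using T(2) S(2) by (auto simp: indicator_def)
    qed
    also have "\<dots> = (measure lborel A - measure lborel T) + (measure lborel S - measure lborel T) +
        (measure lborel S - measure lborel A)"
      using i integrable_translate[OF i(1), of z] integrable_translate[OF i(3), of z]
      using integral_translate[of "indicator A :: 'a \<Rightarrow> real" z] integral_translate[of
          "indicator T :: 'a \<Rightarrow> real" z]
      by simp
    also have "\<dots> < e" using mSA mAT e by simp
    finally show "(LBINT x. \<bar>indicator A (x + z) - indicator A x\<bar>) < e" .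
  qed
qed

lemma L1_translation:
  fixes f :: "'a::euclidean_space \<Rightarrow> real"
  assumes "integrable lborel f"
  shows "\<forall>e>0. \<exists>d>0. \<forall>z. norm z < d \<longrightarrow> (LBINT x. \<bar>f (x + z) - f x\<bar>) < e"
  using assms
proof (induction f)
  case (base A c)
  show ?case
  proof (intro allI impI)
    fix e :: real assume e: "e > 0"
    have A: "A \<in> sets borel" "emeasure lborel A < \<infinity>" using base by auto
    obtain d where d: "d > 0" "\<And>z. norm z < d \<Longrightarrow> (LBINT x. \<bar>indicator A (x + z) - indicator A x\<bar>) < e / (1
        + \<bar>c\<bar>)"
      using L1_translation_indicator[OF A, of "e / (1 + \<bar>c\<bar>)"] e
      by (metis add_pos_nonneg abs_ge_zero zero_less_one divide_pos_pos)
    show "\<exists>d>0. \<forall>z. norm z < d \<longrightarrow> (LBINT x. \<bar>indicator A (x + z) *\<^sub>R c - indicator A x *\<^sub>R c\<bar>) < e"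
    proof (intro exI[of _ d] conjI allI impI d(1))
      fix z :: 'a assume z: "norm z < d"
      have "\<bar>indicator A (x + z) *\<^sub>R c - indicator A x *\<^sub>R c\<bar> = \<bar>indicator A (x + z) - indicator A x\<bar> * \<bar>c\<bar>"
          for x
        by (simp add: abs_mult[symmetric] algebra_simps)
      then have "(LBINT x. \<bar>indicator A (x + z) *\<^sub>R c - indicator A x *\<^sub>R c\<bar>) =
          (LBINT x. \<bar>indicator A (x + z) - indicator A x\<bar>) * \<bar>c\<bar>" by simp
      also have "\<dots> \<le> (e / (1 + \<bar>c\<bar>)) * \<bar>c\<bar>"
        using d(2)[OF z] by (intro mult_right_mono) auto
      also have "\<dots> < e" using e by (simp add: field_simps)
      finally show "(LBINT x. \<bar>indicator A (x + z) *\<^sub>R c - indicator A x *\<^sub>R c\<bar>) < e" .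
    qed
  qed
next
  case (add f g)
  show ?case
  proof (intro allI impI)
    fix e :: real assume e: "e > 0"
    then have "e / 2 > 0" by simp
    from add.IH(1)[rule_format, OF this] add.IH(2)[rule_format, OF this]
    obtain d1 d2 where d: "d1 > 0" "\<And>z. norm z < d1 \<Longrightarrow> (LBINT x. \<bar>f (x + z) - f x\<bar>) < e / 2"
      "d2 > 0" "\<And>z. norm z < d2 \<Longrightarrow> (LBINT x. \<bar>g (x + z) - g x\<bar>) < e / 2" by auto
    have int: "integrable lborel (\<lambda>x. \<bar>f (x + z) - f x\<bar>)" "integrable lborel (\<lambda>x. \<bar>g (x + z) - g x\<bar>)" for z
      using add.hyps integrable_translate by (auto intro!: integrable_abs Bochner_Integration.integrable_diff)
    show "\<exists>d>0. \<forall>z. norm z < d \<longrightarrow> (LBINT x. \<bar>f (x + z) + g (x + z) - (f x + g x)\<bar>) < e"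
    proof (intro exI[of _ "min d1 d2"] conjI allI impI)
      fix z :: 'a assume z: "norm z < min d1 d2"
      have "(LBINT x. \<bar>f (x + z) + g (x + z) - (f x + g x)\<bar>) \<le>
        (LBINT x. \<bar>f (x + z) - f x\<bar> + \<bar>g (x + z) - g x\<bar>)"
        by (intro integral_mono_AE' AE_I2 Bochner_Integration.integrable_add int) auto
      also have "\<dots> < e" using d(2)[of z] d(4)[of z] z by (simp add: int)
      finally show "(LBINT x. \<bar>f (x + z) + g (x + z) - (f x + g x)\<bar>) < e" .
    qed (use d in auto)
  qed
next
  case (lim f s)
  have [measurable]: "f \<in> borel_measurable borel" "\<And>i. s i \<in> borel_measurable borel"
    using borel_measurable_integrable[OF lim.hyps(1)] borel_measurable_integrable[OF lim.hyps(4)] by simp_all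
  show ?case
  proof (intro allI impI)
    fix e :: real assume e: "e > 0"
    have "(\<lambda>i. \<integral>x. \<bar>s i x - f x\<bar> \<partial>lborel) \<longlonglongrightarrow> (\<integral>x. 0 \<partial>(lborel :: 'a measure))"
    proof (rule integral_dominated_convergence[where s="\<lambda>i x. \<bar>s i x - f x\<bar>" and f="\<lambda>x. 0"
        and w="\<lambda>x. 3 * \<bar>f x\<bar>"])
      show "integrable lborel (\<lambda>x. 3 * \<bar>f x\<bar>)" using lim.hyps(4) by simp
      show "AE x in lborel. (\<lambda>i. \<bar>s i x - f x\<bar>) \<longlonglongrightarrow> 0"
        using lim.hyps(2) by (intro AE_I2 tendsto_rabs_zero) (simp add: LIM_zero)
      show "AE x in lborel. norm \<bar>s i x - f x\<bar> \<le> 3 * \<bar>f x\<bar>" for i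
      proof (intro AE_I2)
        fix x :: 'a assume "x \<in> space lborel"
        with lim.hyps(3)[of x i] show "norm \<bar>s i x - f x\<bar> \<le> 3 * \<bar>f x\<bar>" by auto
      qed
    qed auto
    then have "\<forall>\<^sub>F i in sequentially. (LBINT x. \<bar>s i x - f x\<bar>) < e / 3"
      using e by (intro order_tendstoD) auto
    then obtain i where i: "(LBINT x. \<bar>s i x - f x\<bar>) < e / 3"
      using eventually_happens'[OF sequentially_bot] by blast
    have "e / 3 > 0" using e by simp
    with lim.IH[of i] obtain d where d: "d > 0" "\<And>z. norm z < d \<Longrightarrow> (LBINT x. \<bar>s i (x + z) - s i x\<bar>) < e / 3"
      by metis
    have int: "integrable lborel (\<lambda>x. \<bar>s i x - f x\<bar>)" "integrable lborel (\<lambda>x. \<bar>s i (x + z) - s i x\<bar>)"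
      "integrable lborel (\<lambda>x. \<bar>s i (x + z) - f (x + z)\<bar>)" for z
      using lim.hyps(1,4) by (auto intro!: integrable_abs Bochner_Integration.integrable_diff
          integrable_translate)
    show "\<exists>d>0. \<forall>z. norm z < d \<longrightarrow> (LBINT x. \<bar>f (x + z) - f x\<bar>) < e"
    proof (intro exI[of _ d] conjI allI impI d(1))
      fix z :: 'a assume z: "norm z < d"
      have "(LBINT x. \<bar>f (x + z) - f x\<bar>) \<le>
        (LBINT x. \<bar>s i (x + z) - f (x + z)\<bar> + \<bar>s i (x + z) - s i x\<bar> + \<bar>s i x - f x\<bar>)"
        by (intro integral_mono_AE' AE_I2 Bochner_Integration.integrable_add int) auto
      also have "\<dots> = (LBINT x. \<bar>s i (x + z) - f (x + z)\<bar>) + (LBINT x. \<bar>s i (x + z) - s i x\<bar>) +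
          (LBINT x. \<bar>s i x - f x\<bar>)"
        by (simp add: int)
      also have "(LBINT x. \<bar>s i (x + z) - f (x + z)\<bar>) = (LBINT x. \<bar>s i x - f x\<bar>)"
        using integral_translate[of "\<lambda>x. \<bar>s i x - f x\<bar>" z] by simp
      also have "(LBINT x. \<bar>s i x - f x\<bar>) + (LBINT x. \<bar>s i (x + z) - s i x\<bar>) + (LBINT x. \<bar>s i x - f x\<bar>) < e"
        using i d(2)[OF z] by simp
      finally show "(LBINT x. \<bar>f (x + z) - f x\<bar>) < e" .
    qed
  qed
qed

abbreviation L2 :: "('a::euclidean_space \<Rightarrow> real) \<Rightarrow> bool" where
  "L2 f \<equiv> f \<in> borel_measurable borel \<and> integrable lborel (\<lambda>x. (f x)\<^sup>2)"

text \<open>This inequality carries the continuity of translations from \<open>L\<^sup>1\<close> over to \<open>L\<^sup>2\<close>: for a square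
  integrable \<open>w\<close> it is applied to the integrable function \<open>w |w|\<close>.\<close>

lemma square_diff_le_signed_squares: "(a - b)\<^sup>2 \<le> 2 * \<bar>a * \<bar>a\<bar> - b * \<bar>b\<bar>\<bar>" for a b :: real
proof -
  have same: "(a - b)\<^sup>2 \<le> \<bar>a\<^sup>2 - b\<^sup>2\<bar>" if "0 \<le> a * b" for a b :: real
  proof -
    have "\<bar>a - b\<bar> \<le> \<bar>a + b\<bar>"
      using that by (smt (verit) mult_neg_pos mult_pos_neg zero_le_mult_iff)
    then have "\<bar>a - b\<bar> * \<bar>a - b\<bar> \<le> \<bar>a - b\<bar> * \<bar>a + b\<bar>" by (intro mult_left_mono) auto
    then show ?thesis by (simp add: abs_mult[symmetric] power2_eq_square algebra_simps)
  qed
  have opp: "(a - b)\<^sup>2 \<le> 2 * (a\<^sup>2 + b\<^sup>2)" for a b :: real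
    using zero_le_power2[of "a + b"] by (simp add: power2_eq_square algebra_simps)
  consider "0 \<le> a" "0 \<le> b" | "a \<le> 0" "b \<le> 0" | "0 \<le> a" "b \<le> 0" | "a \<le> 0" "0 \<le> b" by linarith
  then show ?thesis
  proof cases
    case 1
    then have "\<bar>a * \<bar>a\<bar> - b * \<bar>b\<bar>\<bar> = \<bar>a\<^sup>2 - b\<^sup>2\<bar>" by (simp add: power2_eq_square)
    moreover have "(a - b)\<^sup>2 \<le> \<bar>a\<^sup>2 - b\<^sup>2\<bar>" using same[of a b] 1 by simp
    ultimately show ?thesis by argo
  next
    case 2
    then have "\<bar>a * \<bar>a\<bar> - b * \<bar>b\<bar>\<bar> = \<bar>a\<^sup>2 - b\<^sup>2\<bar>" by (simp add: power2_eq_square)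
    moreover have "(a - b)\<^sup>2 \<le> \<bar>a\<^sup>2 - b\<^sup>2\<bar>" using same[of a b] 2 by (simp add: mult_nonpos_nonpos)
    ultimately show ?thesis by argo
  next
    case 3
    then have "\<bar>a * \<bar>a\<bar> - b * \<bar>b\<bar>\<bar> = a\<^sup>2 + b\<^sup>2" by (simp add: power2_eq_square)
    then show ?thesis using opp[of a b] by simp
  next
    case 4
    then have "\<bar>a * \<bar>a\<bar> - b * \<bar>b\<bar>\<bar> = \<bar>- (a\<^sup>2 + b\<^sup>2)\<bar>" by (simp add: power2_eq_square)
    then show ?thesis using opp[of a b] by simp
  qed
qed

lemma L2_translation:
  assumes "L2 w" "e > 0"
  shows "\<exists>d>0. \<forall>z. norm z < d \<longrightarrow> (LBINT x. (w (x + z) - w x)\<^sup>2) < e"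
proof -
  have [measurable]: "w \<in> borel_measurable borel" using assms by blast
  have W: "integrable lborel (\<lambda>x. w x * \<bar>w x\<bar>)"
    by (rule Bochner_Integration.integrable_bound[of lborel "\<lambda>x. (w x)\<^sup>2"])
      (use assms in \<open>auto simp: abs_mult power2_eq_square\<close>)
  obtain d where d: "d > 0" "\<And>z. norm z < d \<Longrightarrow> (LBINT x. \<bar>w (x + z) * \<bar>w (x + z)\<bar> - w x * \<bar>w x\<bar>\<bar>) < e / 2"
    using L1_translation[OF W, rule_format, of "e / 2"] assms(2) by (auto simp del: less_divide_eq_numeral1)
  show ?thesis
  proof (intro exI[of _ d] conjI allI impI d(1))
    fix z :: 'a assume z: "norm z < d"
    have "(LBINT x. (w (x + z) - w x)\<^sup>2) \<le> (LBINT x. 2 * \<bar>w (x + z) * \<bar>w (x + z)\<bar> - w x * \<bar>w x\<bar>\<bar>)"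
      by (intro integral_mono_AE' AE_I2 square_diff_le_signed_squares integrable_mult_right integrable_abs
          Bochner_Integration.integrable_diff W integrable_translate[OF W]) auto
    also have "\<dots> < e" using d(2)[OF z] by simp
    finally show "(LBINT x. (w (x + z) - w x)\<^sup>2) < e" .
  qed
qed

lemma L2_translate: "L2 w \<Longrightarrow> L2 (\<lambda>x. w (x + a))"
  using integrable_translate[of "\<lambda>x. (w x)\<^sup>2" a] by auto

lemma L2_diff: assumes "L2 v" "L2 w" shows "L2 (\<lambda>x. v x - w x)"
proof -
  have [measurable]: "v \<in> borel_measurable borel" "w \<in> borel_measurable borel" using assms by auto
  have "integrable lborel (\<lambda>x. (v x - w x)\<^sup>2)"
  proof (rule Bochner_Integration.integrable_bound[of lborel "\<lambda>x. 2 * (v x)\<^sup>2 + 2 * (w x)\<^sup>2"])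
    show "AE x in lborel. norm ((v x - w x)\<^sup>2) \<le> norm (2 * (v x)\<^sup>2 + 2 * (w x)\<^sup>2)"
    proof (intro AE_I2)
      fix x
      have "(v x - w x)\<^sup>2 \<le> 2 * (v x)\<^sup>2 + 2 * (w x)\<^sup>2"
        using zero_le_power2[of "v x + w x"] by (simp add: power2_eq_square algebra_simps)
      then show "norm ((v x - w x)\<^sup>2) \<le> norm (2 * (v x)\<^sup>2 + 2 * (w x)\<^sup>2)" by simp
    qed
  qed (use assms in auto)
  then show ?thesis by simp
qed

lemma abs_mult_le_squares: "\<bar>a * b\<bar> \<le> a\<^sup>2 + b\<^sup>2" for a b :: real
proof -
  have "2 * (\<bar>a\<bar> * \<bar>b\<bar>) \<le> a\<^sup>2 + b\<^sup>2" using sum_squares_bound[of "\<bar>a\<bar>" "\<bar>b\<bar>"] by simp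
  moreover have "0 \<le> \<bar>a\<bar> * \<bar>b\<bar>" by simp
  ultimately show ?thesis unfolding abs_mult by linarith
qed

lemma L2_mult_integrable: assumes "L2 v" "L2 w" shows "integrable lborel (\<lambda>x. v x * w x)"
proof -
  have [measurable]: "v \<in> borel_measurable borel" "w \<in> borel_measurable borel" using assms by auto
  show ?thesis
  proof (rule Bochner_Integration.integrable_bound[of lborel "\<lambda>x. (v x)\<^sup>2 + (w x)\<^sup>2"])
    show "AE x in lborel. norm (v x * w x) \<le> norm ((v x)\<^sup>2 + (w x)\<^sup>2)"
    proof (intro AE_I2)
      fix x show "norm (v x * w x) \<le> norm ((v x)\<^sup>2 + (w x)\<^sup>2)"
        using abs_mult_le_squares[of "v x" "w x"] by simp
    qed
  qed (use assms in auto)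
qed

text \<open>Jensen's inequality for the square.  If the right-hand side is finite, \<open>F\<close> is integrable; otherwise
  the inequality is trivial, whatever the default value of the integral on the left.\<close>

lemma (in prob_space) square_integral_diff_le:
  assumes [measurable]: "F \<in> borel_measurable M"
  shows "ennreal (((\<integral>y. F y \<partial>M) - k)\<^sup>2) \<le> (\<integral>\<^sup>+y. ennreal ((F y - k)\<^sup>2) \<partial>M)"
proof (cases "(\<integral>\<^sup>+y. ennreal ((F y - k)\<^sup>2) \<partial>M) = \<infinity>")
  case False
  then have i2: "integrable M (\<lambda>y. (F y - k)\<^sup>2)"
    by (intro integrableI_nonneg) (auto simp: less_top[symmetric])
  then have i1: "integrable M (\<lambda>y. F y - k)"
    by (intro square_integrable_imp_integrable[OF _ i2]) measurable
  then have "integrable M (\<lambda>y. (F y - k) + k)" by (intro Bochner_Integration.integrable_add) auto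
  then have "(\<integral>y. F y \<partial>M) - k = (\<integral>y. F y - k \<partial>M)"
    by (simp add: prob_space)
  moreover have "(\<integral>y. F y - k \<partial>M)\<^sup>2 \<le> (\<integral>y. (F y - k)\<^sup>2 \<partial>M)"
    using variance_positive[of "\<lambda>y. F y - k"] variance_eq[OF i1 i2] by simp
  ultimately show ?thesis
    using i2 by (simp add: nn_integral_eq_integral)
qed (simp only: infinity_ennreal_def top_greatest)

text \<open>The averages of a function over \<open>x + t y\<close> with \<open>y\<close> distributed according to \<open>\<nu>\<close>.  Uniform
  measures on segments give difference quotients, uniform measures on balls give mollifications.\<close>

locale averaging = prob_space \<nu> for \<nu> :: "'a::euclidean_space measure" +
  fixes R :: real
  assumes sets_\<nu>: "sets \<nu> = sets borel" and bounded_support: "AE y in \<nu>. norm y \<le> R"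
begin

definition avg :: "real \<Rightarrow> ('a \<Rightarrow> real) \<Rightarrow> 'a \<Rightarrow> real" where
  "avg t w x = (\<integral>y. w (x + t *\<^sub>R y) \<partial>\<nu>)"

lemma measurable_\<nu>[measurable_cong]: "sets \<nu> = sets borel" by (rule sets_\<nu>)

lemma avg_measurable:
  assumes [measurable]: "w \<in> borel_measurable borel"
  shows "avg t w \<in> borel_measurable borel"
  unfolding avg_def by measurable

text \<open>Jensen's inequality under the integral over \<open>x\<close>, and Tonelli: what holds for all translates
  by \<open>t y\<close> holds for their averages.\<close>

lemma nn_integral_shift_le:
  assumes "L2 w" "L2 k"
    and c: "\<And>y. norm y \<le> R \<Longrightarrow> (LBINT x. (w (x + t *\<^sub>R y) - k x)\<^sup>2) \<le> c"
  shows "(\<integral>\<^sup>+x. ennreal ((avg t w x - k x)\<^sup>2) \<partial>lborel) \<le> ennreal c"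
proof -
  have [measurable]: "w \<in> borel_measurable borel" "k \<in> borel_measurable borel" using assms by auto
  interpret lb: pair_sigma_finite lborel \<nu> ..
  have "(\<integral>\<^sup>+x. ennreal ((avg t w x - k x)\<^sup>2) \<partial>lborel) \<le>
      (\<integral>\<^sup>+x. (\<integral>\<^sup>+y. ennreal ((w (x + t *\<^sub>R y) - k x)\<^sup>2) \<partial>\<nu>) \<partial>lborel)"
    unfolding avg_def by (intro nn_integral_mono square_integral_diff_le) auto
  also have "\<dots> = (\<integral>\<^sup>+y. (\<integral>\<^sup>+x. ennreal ((w (x + t *\<^sub>R y) - k x)\<^sup>2) \<partial>lborel) \<partial>\<nu>)"
    by (rule lb.Fubini'[symmetric]) measurable
  also have "\<dots> \<le> (\<integral>\<^sup>+y. ennreal c \<partial>\<nu>)"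
  proof (intro nn_integral_mono_AE)
    show "AE y in \<nu>. (\<integral>\<^sup>+x. ennreal ((w (x + t *\<^sub>R y) - k x)\<^sup>2) \<partial>lborel) \<le> ennreal c"
      using bounded_support
    proof eventually_elim
      case (elim y)
      have "integrable lborel (\<lambda>x. (w (x + t *\<^sub>R y) - k x)\<^sup>2)"
        using L2_diff[OF L2_translate[OF assms(1)] assms(2)] by blast
      then show ?case using c[OF elim] by (simp add: nn_integral_eq_integral ennreal_leI)
    qed
  qed
  also have "\<dots> = ennreal c" by (simp add: emeasure_space_1)
  finally show ?thesis .
qed

lemma avg_L2:
  assumes "L2 w"
  shows "L2 (avg t w)"
proof -
  have [measurable]: "w \<in> borel_measurable borel" using assms by auto
  have "(\<integral>\<^sup>+x. ennreal ((avg t w x - 0)\<^sup>2) \<partial>lborel) \<le> ennreal (LBINT x. (w x)\<^sup>2)"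
    by (rule nn_integral_shift_le[OF assms]) (use integral_translate[of "\<lambda>x. (w x)\<^sup>2"] in auto)
  then have "integrable lborel (\<lambda>x. (avg t w x)\<^sup>2)"
    using avg_measurable[of w t] by (intro integrableI_nonneg) (auto simp: less_top[symmetric] top_unique)
  then show ?thesis using avg_measurable by auto
qed

lemma avg_tendsto:
  assumes "L2 w" "e > 0"
  shows "\<exists>d>0. \<forall>t. \<bar>t\<bar> < d \<longrightarrow> (LBINT x. (avg t w x - w x)\<^sup>2) < e"
proof -
  have [measurable]: "w \<in> borel_measurable borel" using assms by auto
  obtain d where d: "d > 0" "\<And>z. norm z < d \<Longrightarrow> (LBINT x. (w (x + z) - w x)\<^sup>2) < e / 2"
    using L2_translation[OF assms(1), of "e / 2"] assms(2) by (auto simp: half_gt_zero)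
  show ?thesis
  proof (intro exI[of _ "d / (\<bar>R\<bar> + 1)"] conjI allI impI)
    show "d / (\<bar>R\<bar> + 1) > 0" using d(1) by simp
    fix t :: real assume t: "\<bar>t\<bar> < d / (\<bar>R\<bar> + 1)"
    have "(\<integral>\<^sup>+x. ennreal ((avg t w x - w x)\<^sup>2) \<partial>lborel) \<le> ennreal (e / 2)"
    proof (rule nn_integral_shift_le[OF assms(1) assms(1)])
      fix y :: 'a assume "norm y \<le> R"
      then have "norm (t *\<^sub>R y) \<le> \<bar>t\<bar> * (\<bar>R\<bar> + 1)" by (auto intro!: mult_left_mono)
      also have "\<dots> < d" using t by (simp add: field_simps)
      finally show "(LBINT x. (w (x + t *\<^sub>R y) - w x)\<^sup>2) \<le> e / 2" using d(2) less_imp_le by blast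
    qed
    moreover have "integrable lborel (\<lambda>x. (avg t w x - w x)\<^sup>2)"
      using L2_diff[OF avg_L2[OF assms(1)] assms(1)] by blast
    ultimately have "ennreal (LBINT x. (avg t w x - w x)\<^sup>2) \<le> ennreal (e / 2)"
      by (simp add: nn_integral_eq_integral)
    then show "(LBINT x. (avg t w x - w x)\<^sup>2) < e" using assms(2) by (simp add: ennreal_le_iff)
  qed
qed

lemma shift_product_integrable:
  assumes "L2 w" "L2 \<psi>"
  shows "integrable (lborel \<Otimes>\<^sub>M \<nu>) (\<lambda>(x, y). w (x + t *\<^sub>R y) * \<psi> x)"
proof -
  have [measurable]: "w \<in> borel_measurable borel" "\<psi> \<in> borel_measurable borel" using assms by auto
  interpret lb: pair_sigma_finite lborel \<nu> ..
  define c where "c = (LBINT x. (w x)\<^sup>2) + (LBINT x. (\<psi> x)\<^sup>2)"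
  have b: "(\<integral>\<^sup>+x. ennreal (norm (w (x + t *\<^sub>R y) * \<psi> x)) \<partial>lborel) \<le> ennreal c" for y
  proof -
    note i = conjunct2[OF L2_translate[OF assms(1), of "t *\<^sub>R y"]] conjunct2[OF assms(2)]
    have "(\<integral>\<^sup>+x. ennreal (norm (w (x + t *\<^sub>R y) * \<psi> x)) \<partial>lborel) \<le>
        (\<integral>\<^sup>+x. ennreal ((w (x + t *\<^sub>R y))\<^sup>2 + (\<psi> x)\<^sup>2) \<partial>lborel)"
    proof (intro nn_integral_mono ennreal_leI)
      fix x show "norm (w (x + t *\<^sub>R y) * \<psi> x) \<le> (w (x + t *\<^sub>R y))\<^sup>2 + (\<psi> x)\<^sup>2"
        using abs_mult_le_squares[of "w (x + t *\<^sub>R y)" "\<psi> x"] by simp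
    qed
    also have "\<dots> = ennreal c"
      using i integral_translate[of "\<lambda>x. (w x)\<^sup>2" "t *\<^sub>R y"] unfolding c_def
      by (subst nn_integral_eq_integral) auto
    finally show ?thesis .
  qed
  show ?thesis
  proof (rule integrableI_bounded)
    have "(\<integral>\<^sup>+p. ennreal (norm ((\<lambda>(x, y). w (x + t *\<^sub>R y) * \<psi> x) p)) \<partial>(lborel \<Otimes>\<^sub>M \<nu>)) =
      (\<integral>\<^sup>+y. (\<integral>\<^sup>+x. ennreal (norm (w (x + t *\<^sub>R y) * \<psi> x)) \<partial>lborel) \<partial>\<nu>)"
      by (subst lb.nn_integral_snd[symmetric]) auto
    also have "\<dots> \<le> (\<integral>\<^sup>+y. ennreal c \<partial>\<nu>)" by (intro nn_integral_mono b)
    also have "\<dots> < \<infinity>" by (simp add: emeasure_space_1)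
    finally show "(\<integral>\<^sup>+p. ennreal (norm ((\<lambda>(x, y). w (x + t *\<^sub>R y) * \<psi> x) p)) \<partial>(lborel \<Otimes>\<^sub>M \<nu>)) < \<infinity>" .
  qed measurable
qed

text \<open>Fubini moves the averages from a square integrable function to the other factor; for test functions
  the inner integral on the right is a pairing with a translated test function.\<close>

lemma integral_avg_mult:
  assumes "L2 w" "L2 \<psi>"
  shows "(LBINT x. avg t w x * \<psi> x) = (\<integral>y. (LBINT x. w x * \<psi> (x - t *\<^sub>R y)) \<partial>\<nu>)"
proof -
  have [measurable]: "w \<in> borel_measurable borel" "\<psi> \<in> borel_measurable borel" using assms by auto
  interpret lb: pair_sigma_finite lborel \<nu> ..
  have "(LBINT x. avg t w x * \<psi> x) = (LBINT x. (\<integral>y. w (x + t *\<^sub>R y) * \<psi> x \<partial>\<nu>))"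
    unfolding avg_def by simp
  also have "\<dots> = (\<integral>y. (LBINT x. w (x + t *\<^sub>R y) * \<psi> x) \<partial>\<nu>)"
    using lb.Fubini_integral[OF shift_product_integrable[OF assms, of t]] by simp
  also have "\<dots> = (\<integral>y. (LBINT x. w x * \<psi> (x - t *\<^sub>R y)) \<partial>\<nu>)"
  proof (rule Bochner_Integration.integral_cong[OF refl])
    fix y
    show "(LBINT x. w (x + t *\<^sub>R y) * \<psi> x) = (LBINT x. w x * \<psi> (x - t *\<^sub>R y))"
      using integral_translate[of "\<lambda>x. w x * \<psi> (x - t *\<^sub>R y)" "t *\<^sub>R y"] by simp
  qed
  finally show ?thesis .
qed

lemma integral_avg_adjoint:
  assumes "L2 w" "L2 \<psi>"
  shows "(LBINT x. avg t w x * \<psi> x) = (LBINT x. w x * avg (- t) \<psi> x)"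
proof -
  have [measurable]: "w \<in> borel_measurable borel" "\<psi> \<in> borel_measurable borel" using assms by auto
  interpret lb: pair_sigma_finite lborel \<nu> ..
  have "(LBINT x. w x * avg (- t) \<psi> x) = (LBINT x. (\<integral>y. \<psi> (x + (- t) *\<^sub>R y) * w x \<partial>\<nu>))"
    unfolding avg_def by (simp add: mult.commute)
  also have "\<dots> = (\<integral>y. (LBINT x. \<psi> (x + (- t) *\<^sub>R y) * w x) \<partial>\<nu>)"
    using lb.Fubini_integral[OF shift_product_integrable[OF assms(2,1), of "- t"]] by simp
  also have "\<dots> = (LBINT x. avg t w x * \<psi> x)"
    unfolding integral_avg_mult[OF assms] by (simp add: mult.commute)
  finally show ?thesis by simp
qed

end

section \<open>The fundamental lemma of the calculus of variations\<close>

text \<open>The indicator of \<open>A\<close> is a dominated limit of cut-off functions supported in shrinking neighbourhoods.\<close>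

lemma integral_over_compact_eq_0:
  fixes d :: "real^'n \<Rightarrow> real"
  assumes U: "open U" and int: "\<And>B. compact B \<Longrightarrow> B \<subseteq> U \<Longrightarrow> set_integrable lebesgue B d"
    and zero: "\<And>\<phi>. test_function U \<phi> \<Longrightarrow> (LINT x|lebesgue. \<phi> x * d x) = 0"
    and A: "compact A" "A \<subseteq> U"
  shows "(LINT x:A|lebesgue. d x) = 0"
proof (cases "A = {}")
  case False
  obtain p0 V0 where p0: "test_function U p0" "open V0" "A \<subseteq> V0" "\<forall>x\<in>V0. p0 x = 1"
    using cutoff_exists[OF A(1) U A(2)] by (elim exE conjE)
  define B where "B = closure {x. p0 x \<noteq> 0}"
  have B: "compact B" "B \<subseteq> U" using test_functionD[OF p0(1)] unfolding B_def by auto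
  have V0B: "V0 \<subseteq> B" unfolding B_def using p0(4) closure_subset[of "{x. p0 x \<noteq> 0}"] by (auto simp: subset_iff)
  define W where "W n = {x. infdist x A < 1 / real (Suc n)} \<inter> V0" for n
  have "open (W n)" for n
    unfolding W_def by (intro open_Int p0(2) open_Collect_less continuous_intros)
  moreover have "A \<subseteq> W n" for n
    using p0(3) unfolding W_def by (auto simp: infdist_zero)
  ultimately have "\<exists>p V. test_function (W n) p \<and> (\<forall>x. 0 \<le> p x \<and> p x \<le> 1) \<and> open V \<and> A \<subseteq> V \<and> (\<forall>x\<in>V. p x = 1)"
      for n
    using cutoff_exists[OF A(1)] by simp
  then obtain p V where p: "\<And>n. test_function (W n) (p n)" "\<And>n x. 0 \<le> p n x \<and> p n x \<le> 1"
    "\<And>n. A \<subseteq> V n" "\<And>n x. x \<in> V n \<Longrightarrow> p n x = 1"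
    by (metis (no_types))
  have pW: "p n x = 0" if "x \<notin> W n" for n x using test_function_outside[OF p(1) that] .
  have pB: "p n x = 0" if "x \<notin> B" for n x
    using that V0B by (intro pW) (auto simp: W_def)
  have lim: "(\<lambda>n. p n x) \<longlonglongrightarrow> indicator A x" for x
  proof (cases "x \<in> A")
    case True
    then have "p n x = 1" for n using p(3,4) by blast
    then show ?thesis using True by simp
  next
    case False
    then have "infdist x A > 0"
      using \<open>A \<noteq> {}\<close> compact_imp_closed[OF A(1)] in_closed_iff_infdist_zero[of A x] infdist_nonneg[of x A]
          by fastforce
    then obtain N where N: "inverse (real (Suc N)) < infdist x A" using reals_Archimedean by blast
    have "p n x = 0" if "n \<ge> N" for n
    proof (rule pW)
      have "1 / real (Suc n) \<le> 1 / real (Suc N)" using that by (intro divide_left_mono) auto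
      then show "x \<notin> W n" using N unfolding W_def by (auto simp: inverse_eq_divide)
    qed
    then have "(\<lambda>n. p n x) \<longlonglongrightarrow> 0"
      by (intro tendsto_eventually) (auto simp: eventually_sequentially)
    then show ?thesis using False by simp
  qed
  have dB: "integrable lebesgue (\<lambda>x. indicator B x * d x)"
    using int[OF B] by (simp add: set_integrable_def)
  have tf: "test_function U (p n)" for n
    using p(1)[of n] V0B B(2) by (intro test_function_mono[of "W n" "p n" U]) (auto simp: W_def)
  have pm: "p n \<in> borel_measurable lebesgue" for n
    using smooth_continuous[OF test_functionD(1)[OF tf[of n]]] by
        (simp add: borel_measurable_continuous_onI measurable_completion)
  have prod: "p n x * d x = p n x * (indicator B x * d x)" for n x
    using pB[of x n] by (auto simp: indicator_def)
  have "(\<lambda>n. \<integral>x. p n x * d x \<partial>lebesgue) \<longlonglongrightarrow> (LINT x|lebesgue. indicator A x * (indicator B x * d x))"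
    unfolding prod
  proof (rule integral_dominated_convergence[where w="\<lambda>x. \<bar>indicator B x * d x\<bar>"])
    show "AE x in lebesgue. (\<lambda>n. p n x * (indicator B x * d x)) \<longlonglongrightarrow> indicator A x * (indicator B x * d x)"
      by (intro AE_I2 tendsto_mult lim tendsto_const)
    show "AE x in lebesgue. norm (p n x * (indicator B x * d x)) \<le> \<bar>indicator B x * d x\<bar>" for n
      using p(2)[of n] by (intro AE_I2) (auto simp: abs_mult intro!: mult_left_le_one_le mult_le_one)
    have "A \<in> sets lebesgue" using A(1) by (simp add: borel_compact)
    then show "(\<lambda>x. indicator A x * (indicator B x * d x)) \<in> borel_measurable lebesgue"
      by (intro borel_measurable_times[OF borel_measurable_indicator borel_measurable_integrable[OF dB]])
  qed (use dB pm in \<open>auto intro!: borel_measurable_times\<close>)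
  moreover have "(LINT x|lebesgue. p n x * d x) = 0" for n by (rule zero[OF tf])
  ultimately have "(LINT x|lebesgue. indicator A x * (indicator B x * d x)) = 0"
    using LIMSEQ_unique[OF _ tendsto_const] by fastforce
  moreover have "indicator A x * (indicator B x * d x) = indicator A x * d x" for x
    using p0(3) V0B by (auto simp: indicator_def)
  ultimately show ?thesis by (simp add: set_lebesgue_integral_def)
qed (simp add: set_lebesgue_integral_def)

text \<open>Up to a null set, \<open>{d > 0}\<close> is a countable union of compact sets.  On each of them \<open>d\<close> is positive
  with integral \<open>0\<close>, so each is a null set.\<close>

lemma AE_nonpos_of_test_functions:
  fixes d :: "real^'n \<Rightarrow> real"
  assumes U: "open U" and int: "\<And>B. compact B \<Longrightarrow> B \<subseteq> U \<Longrightarrow> set_integrable lebesgue B d"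
    and zero: "\<And>\<phi>. test_function U \<phi> \<Longrightarrow> (LINT x|lebesgue. \<phi> x * d x) = 0"
  shows "AE x in lebesgue. x \<in> U \<longrightarrow> d x \<le> 0"
proof -
  have "\<exists>C::nat \<Rightarrow> _. (\<forall>n. compact (C n)) \<and> (\<forall>n. C n \<subseteq> U) \<and> \<Union>(range C) = U"
    by (rule open_Union_compact_subsets[OF U]) (intro exI conjI allI; assumption)
  then obtain C :: "nat \<Rightarrow> (real^'n) set"
    where C: "\<And>n. compact (C n)" "\<And>n. C n \<subseteq> U" "\<Union>(range C) = U" by auto
  have "AE x in lebesgue. x \<in> C n \<longrightarrow> d x \<le> 0" for n
  proof -
    have dC: "integrable lebesgue (\<lambda>x. indicator (C n) x * d x)"
      using int[OF C(1,2)] by (simp add: set_integrable_def)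
    define E where "E = {x. indicator (C n) x * d x > 0}"
    have "E \<in> sets lebesgue"
      using measurable_sets[OF borel_measurable_integrable[OF dC], of "{0<..}"]
      by (simp add: E_def vimage_def)
    then obtain F T where F: "fsigma F" "T \<in> null_sets lebesgue" "F \<union> T = E"
      using lebesgue_set_almost_fsigma by metis
    then obtain K :: "nat \<Rightarrow> (real^'n) set" where K: "\<And>m. compact (K m)" "F = (\<Union>m. K m)"
      unfolding fsigma_Union_compact by (auto simp: image_subset_iff)
    have KE: "K m \<subseteq> E" for m using K F by auto
    have EC: "E \<subseteq> C n" unfolding E_def by (auto simp: indicator_def split: if_splits)
    have dpos: "d x > 0" if "x \<in> E" for x
      using that unfolding E_def by (cases "x \<in> C n") auto
    have "AE x in lebesgue. x \<notin> K m" for m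
    proof -
      have KU: "K m \<subseteq> U" using KE EC C(2) by blast
      have i: "integrable lebesgue (\<lambda>x. indicator (K m) x * d x)"
        using int[OF K(1) KU] by (simp add: set_integrable_def)
      have "(LINT x|lebesgue. indicator (K m) x * d x) = 0"
        using integral_over_compact_eq_0[OF U int zero K(1) KU] by (simp add: set_lebesgue_integral_def)
      moreover have nn: "0 \<le> indicator (K m) x * d x" for x
        using dpos KE[of m] by (auto simp: indicator_def intro: less_imp_le)
      ultimately have "AE x in lebesgue. indicator (K m) x * d x = 0"
        using integral_nonneg_eq_0_iff_AE[OF i] by simp
      then show ?thesis
      proof eventually_elim
        case (elim x)
        then show ?case using dpos[of x] KE[of m] by (auto simp: indicator_def)
      qed
    qed
    then have "AE x in lebesgue. \<forall>m. x \<notin> K m" by (simp add: AE_all_countable)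
    moreover have "AE x in lebesgue. x \<notin> T" by (rule AE_not_in[OF F(2)])
    ultimately show ?thesis
    proof eventually_elim
      case (elim x)
      then have "x \<notin> E" using F(3) K(2) by auto
      then show ?case unfolding E_def by (auto simp: indicator_def)
    qed
  qed
  then have "AE x in lebesgue. \<forall>n. x \<in> C n \<longrightarrow> d x \<le> 0" by (subst AE_all_countable) blast
  then show ?thesis
    by (rule eventually_mono) (use C(3) in auto)
qed

lemma fundamental_lemma:
  fixes d :: "real^'n \<Rightarrow> real"
  assumes U: "open U" and int: "\<And>B. compact B \<Longrightarrow> B \<subseteq> U \<Longrightarrow> set_integrable lebesgue B d"
    and zero: "\<And>\<phi>. test_function U \<phi> \<Longrightarrow> (LINT x|lebesgue. \<phi> x * d x) = 0"
  shows "AE x in lebesgue. x \<in> U \<longrightarrow> d x = 0"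
proof -
  have "AE x in lebesgue. x \<in> U \<longrightarrow> - d x \<le> 0"
  proof (rule AE_nonpos_of_test_functions[OF U])
    show "set_integrable lebesgue B (\<lambda>x. - d x)" if "compact B" "B \<subseteq> U" for B
      using int[OF that] by (simp add: set_integrable_def)
    show "(LINT x|lebesgue. \<phi> x * - d x) = 0" if "test_function U \<phi>" for \<phi>
      using zero[OF that] by simp
  qed
  with AE_nonpos_of_test_functions[OF U int zero] show ?thesis
    by (auto elim: eventually_elim2)
qed

section \<open>Weak directional derivatives on the whole space\<close>

lemma Cauchy_Schwarz_L2:
  assumes "L2 f" "L2 k"
  shows "\<bar>\<integral>x. f x * k x \<partial>lborel\<bar> \<le> sqrt (LBINT x. (f x)\<^sup>2) * sqrt (LBINT x. (k x)\<^sup>2)"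
proof -
  define F P K where "F = (LBINT x. (f x)\<^sup>2)" "P = (LBINT x. f x * k x)" "K = (LBINT x. (k x)\<^sup>2)"
  have "0 \<le> F - 2 * t * P + t\<^sup>2 * K" for t
  proof -
    have "0 \<le> (LBINT x. (f x - t * k x)\<^sup>2)" by simp
    also have "(\<lambda>x. (f x - t * k x)\<^sup>2) = (\<lambda>x. (f x)\<^sup>2 - 2 * t * (f x * k x) + t\<^sup>2 * (k x)\<^sup>2)"
      by (simp add: power2_eq_square algebra_simps)
    finally show ?thesis
      using assms L2_mult_integrable[OF assms] unfolding F_P_K_def by simp
  qed
  note q = this
  have "F \<ge> 0" "K \<ge> 0" unfolding F_P_K_def by auto
  have "P\<^sup>2 \<le> F * K"
  proof (cases "K = 0")
    case True
    have "P = 0"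
    proof (rule ccontr)
      assume "P \<noteq> 0"
      with q[of "(F + 1) / (2 * P)"] True show False by (simp add: field_simps)
    qed
    then show ?thesis using True by simp
  next
    case False
    with \<open>K \<ge> 0\<close> have "K > 0" by simp
    with q[of "P / K"] show ?thesis by (simp add: field_simps power2_eq_square)
  qed
  then have "\<bar>P\<bar> \<le> sqrt (F * K)" by (simp add: real_le_rsqrt)
  then show ?thesis unfolding F_P_K_def by (simp add: real_sqrt_mult)
qed

lemma L2_mult_tendsto:
  assumes "\<And>n::nat. L2 (f n)" "L2 g" "L2 k" and lim: "(\<lambda>n. \<integral>x. (f n x - g x)\<^sup>2 \<partial>lborel) \<longlonglongrightarrow> 0"
  shows "(\<lambda>n. \<integral>x. f n x * k x \<partial>lborel) \<longlonglongrightarrow> (LBINT x. g x * k x)"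
proof -
  have "(\<lambda>n. (LBINT x. f n x * k x) - (LBINT x. g x * k x)) \<longlonglongrightarrow> 0"
  proof (rule Lim_null_comparison)
    show "\<forall>\<^sub>F n in sequentially. norm ((LBINT x. f n x * k x) - (LBINT x. g x * k x)) \<le>
       sqrt (LBINT x. (f n x - g x)\<^sup>2) * sqrt (LBINT x. (k x)\<^sup>2)"
    proof (intro always_eventually allI)
      fix n
      have "(LBINT x. f n x * k x) - (LBINT x. g x * k x) = (LBINT x. (f n x - g x) * k x)"
        using L2_mult_integrable[OF assms(1)[of n] assms(3)] L2_mult_integrable[OF assms(2,3)]
        by (simp add: left_diff_distrib)
      then show "norm ((LBINT x. f n x * k x) - (LBINT x. g x * k x)) \<le>
         sqrt (LBINT x. (f n x - g x)\<^sup>2) * sqrt (LBINT x. (k x)\<^sup>2)"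
        using Cauchy_Schwarz_L2[OF L2_diff[OF assms(1)[of n] assms(2)] assms(3)] by simp
    qed
    show "(\<lambda>n. sqrt (LBINT x. (f n x - g x)\<^sup>2) * sqrt (LBINT x. (k x)\<^sup>2)) \<longlonglongrightarrow> 0"
      using tendsto_mult[OF tendsto_real_sqrt[OF lim] tendsto_const] by simp
  qed
  then show ?thesis by (simp add: LIM_zero_iff)
qed

lemma continuous_compact_support_L2:
  fixes h :: "'a::euclidean_space \<Rightarrow> real"
  assumes "continuous_on UNIV h" "compact A" "\<And>x. x \<notin> A \<Longrightarrow> h x = 0"
  shows "L2 h"
proof -
  have "integrable lborel (\<lambda>x. indicator A x *\<^sub>R (h x)\<^sup>2)"
    using assms by (intro borel_integrable_compact continuous_intros) (auto intro: continuous_on_subset)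
  moreover have "(\<lambda>x. indicator A x *\<^sub>R (h x)\<^sup>2) = (\<lambda>x. (h x)\<^sup>2)"
    using assms(3) by (force simp: indicator_def)
  ultimately show ?thesis using assms(1) by (simp add: borel_measurable_continuous_onI)
qed

lemma test_function_L2:
  assumes "test_function U \<phi>"
  shows "L2 \<phi>" "L2 (\<lambda>x. grad \<phi> x \<bullet> e)"
proof -
  note D = test_functionD[OF assms]
  show "L2 \<phi>"
    by (rule continuous_compact_support_L2[OF smooth_continuous[OF D(1)] D(2)]) (rule outside_support)
  have "continuous_on UNIV (\<lambda>x. grad \<phi> x \<bullet> e)"
    using smooth_grad_continuous[OF D(1)] by (intro continuous_intros)
  then show "L2 (\<lambda>x. grad \<phi> x \<bullet> e)"
    by (rule continuous_compact_support_L2[OF _ D(2)]) (simp add: grad_outside_support)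
qed

text \<open>The weak derivative of \<open>w\<close> on the whole space in the single direction \<open>e\<close>.  With \<open>e\<close> fixed, everything
  is real-valued, and Borel functions make Fubini's theorem directly applicable.\<close>

definition weak_dderiv :: "real^'n \<Rightarrow> (real^'n \<Rightarrow> real) \<Rightarrow> (real^'n \<Rightarrow> real) \<Rightarrow> bool" where
  "weak_dderiv e w q \<longleftrightarrow> L2 w \<and> L2 q \<and>
    (\<forall>\<phi>. test_function UNIV \<phi> \<longrightarrow> (LBINT x. w x * (grad \<phi> x \<bullet> e)) = - (LBINT x. \<phi> x * q x))"

lemma integral_avg_test_function:
  fixes \<nu> :: "(real^'n) measure"
  assumes "averaging \<nu> R" "weak_dderiv e w q" "test_function UNIV \<phi>"
  shows "(LBINT x. averaging.avg \<nu> t q x * \<phi> x) = - (LBINT x. averaging.avg \<nu> t w x * (grad \<phi> x \<bullet> e))"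
proof -
  interpret averaging \<nu> R by fact
  have wq: "L2 w" "L2 q" using assms(2) unfolding weak_dderiv_def by auto
  have "(LBINT x. q x * \<phi> (x - t *\<^sub>R y)) = - (LBINT x. w x * (grad \<phi> (x - t *\<^sub>R y) \<bullet> e))" for y
  proof -
    have "test_function UNIV (\<lambda>x. \<phi> (x - t *\<^sub>R y))"
      using assms(3) by (rule test_function_translate)
    then have "(LBINT x. w x * (grad (\<lambda>x. \<phi> (x - t *\<^sub>R y)) x \<bullet> e)) = - (LBINT x. \<phi> (x - t *\<^sub>R y) * q x)"
      using assms(2) unfolding weak_dderiv_def by blast
    then show ?thesis
      unfolding grad_translate[OF test_functionD(1)[OF assms(3)]] by (simp add: mult.commute)
  qed
  then show ?thesis
    unfolding integral_avg_mult[OF wq(2) test_function_L2(1)[OF assms(3)]]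
      integral_avg_mult[OF wq(1) test_function_L2(2)[OF assms(3)]] by simp
qed

lemma avg_weak_dderiv:
  assumes "averaging \<nu> R" "weak_dderiv e w q"
  shows "weak_dderiv e (averaging.avg \<nu> t w) (averaging.avg \<nu> t q)"
proof -
  interpret averaging \<nu> R by fact
  have "L2 w" "L2 q" using assms(2) unfolding weak_dderiv_def by auto
  then show ?thesis
    using integral_avg_test_function[OF assms, of _ t] avg_L2 unfolding weak_dderiv_def
    by (simp add: mult.commute)
qed

text \<open>The uniform distribution on the segment from \<open>0\<close> to \<open>e\<close>.\<close>

definition segment_measure :: "'a::euclidean_space \<Rightarrow> 'a measure" where
  "segment_measure e = distr (restrict_space lborel {0..1::real}) borel (\<lambda>r. r *\<^sub>R e)"

lemma averaging_segment: "averaging (segment_measure e) (norm e)"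
proof -
  have [measurable]: "(\<lambda>r. r *\<^sub>R e) \<in> restrict_space lborel {0..1::real} \<rightarrow>\<^sub>M borel"
    by (intro measurable_restrict_space1) measurable
  have "prob_space (restrict_space lborel {0..1::real})"
    by (rule prob_spaceI) (simp add: emeasure_restrict_space space_restrict_space)
  then interpret prob_space "segment_measure e"
    unfolding segment_measure_def by (rule prob_space.prob_space_distr) measurable
  show ?thesis
  proof
    show "sets (segment_measure e) = sets borel" by (simp add: segment_measure_def)
    show "AE y in segment_measure e. norm y \<le> norm e"
      unfolding segment_measure_def
      by (subst AE_distr_iff) (auto simp: AE_restrict_space_iff mult_left_le_one_le intro!: AE_I2)
  qed
qed

interpretation seg: averaging "segment_measure e" "norm e" for e :: "'a::euclidean_space"
  by (rule averaging_segment)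

lemma segment_avg_eq:
  assumes [measurable]: "\<psi> \<in> borel_measurable borel"
  shows "seg.avg e t \<psi> x = (LBINT r. \<psi> (x + (t * r) *\<^sub>R e) * indicator {0..1} r)"
proof -
  have [measurable]: "(\<lambda>r. r *\<^sub>R e) \<in> restrict_space lborel {0..1::real} \<rightarrow>\<^sub>M borel"
    by (intro measurable_restrict_space1) measurable
  show ?thesis
    unfolding seg.avg_def unfolding segment_measure_def
    by (subst integral_distr) (auto simp: integral_restrict_space mult.commute)
qed

lemma segment_avg_grad:
  fixes e :: "real^'n"
  assumes "smooth \<phi>" "s \<noteq> 0"
  shows "seg.avg e (- s) (\<lambda>x. grad \<phi> x \<bullet> e) x = (\<phi> x - \<phi> (x - s *\<^sub>R e)) / s"
proof -
  have cont: "continuous_on UNIV (\<lambda>x. grad \<phi> x \<bullet> e)"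
    using smooth_grad_continuous[OF assms(1)] by (intro continuous_intros)
  have "seg.avg e (- s) (\<lambda>x. grad \<phi> x \<bullet> e) x =
      (LBINT r. (grad \<phi> (x + (- s * r) *\<^sub>R e) \<bullet> e) * indicator {0..1} r)"
    by (rule segment_avg_eq) (rule borel_measurable_continuous_onI[OF cont])
  also have "\<dots> = - \<phi> (x + (- s * 1) *\<^sub>R e) / s - (- \<phi> (x + (- s * 0) *\<^sub>R e) / s)"
  proof (rule integral_FTC_Icc_real)
    fix r :: real
    have "((\<lambda>r. x + (- s * r) *\<^sub>R e) has_derivative (\<lambda>h. (- s * h) *\<^sub>R e)) (at r)"
      by (auto intro!: derivative_eq_intros)
    from diff_chain_at[OF this smooth_GDERIV[OF assms(1), unfolded gderiv_def]]
    have "((\<lambda>r. \<phi> (x + (- s * r) *\<^sub>R e)) has_derivative (\<lambda>h. (- s * h) *\<^sub>R e \<bullet> grad \<phi> (x +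
        (- s * r) *\<^sub>R e))) (at r)"
      by (simp add: o_def)
    then have "((\<lambda>r. \<phi> (x + (- s * r) *\<^sub>R e)) has_real_derivative - s * (grad \<phi> (x + (- s * r) *\<^sub>R e) \<bullet> e))
        (at r)"
      by (rule has_derivative_imp_has_field_derivative) (simp add: inner_commute)
    then have "((\<lambda>r. - \<phi> (x + (- s * r) *\<^sub>R e) / s) has_real_derivative - (- s * (grad \<phi> (x +
        (- s * r) *\<^sub>R e) \<bullet> e)) / s) (at r)"
      by (intro DERIV_cdivide DERIV_minus)
    then show "((\<lambda>r. - \<phi> (x + (- s * r) *\<^sub>R e) / s) has_real_derivative grad \<phi> (x + (- s * r) *\<^sub>R e) \<bullet> e)
        (at r)"
      using assms(2) by simp
    have "continuous_on UNIV (\<lambda>r. grad \<phi> (x + (- s * r) *\<^sub>R e) \<bullet> e)"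
      by (rule continuous_on_compose2[OF cont]) (auto intro!: continuous_intros)
    then show "isCont (\<lambda>r. grad \<phi> (x + (- s * r) *\<^sub>R e) \<bullet> e) r"
      by (simp add: continuous_on_eq_continuous_at)
  qed simp
  finally show ?thesis by (simp add: diff_divide_distrib)
qed

lemma L2_set_integrable:
  assumes "L2 d" "compact B"
  shows "set_integrable lebesgue B d"
proof -
  have B: "B \<in> sets borel" "emeasure lborel B < \<infinity>"
    using borel_compact[OF assms(2)] emeasure_compact_finite[OF assms(2)] by simp_all
  have "L2 (indicator B :: 'a \<Rightarrow> real)"
    using B by (simp add: power2_eq_square flip: indicator_inter_arith)
  from L2_mult_integrable[OF this assms(1)] show ?thesis
    using assms(1) B unfolding set_integrable_def by (simp add: integrable_completion)
qed

lemma L2_cmult: "L2 v \<Longrightarrow> L2 (\<lambda>x. c * v x)"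
  by (auto simp: power_mult_distrib)

text \<open>Tested against a smooth \<open>\<phi>\<close>, the average of \<open>q\<close> over the segment turns into the average of
  \<open>\<nabla>\<phi> \<bullet> e\<close> over the reversed segment, which is a difference of values of \<open>\<phi>\<close> by the fundamental theorem
  of calculus; the fundamental lemma removes \<open>\<phi>\<close>.\<close>

lemma difference_eq_segment_avg:
  fixes e :: "real^'n"
  assumes "weak_dderiv e w q" "s \<noteq> 0"
  shows "AE x in lborel. w (x + s *\<^sub>R e) = w x + s * seg.avg e s q x"
proof -
  have wq: "L2 w" "L2 q" using assms(1) unfolding weak_dderiv_def by auto
  have mw: "w \<in> borel_measurable borel" using wq by auto
  define d where "d x = w (x + s *\<^sub>R e) - w x - s * seg.avg e s q x" for x
  have L: "L2 (\<lambda>x. w (x + s *\<^sub>R e))" "L2 (\<lambda>x. s * seg.avg e s q x)"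
    using L2_translate[OF wq(1)] L2_cmult[OF seg.avg_L2[OF wq(2)]] by blast+
  have "L2 d" unfolding d_def by (intro L2_diff L wq)
  have "AE x in lebesgue. x \<in> UNIV \<longrightarrow> d x = 0"
  proof (rule fundamental_lemma)
    show "set_integrable lebesgue B d" if "compact B" for B
      using L2_set_integrable[OF \<open>L2 d\<close> that] .
    show "(LINT x|lebesgue. \<phi> x * d x) = 0" if \<phi>: "test_function UNIV \<phi>" for \<phi>
    proof -
      note T = test_function_L2[OF \<phi>]
      have m\<phi>: "\<phi> \<in> borel_measurable borel" using T by auto
      have "(LINT x|lebesgue. \<phi> x * d x) = (LBINT x. \<phi> x * d x)"
        using T \<open>L2 d\<close> by (intro integral_completion) auto
      also have "\<dots> = (LBINT x. w (x + s *\<^sub>R e) * \<phi> x) - (LBINT x. w x * \<phi> x) - s *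
          (LBINT x. seg.avg e s q x * \<phi> x)"
        using L2_mult_integrable[OF T(1) L(1)] L2_mult_integrable[OF T(1) wq(1)] L2_mult_integrable[OF T(1)
            seg.avg_L2[OF wq(2), of e s]]
        unfolding d_def by (simp add: right_diff_distrib mult.commute mult.left_commute)
      also have "(LBINT x. seg.avg e s q x * \<phi> x) = - (LBINT x. w x * seg.avg e (- s) (\<lambda>x. grad \<phi> x \<bullet> e) x)"
        using integral_avg_test_function[OF averaging_segment assms(1) \<phi>] seg.integral_avg_adjoint[OF wq(1)
            T(2)] by metis
      also have "(LBINT x. w x * seg.avg e (- s) (\<lambda>x. grad \<phi> x \<bullet> e) x) = ((LBINT x. w x * \<phi> x) -
          (LBINT x. w x * \<phi> (x - s *\<^sub>R e))) / s"
        using L2_mult_integrable[OF wq(1) T(1)] L2_mult_integrable[OF wq(1) L2_translate[OF T(1), of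
            "- s *\<^sub>R e"]]
        unfolding segment_avg_grad[OF test_functionD(1)[OF \<phi>] assms(2)]
        by (simp add: right_diff_distrib)
      also have "(LBINT x. w x * \<phi> (x - s *\<^sub>R e)) = (LBINT x. w (x + s *\<^sub>R e) * \<phi> x)"
        using integral_translate[of "\<lambda>x. w x * \<phi> (x - s *\<^sub>R e)" "s *\<^sub>R e"] mw m\<phi> by simp
      finally show ?thesis using assms(2) by simp
    qed
  qed simp
  then have "AE x in lborel. d x = 0" by (simp add: AE_completion_iff)
  then show ?thesis by eventually_elim (simp add: d_def)
qed

section \<open>The chain rule\<close>

text \<open>Under these hypotheses composition with \<open>\<beta>\<close> maps \<open>W\<^sup>1\<^sup>,\<^sup>2\<close> into itself without increasing norms;
  \<open>\<beta> 0 = 0\<close> makes it commute with extension by zero.\<close>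

locale truncation =
  fixes \<beta> \<beta>' :: "real \<Rightarrow> real"
  assumes deriv: "\<And>s. (\<beta> has_real_derivative \<beta>' s) (at s)"
    and deriv_le_1: "\<And>s. \<bar>\<beta>' s\<bar> \<le> 1"
    and cont_deriv: "continuous_on UNIV \<beta>'"
    and at_0: "\<beta> 0 = 0"
begin

lemma lipschitz: "\<bar>\<beta> a - \<beta> b\<bar> \<le> \<bar>a - b\<bar>"
  using field_differentiable_bound[of UNIV \<beta> \<beta>' 1 a b] deriv deriv_le_1 by simp

lemma abs_le: "\<bar>\<beta> a\<bar> \<le> \<bar>a\<bar>"
  using lipschitz[of a 0] at_0 by simp

lemma cont: "continuous_on UNIV \<beta>"
  using deriv by (blast intro: continuous_at_imp_continuous_on DERIV_isCont)

lemma measurable_\<beta>[measurable]: "\<beta> \<in> borel_measurable borel"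
  by (rule borel_measurable_continuous_onI[OF cont])

lemma measurable_\<beta>'[measurable]: "\<beta>' \<in> borel_measurable borel"
  by (rule borel_measurable_continuous_onI[OF cont_deriv])

lemma L2_compose:
  assumes "L2 w"
  shows "L2 (\<lambda>x. \<beta> (w x))"
proof -
  have [measurable]: "w \<in> borel_measurable borel" using assms by auto
  have "integrable lborel (\<lambda>x. (\<beta> (w x))\<^sup>2)"
    by (rule Bochner_Integration.integrable_bound[of lborel "\<lambda>x. (w x)\<^sup>2"])
      (use assms abs_le in \<open>auto simp: abs_le_square_iff[symmetric]\<close>)
  then show ?thesis by simp
qed

lemma L2_deriv_mult:
  assumes "L2 q" "w \<in> borel_measurable borel"
  shows "L2 (\<lambda>x. \<beta>' (w x) * q x)"
proof -
  have [measurable]: "w \<in> borel_measurable borel" "q \<in> borel_measurable borel" using assms by auto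
  have "integrable lborel (\<lambda>x. (\<beta>' (w x) * q x)\<^sup>2)"
    by (rule Bochner_Integration.integrable_bound[of lborel "\<lambda>x. (q x)\<^sup>2"])
      (use assms deriv_le_1 in \<open>auto simp: abs_le_square_iff[symmetric] abs_mult intro!: mult_left_le_one_le\<close>)
  then show ?thesis by simp
qed

lemma difference_quotient_tendsto:
  assumes "s \<longlonglongrightarrow> 0" "\<And>n. s n \<noteq> (0::real)"
  shows "(\<lambda>n. (\<beta> (a + s n * q) - \<beta> a) / s n) \<longlonglongrightarrow> \<beta>' a * q"
proof -
  have "((\<lambda>s. a + s * q) has_real_derivative q) (at 0)"
    by (auto intro!: derivative_eq_intros)
  from DERIV_chain2[OF _ this, of \<beta> "\<beta>' a"] deriv[of a]
  have "((\<lambda>s. \<beta> (a + s * q)) has_real_derivative \<beta>' a * q) (at 0)" by simp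
  then have "((\<lambda>h. (\<beta> (a + h * q) - \<beta> a) / h) \<longlongrightarrow> \<beta>' a * q) (at 0)"
    by (simp add: DERIV_def)
  then show ?thesis
    by (rule filterlim_compose) (use assms in \<open>auto simp: filterlim_at\<close>)
qed

text \<open>The difference quotients of \<open>\<beta> (w)\<close>, paired with \<open>\<phi>\<close>, are evaluated in two ways: by moving the translation
  to \<open>\<phi>\<close>, and by inserting that the increments of \<open>w\<close> are averages of \<open>q\<close>.\<close>

lemma chain_rule:
  fixes e :: "real^'n"
  assumes wd: "weak_dderiv e w q"
  shows "weak_dderiv e (\<lambda>x. \<beta> (w x)) (\<lambda>x. \<beta>' (w x) * q x)"
proof -
  have wq: "L2 w" "L2 q" using wd unfolding weak_dderiv_def by auto
  have [measurable]: "w \<in> borel_measurable borel" "q \<in> borel_measurable borel" using wq by auto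
  have "(LBINT x. \<beta> (w x) * (grad \<phi> x \<bullet> e)) = - (LBINT x. \<phi> x * (\<beta>' (w x) * q x))"
    if \<phi>: "test_function UNIV \<phi>" for \<phi>
  proof -
    note T = test_function_L2[OF \<phi>]
    have [measurable]: "\<phi> \<in> borel_measurable borel" using T by auto
    define s where "s n = 1 / real (Suc n)" for n
    have s: "s \<longlonglongrightarrow> 0" "\<And>n. s n \<noteq> 0" "\<And>n. s n > 0"
      using LIMSEQ_inverse_real_of_nat by (simp_all add: s_def[abs_def] inverse_eq_divide)
    have s': "(\<lambda>n. - s n) \<longlonglongrightarrow> 0" using tendsto_minus[OF s(1)] by simp
    have avg_lim: "(\<lambda>n. \<integral>x. (seg.avg e (t n) k x - k x)\<^sup>2 \<partial>lborel) \<longlonglongrightarrow> 0"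
      if tk: "t \<longlonglongrightarrow> 0" "L2 k" for t k
    proof (rule LIMSEQ_I)
      fix r :: real assume "r > 0"
      then obtain d where d: "d > 0" "\<And>t. \<bar>t\<bar> < d \<Longrightarrow> (LBINT x. (seg.avg e t k x - k x)\<^sup>2) < r"
        using seg.avg_tendsto[OF tk(2), of r e] by auto
      obtain N where N: "\<And>n. n \<ge> N \<Longrightarrow> \<bar>t n\<bar> < d"
        using LIMSEQ_D[OF tk(1) d(1)] by auto
      show "\<exists>N. \<forall>n\<ge>N. norm ((LBINT x. (seg.avg e (t n) k x - k x)\<^sup>2) - 0) < r"
        by (intro exI[of _ N] allI impI) (simp add: d(2) N)
    qed
    define I where "I n = (LBINT x. \<phi> x * ((\<beta> (w (x + s n *\<^sub>R e)) - \<beta> (w x)) / s n))" for n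
    \<comment> \<open>Moving the difference quotient onto \<open>\<phi>\<close> gives one limit of \<open>I\<close>.\<close>
    have "I n = - (LBINT x. seg.avg e (- s n) (\<lambda>x. grad \<phi> x \<bullet> e) x * \<beta> (w x))" for n
    proof -
      note L = L2_compose[OF wq(1)] L2_compose[OF L2_translate[OF wq(1), of "s n *\<^sub>R e"]]
        L2_translate[OF T(1), of "- s n *\<^sub>R e"]
      have "I n = ((LBINT x. \<beta> (w (x + s n *\<^sub>R e)) * \<phi> x) - (LBINT x. \<beta> (w x) * \<phi> x)) / s n"
        unfolding I_def using L2_mult_integrable[OF L(1) T(1)] L2_mult_integrable[OF L(2) T(1)]
        by (simp add: right_diff_distrib mult.commute)
      also have "(LBINT x. \<beta> (w (x + s n *\<^sub>R e)) * \<phi> x) = (LBINT x. \<beta> (w x) * \<phi> (x - s n *\<^sub>R e))"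
        using integral_translate[of "\<lambda>x. \<beta> (w x) * \<phi> (x - s n *\<^sub>R e)" "s n *\<^sub>R e"] by simp
      finally have I_eq: "I n = ((LBINT x. \<beta> (w x) * \<phi> (x - s n *\<^sub>R e)) - (LBINT x. \<beta> (w x) * \<phi> x)) / s n" .
      show ?thesis
        unfolding segment_avg_grad[OF test_functionD(1)[OF \<phi>] s(2)] I_eq
      proof -
        have "(\<lambda>x. (\<phi> x - \<phi> (x - s n *\<^sub>R e)) / s n * \<beta> (w x)) = (\<lambda>x. (\<beta> (w x) * \<phi> x - \<beta> (w x) * \<phi>
            (x - s n *\<^sub>R e)) / s n)"
          by (intro ext) (simp add: left_diff_distrib right_diff_distrib mult.commute[of "\<beta> _"])
        then have "(LBINT x. (\<phi> x - \<phi> (x - s n *\<^sub>R e)) / s n * \<beta> (w x)) = ((LBINT x. \<beta> (w x) * \<phi> x) -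
            (LBINT x. \<beta> (w x) * \<phi> (x - s n *\<^sub>R e))) / s n"
          using L2_mult_integrable[OF L(1) T(1)] L2_mult_integrable[OF L(1) L(3)] by simp
        then show "((LBINT x. \<beta> (w x) * \<phi> (x - s n *\<^sub>R e)) - (LBINT x. \<beta> (w x) * \<phi> x)) / s n = - (LBINT x.
            (\<phi> x - \<phi> (x - s n *\<^sub>R e)) / s n * \<beta> (w x))"
          by (simp only: minus_divide_left minus_diff_eq)
      qed
    qed
    then have Ieq: "I = (\<lambda>n. - (LBINT x. seg.avg e (- s n) (\<lambda>x. grad \<phi> x \<bullet> e) x * \<beta> (w x)))" by (rule ext)
    have lim1: "I \<longlonglongrightarrow> - (LBINT x. (grad \<phi> x \<bullet> e) * \<beta> (w x))"
      unfolding Ieq by (rule tendsto_minus[OF L2_mult_tendsto[OF seg.avg_L2[OF T(2)] T(2) L2_compose[OF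
          wq(1)] avg_lim[OF s' T(2)]]])
    \<comment> \<open>The other limit: the increments of \<open>w\<close> are replaced first by \<open>s n * q\<close>, at a cost controlled in
      \<open>L\<^sup>2\<close>, after which \<open>\<beta>\<close> is differentiated pointwise.\<close>
    define J where "J n = (LBINT x. \<phi> x * ((\<beta> (w x + s n * q x) - \<beta> (w x)) / s n))" for n
    have bound: "\<bar>(\<beta> (w x + s n * q x) - \<beta> (w x)) / s n\<bar> \<le> \<bar>q x\<bar>" for n x
      using lipschitz[of "w x + s n * q x" "w x"] s(3)[of n] by (simp add: abs_mult field_simps)
    have i\<phi>q: "integrable lborel (\<lambda>x. \<bar>\<phi> x * q x\<bar>)"
      using L2_mult_integrable[OF T(1) wq(2)] by simp
    have lim2: "J \<longlonglongrightarrow> (LBINT x. \<phi> x * (\<beta>' (w x) * q x))"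
      unfolding J_def
    proof (rule integral_dominated_convergence[where w="\<lambda>x. \<bar>\<phi> x * q x\<bar>"])
      show "AE x in lborel. (\<lambda>n. \<phi> x * ((\<beta> (w x + s n * q x) - \<beta> (w x)) / s n)) \<longlonglongrightarrow> \<phi> x * (\<beta>' (w x) * q x)"
        by (intro AE_I2 tendsto_mult tendsto_const difference_quotient_tendsto s)
      show "AE x in lborel. norm (\<phi> x * ((\<beta> (w x + s n * q x) - \<beta> (w x)) / s n)) \<le> \<bar>\<phi> x * q x\<bar>" for n
        using bound[of _ n] by (intro AE_I2) (simp only: real_norm_def abs_mult mult_left_mono abs_ge_zero)
    qed (use i\<phi>q in auto)
    have lim3: "(\<lambda>n. I n - J n) \<longlonglongrightarrow> 0"
    proof (rule Lim_null_comparison)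
      define Q where "Q n = seg.avg e (s n) q" for n
      have Q: "L2 (Q n)" for n unfolding Q_def by (rule seg.avg_L2[OF wq(2)])
      then have [measurable]: "Q n \<in> borel_measurable borel" for n by blast
      have "L2 (\<lambda>x. \<bar>\<phi> x\<bar>)" using T by auto
      have QL: "L2 (\<lambda>x. \<bar>Q n x - q x\<bar>)" for n using L2_diff[OF Q[of n] wq(2)] by auto
      have "norm (I n - J n) \<le> sqrt (LBINT x. (Q n x - q x)\<^sup>2) * sqrt (LBINT x. (\<phi> x)\<^sup>2)" for n
      proof -
        have "I n = (LBINT x. \<phi> x * ((\<beta> (w x + s n * Q n x) - \<beta> (w x)) / s n))"
          unfolding I_def Q_def
        proof (rule integral_cong_AE)
          have [measurable]: "seg.avg e (s n) q \<in> borel_measurable borel"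
            using Q[of n] unfolding Q_def by blast
          show "(\<lambda>x. \<phi> x * ((\<beta> (w x + s n * seg.avg e (s n) q x) - \<beta> (w x)) / s n)) \<in> borel_measurable lborel"
            by measurable
          show "AE x in lborel. \<phi> x * ((\<beta> (w (x + s n *\<^sub>R e)) - \<beta> (w x)) / s n) =
              \<phi> x * ((\<beta> (w x + s n * seg.avg e (s n) q x) - \<beta> (w x)) / s n)"
            using difference_eq_segment_avg[OF wd s(2)[of n]] by eventually_elim simp
        qed measurable
        moreover have "\<bar>\<phi> x * ((\<beta> (w x + s n * Q n x) - \<beta> (w x)) / s n) - \<phi> x * ((\<beta> (w x + s n * q x) - \<beta>
            (w x)) / s n)\<bar> \<le> \<bar>Q n x - q x\<bar> * \<bar>\<phi> x\<bar>" for x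
        proof -
          have "\<bar>\<beta> (w x + s n * Q n x) - \<beta> (w x + s n * q x)\<bar> \<le> s n * \<bar>Q n x - q x\<bar>"
            using lipschitz[of "w x + s n * Q n x" "w x + s n * q x"] s(3)[of n]
            by (simp add: right_diff_distrib[symmetric] abs_mult)
          then have "\<bar>(\<beta> (w x + s n * Q n x) - \<beta> (w x + s n * q x)) / s n\<bar> \<le> \<bar>Q n x - q x\<bar>"
            using s(3)[of n] by (simp add: field_simps)
          then have "\<bar>\<phi> x\<bar> * \<bar>(\<beta> (w x + s n * Q n x) - \<beta> (w x + s n * q x)) / s n\<bar> \<le> \<bar>\<phi> x\<bar> * \<bar>Q n x - q x\<bar>"
            by (rule mult_left_mono) simp
          then show ?thesis
            unfolding abs_mult[symmetric] by (simp add: right_diff_distrib[symmetric]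
                diff_divide_distrib[symmetric] mult.commute)
        qed
        note diff_le = this
        have iQ: "integrable lborel (\<lambda>x. \<phi> x * ((\<beta> (w x + s n * r x) - \<beta> (w x)) / s n))" if r: "L2 r" for r
        proof (rule Bochner_Integration.integrable_bound[OF integrable_abs[OF L2_mult_integrable[OF T(1) r]]])
          have [measurable]: "r \<in> borel_measurable borel" using r by blast
          show "(\<lambda>x. \<phi> x * ((\<beta> (w x + s n * r x) - \<beta> (w x)) / s n)) \<in> borel_measurable lborel" by measurable
          have "\<bar>(\<beta> (w x + s n * r x) - \<beta> (w x)) / s n\<bar> \<le> \<bar>r x\<bar>" for x
            using lipschitz[of "w x + s n * r x" "w x"] s(3)[of n] by (simp add: abs_mult field_simps)
          then show "AE x in lborel. norm (\<phi> x * ((\<beta> (w x + s n * r x) - \<beta> (w x)) / s n)) \<le> norm \<bar>\<phi> x * r x\<bar>"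
            by (intro AE_I2) (simp only: real_norm_def abs_mult mult_left_mono abs_ge_zero abs_abs)
        qed
        ultimately have "norm (I n - J n) = \<bar>\<integral>x. \<phi> x * ((\<beta> (w x + s n * Q n x) - \<beta> (w x)) / s n) - \<phi> x * ((\<beta>
            (w x + s n * q x) - \<beta> (w x)) / s n) \<partial>lborel\<bar>"
          using iQ[OF Q[of n]] iQ[OF wq(2)] unfolding J_def by simp
        also have "\<dots> \<le> (LBINT x. \<bar>Q n x - q x\<bar> * \<bar>\<phi> x\<bar>)"
          by (rule order_trans[OF integral_abs_bound integral_mono_AE'[OF L2_mult_integrable[OF QL \<open>L2
              (\<lambda>x. \<bar>\<phi> x\<bar>)\<close>]]])
            (use diff_le in \<open>auto intro!: AE_I2 simp del: times_divide_eq_right\<close>)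
        also have "\<dots> \<le> sqrt (LBINT x. (Q n x - q x)\<^sup>2) * sqrt (LBINT x. (\<phi> x)\<^sup>2)"
          using Cauchy_Schwarz_L2[OF QL[of n] \<open>L2 (\<lambda>x. \<bar>\<phi> x\<bar>)\<close>] by simp
        finally show ?thesis .
      qed
      then show "\<forall>\<^sub>F n in sequentially. norm (I n - J n) \<le> sqrt (LBINT x. (Q n x - q x)\<^sup>2) * sqrt (LBINT x.
          (\<phi> x)\<^sup>2)"
        by simp
      show "(\<lambda>n. sqrt (LBINT x. (Q n x - q x)\<^sup>2) * sqrt (LBINT x. (\<phi> x)\<^sup>2)) \<longlonglongrightarrow> 0"
        using tendsto_mult[OF tendsto_real_sqrt[OF avg_lim[OF s(1) wq(2)]] tendsto_const]
        unfolding Q_def by simp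
    qed
    have "I \<longlonglongrightarrow> (LBINT x. \<phi> x * (\<beta>' (w x) * q x))"
      using tendsto_add[OF lim3 lim2] by simp
    from LIMSEQ_unique[OF lim1 this] show ?thesis by (simp add: mult.commute)
  qed
  then show ?thesis
    unfolding weak_dderiv_def using L2_compose[OF wq(1)] L2_deriv_mult[OF wq(2)] by auto
qed

end

section \<open>Square integrable functions\<close>

definition square_integrable :: "(real^'n \<Rightarrow> 'b::euclidean_space) \<Rightarrow> bool" where
  "square_integrable f \<longleftrightarrow> f \<in> borel_measurable lebesgue \<and> integrable lebesgue (\<lambda>x. (norm (f x))\<^sup>2)"

lemma square_integrableD:
  "square_integrable f \<Longrightarrow> f \<in> borel_measurable lebesgue"
  "square_integrable f \<Longrightarrow> integrable lebesgue (\<lambda>x. (norm (f x))\<^sup>2)"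
  unfolding square_integrable_def by auto

lemma L_p_2_iff: "u \<in> L_p 2 U \<longleftrightarrow> square_integrable (\<lambda>x. indicator U x *\<^sub>R u x)"
proof -
  have "(norm (indicator U x *\<^sub>R u x))\<^sup>2 = indicator U x *\<^sub>R (norm (u x))\<^sup>2" for x
    by (simp add: indicator_def)
  then show ?thesis
    unfolding L_p_def square_integrable_def set_borel_measurable_def set_integrable_def by simp
qed

lemma square_integrable_bound:
  assumes "square_integrable f" "g \<in> borel_measurable lebesgue" "\<And>x. norm (g x) \<le> B * norm (f x)"
  shows "square_integrable g"
proof -
  have "integrable lebesgue (\<lambda>x. (norm (g x))\<^sup>2)"
  proof (rule Bochner_Integration.integrable_bound[of lebesgue "\<lambda>x. B\<^sup>2 * (norm (f x))\<^sup>2"])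
    show "AE x in lebesgue. norm ((norm (g x))\<^sup>2) \<le> norm (B\<^sup>2 * (norm (f x))\<^sup>2)"
    proof (intro AE_I2)
      fix x
      have "(norm (g x))\<^sup>2 \<le> (B * norm (f x))\<^sup>2" by (intro power_mono assms) simp
      then show "norm ((norm (g x))\<^sup>2) \<le> norm (B\<^sup>2 * (norm (f x))\<^sup>2)" by (simp add: power_mult_distrib)
    qed
  qed (use assms in \<open>auto simp: square_integrable_def\<close>)
  then show ?thesis using assms(2) by (simp add: square_integrable_def)
qed

lemma norm_add_sq_le: "(norm (a + b :: 'b::real_normed_vector))\<^sup>2 \<le> 2 * (norm a)\<^sup>2 + 2 * (norm b)\<^sup>2"
proof -
  have "(norm (a + b))\<^sup>2 \<le> (norm a + norm b)\<^sup>2" by (intro power_mono norm_triangle_ineq) simp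
  also have "\<dots> \<le> 2 * (norm a)\<^sup>2 + 2 * (norm b)\<^sup>2"
    using zero_le_power2[of "norm a - norm b"] by (simp add: power2_eq_square algebra_simps)
  finally show ?thesis .
qed

lemma square_integrable_add:
  assumes "square_integrable f" "square_integrable g"
  shows "square_integrable (\<lambda>x. f x + g x)"
proof -
  have [measurable]: "f \<in> borel_measurable lebesgue" "g \<in> borel_measurable lebesgue"
    using assms by (auto simp: square_integrable_def)
  have "integrable lebesgue (\<lambda>x. (norm (f x + g x))\<^sup>2)"
    by (rule Bochner_Integration.integrable_bound[of lebesgue "\<lambda>x. 2 * (norm (f x))\<^sup>2 + 2 * (norm (g x))\<^sup>2"])
      (use assms norm_add_sq_le in \<open>auto simp: square_integrable_def intro!: AE_I2\<close>)
  then show ?thesis by (simp add: square_integrable_def)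
qed

lemma square_integrable_mult_bounded:
  assumes "square_integrable f" "h \<in> borel_measurable lebesgue" "\<And>x. \<bar>h x\<bar> \<le> B"
  shows "square_integrable (\<lambda>x. h x *\<^sub>R f x)"
  using assms by (intro square_integrable_bound[OF assms(1), of _ B])
    (auto simp: square_integrable_def mult_right_mono)

lemma square_integrable_cmult: "square_integrable f \<Longrightarrow> square_integrable (\<lambda>x. c *\<^sub>R f x)"
  by (rule square_integrable_mult_bounded[of _ _ "\<bar>c\<bar>"]) auto

lemma square_integrable_indicator:
  assumes "square_integrable f" "A \<in> sets lebesgue"
  shows "square_integrable (\<lambda>x. indicator A x *\<^sub>R f x)"
  using assms by (intro square_integrable_mult_bounded[of _ _ 1]) (auto simp: indicator_def)

lemma square_integrable_inner: "square_integrable f \<Longrightarrow> square_integrable (\<lambda>x. f x \<bullet> e)"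
  by (rule square_integrable_bound[of f _ "norm e"])
    (use Cauchy_Schwarz_ineq2[of _ e] in \<open>auto simp: square_integrable_def mult.commute[of "norm e"]\<close>)

lemma square_integrable_scaleR_const: "square_integrable f \<Longrightarrow> square_integrable (\<lambda>x. f x *\<^sub>R e)"
  by (rule square_integrable_bound[of f _ "norm e"]) (auto simp: square_integrable_def mult.commute)

lemma square_integrable_sum:
  "finite I \<Longrightarrow> (\<And>i. i \<in> I \<Longrightarrow> square_integrable (f i)) \<Longrightarrow> square_integrable (\<lambda>x. \<Sum>i\<in>I. f i x)"
proof (induction I rule: finite_induct)
  case empty
  then show ?case by (simp add: square_integrable_def)
next
  case (insert i I)
  then show ?case by (simp add: square_integrable_add)
qed

lemma square_integrable_scaleR_integrable:
  fixes f :: "real^'n \<Rightarrow> real"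
  assumes "square_integrable f" "square_integrable g"
  shows "integrable lebesgue (\<lambda>x. f x *\<^sub>R g x)"
proof (rule Bochner_Integration.integrable_bound[of lebesgue "\<lambda>x. (norm (f x))\<^sup>2 + (norm (g x))\<^sup>2"])
  show "AE x in lebesgue. norm (f x *\<^sub>R g x) \<le> norm ((norm (f x))\<^sup>2 + (norm (g x))\<^sup>2)"
  proof (intro AE_I2)
    fix x show "norm (f x *\<^sub>R g x) \<le> norm ((norm (f x))\<^sup>2 + (norm (g x))\<^sup>2)"
      using abs_mult_le_squares[of "norm (f x)" "norm (g x)"] by (simp add: abs_mult)
  qed
qed (use assms in \<open>auto simp: square_integrable_def\<close>)

lemma L2_imp_square_integrable: "L2 f \<Longrightarrow> square_integrable f"
  unfolding square_integrable_def by (auto simp: integrable_completion measurable_completion)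

lemma square_integrable_borel: "square_integrable f \<Longrightarrow> f \<in> borel_measurable borel \<Longrightarrow> L2 f"
  for f :: "real^'n \<Rightarrow> real"
  unfolding square_integrable_def by (simp add: integrable_completion)

lemma lebesgue_integral_eq_lborel:
  fixes f g :: "real^'n \<Rightarrow> real"
  assumes "f \<in> borel_measurable borel" "AE x in lebesgue. g x = f x"
  shows "(LINT x|lebesgue. g x) = (LBINT x. f x)"
proof -
  have f: "f \<in> borel_measurable lebesgue" using assms(1) by (intro measurable_completion) simp
  have "AE x in lebesgue. f x = g x" using assms(2) by (rule eventually_mono) simp
  then have "g \<in> borel_measurable lebesgue" by (rule borel_measurable_AE[OF f])
  then have "(LINT x|lebesgue. g x) = (LINT x|lebesgue. f x)"
    by (rule integral_cong_AE[OF _ f assms(2)])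
  also have "\<dots> = (LBINT x. f x)" using assms(1) by (intro integral_completion) simp
  finally show ?thesis .
qed

lemma square_integrable_cong_AE:
  assumes "square_integrable f" "AE x in lebesgue. g x = f x" "g \<in> borel_measurable lebesgue"
  shows "square_integrable g"
proof -
  have "integrable lebesgue (\<lambda>x. (norm (g x))\<^sup>2)"
  proof (rule integrable_cong_AE_imp[OF square_integrableD(2)[OF assms(1)]])
    show "AE x in lebesgue. (norm (f x))\<^sup>2 = (norm (g x))\<^sup>2"
      using assms(2) by (rule eventually_mono) simp
  qed (use assms(3) in auto)
  then show ?thesis using assms(3) by (simp add: square_integrable_def)
qed

text \<open>Lebesgue measurable representatives are exchanged for Borel ones whenever Fubini's theorem is to be used.\<close>

lemma square_integrable_borel_version:
  fixes f :: "real^'n \<Rightarrow> real"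
  assumes "square_integrable f"
  shows "\<exists>f'. L2 f' \<and> (AE x in lebesgue. f x = f' x)"
proof -
  obtain f' where f': "f' \<in> borel_measurable lborel" "AE x in lborel. f x = f' x"
    using completion_ex_borel_measurable_real[OF square_integrableD(1)[OF assms]] by blast
  have ae: "AE x in lebesgue. f' x = f x"
    using AE_completion[OF f'(2)] by eventually_elim simp
  have "f' \<in> borel_measurable lebesgue" using f'(1) by (rule measurable_completion)
  then have "square_integrable f'" by (rule square_integrable_cong_AE[OF assms ae])
  with f'(1) ae show ?thesis by (intro exI[of _ f']) (auto simp: square_integrable_borel elim: eventually_mono)
qed

lemma test_function_square_integrable:
  assumes "test_function U \<phi>"
  shows "square_integrable \<phi>" "square_integrable (grad \<phi>)"
proof -
  show "square_integrable \<phi>"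
    by (rule L2_imp_square_integrable[OF test_function_L2(1)[OF assms]])
  have "square_integrable (\<lambda>x. \<Sum>b\<in>Basis. (grad \<phi> x \<bullet> b) *\<^sub>R b)"
    by (intro square_integrable_sum square_integrable_scaleR_const
        L2_imp_square_integrable[OF test_function_L2(2)[OF assms]]) simp
  then show "square_integrable (grad \<phi>)" by (simp add: euclidean_representation)
qed

section \<open>Functions with square integrable weak gradient\<close>

text \<open>Because test functions and their gradients vanish outside \<open>U\<close>, the integrals can be taken over
  the whole space, and a product \<open>p u\<close> with a test function \<open>p\<close> on \<open>U\<close> is automatically the extension
  by zero.\<close>

definition sobolev :: "(real^'n) set \<Rightarrow> (real^'n \<Rightarrow> real) \<Rightarrow> (real^'n \<Rightarrow> real^'n) \<Rightarrow> bool" where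
  "sobolev U u g \<longleftrightarrow> u \<in> L_p 2 U \<and> g \<in> L_p 2 U \<and>
    (\<forall>\<phi>. test_function U \<phi> \<longrightarrow> (\<forall>e\<in>Basis.
       (LINT x|lebesgue. u x * (grad \<phi> x \<bullet> e)) = - (LINT x|lebesgue. \<phi> x * (g x \<bullet> e))))"

lemma sobolevD:
  assumes "sobolev U u g"
  shows "square_integrable (\<lambda>x. indicator U x * u x)" "square_integrable (\<lambda>x. indicator U x *\<^sub>R g x)"
    "test_function U \<phi> \<Longrightarrow> e \<in> Basis \<Longrightarrow>
      (LINT x|lebesgue. u x * (grad \<phi> x \<bullet> e)) = - (LINT x|lebesgue. \<phi> x * (g x \<bullet> e))"
  using assms unfolding sobolev_def L_p_2_iff by auto

lemma sobolevI:
  assumes "square_integrable (\<lambda>x. indicator U x * u x)" "square_integrable (\<lambda>x. indicator U x *\<^sub>R g x)"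
    "\<And>\<phi> e. test_function U \<phi> \<Longrightarrow> e \<in> Basis \<Longrightarrow>
      (LINT x|lebesgue. u x * (grad \<phi> x \<bullet> e)) = - (LINT x|lebesgue. \<phi> x * (g x \<bullet> e))"
  shows "sobolev U u g"
  using assms unfolding sobolev_def L_p_2_iff by auto

lemma sobolev_UNIV_D:
  assumes "sobolev UNIV u g"
  shows "square_integrable u" "square_integrable g"
  using sobolevD[OF assms] by simp_all

lemma grad_outside:
  assumes "test_function U \<phi>" "x \<notin> U"
  shows "grad \<phi> x = 0"
  using test_functionD(3)[OF assms(1)] assms(2) by (intro grad_outside_support) auto

lemma integrable_scaleR_grad:
  assumes "square_integrable (\<lambda>x. indicator U x * u x)" "test_function U \<phi>"
  shows "integrable lebesgue (\<lambda>x. u x *\<^sub>R grad \<phi> x)"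
proof -
  have "(indicator U x * u x) *\<^sub>R grad \<phi> x = u x *\<^sub>R grad \<phi> x" for x
    using grad_outside[OF assms(2), of x] by (cases "x \<in> U") auto
  then show ?thesis
    using square_integrable_scaleR_integrable[OF assms(1) test_function_square_integrable(2)[OF assms(2)]]
    by (simp only:)
qed

lemma integrable_test_scaleR:
  assumes "square_integrable (\<lambda>x. indicator U x *\<^sub>R g x)" "test_function U \<phi>"
  shows "integrable lebesgue (\<lambda>x. \<phi> x *\<^sub>R g x)"
proof -
  have "\<phi> x *\<^sub>R indicator U x *\<^sub>R g x = \<phi> x *\<^sub>R g x" for x
    using test_function_outside[OF assms(2), of x] by (cases "x \<in> U") auto
  then show ?thesis
    using square_integrable_scaleR_integrable[OF test_function_square_integrable(1)[OF assms(2)] assms(1)]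
    by (simp only:)
qed

lemma integrable_mult_grad:
  assumes "square_integrable (\<lambda>x. indicator U x * u x)" "test_function U \<phi>"
  shows "integrable lebesgue (\<lambda>x. u x * (grad \<phi> x \<bullet> e))"
  using integrable_inner_left[OF integrable_scaleR_grad[OF assms], of e] by simp

lemma integrable_test_mult:
  assumes "square_integrable (\<lambda>x. indicator U x *\<^sub>R g x)" "test_function U \<phi>"
  shows "integrable lebesgue (\<lambda>x. \<phi> x * (g x \<bullet> e))"
  using integrable_inner_left[OF integrable_test_scaleR[OF assms], of e] by simp

lemma L_p_2_imp_L1_loc:
  assumes "u \<in> L_p 2 U"
  shows "u \<in> L1_loc U"
  unfolding L1_loc_def
proof (intro CollectI allI impI, elim conjE)
  fix A assume A: "compact A" "A \<subseteq> U"
  have "L2 (indicator A :: real^'a \<Rightarrow> real)"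
    using borel_compact[OF A(1)] emeasure_compact_finite[OF A(1)]
    by (simp add: power2_eq_square flip: indicator_inter_arith)
  then have "square_integrable (indicator A :: real^'a \<Rightarrow> real)" by (rule L2_imp_square_integrable)
  from square_integrable_scaleR_integrable[OF this assms[unfolded L_p_2_iff]]
  have "integrable lebesgue (\<lambda>x. indicator A x *\<^sub>R indicator U x *\<^sub>R u x)" .
  moreover have "indicator A x *\<^sub>R indicator U x *\<^sub>R u x = indicator A x *\<^sub>R u x" for x
    using A(2) by (auto simp: indicator_def)
  ultimately show "set_integrable lebesgue A u" by (simp only: set_integrable_def)
qed

lemma sobolev_iff_weak_gradient:
  "sobolev U u g \<longleftrightarrow> u \<in> L_p 2 U \<and> g \<in> L_p 2 U \<and> weak_gradient U u g"
proof (cases "u \<in> L_p 2 U \<and> g \<in> L_p 2 U")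
  case True
  then have s: "square_integrable (\<lambda>x. indicator U x * u x)" "square_integrable (\<lambda>x. indicator U x *\<^sub>R g x)"
    unfolding L_p_2_iff by auto
  have "(LINT x:U|lebesgue. u x *\<^sub>R grad \<phi> x) = - (LINT x:U|lebesgue. \<phi> x *\<^sub>R g x) \<longleftrightarrow>
     (\<forall>e\<in>Basis. (LINT x|lebesgue. u x * (grad \<phi> x \<bullet> e)) = - (LINT x|lebesgue. \<phi> x * (g x \<bullet> e)))"
    if \<phi>: "test_function U \<phi>" for \<phi>
  proof -
    have "(LINT x:U|lebesgue. u x *\<^sub>R grad \<phi> x) = (LINT x|lebesgue. u x *\<^sub>R grad \<phi> x)"
      unfolding set_lebesgue_integral_def
      by (rule Bochner_Integration.integral_cong) (use grad_outside[OF \<phi>] in \<open>auto simp: indicator_def\<close>)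
    moreover have "(LINT x:U|lebesgue. \<phi> x *\<^sub>R g x) = (LINT x|lebesgue. \<phi> x *\<^sub>R g x)"
      unfolding set_lebesgue_integral_def
      by (rule Bochner_Integration.integral_cong) (use test_function_outside[OF \<phi>] in \<open>auto simp:
          indicator_def\<close>)
    moreover have "(LINT x|lebesgue. u x * (grad \<phi> x \<bullet> e)) = (LINT x|lebesgue. u x *\<^sub>R grad \<phi> x) \<bullet> e"
      "(LINT x|lebesgue. \<phi> x * (g x \<bullet> e)) = (LINT x|lebesgue. \<phi> x *\<^sub>R g x) \<bullet> e" for e
      using integral_inner_left[OF integrable_scaleR_grad[OF s(1) \<phi>]] integral_inner_left[OF
          integrable_test_scaleR[OF s(2) \<phi>]]
      by simp_all
    ultimately show ?thesis
      by (auto simp: euclidean_eq_iff[where 'a="real^'a"])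
  qed
  with True show ?thesis
    using L_p_2_imp_L1_loc[of u U] L_p_2_imp_L1_loc[of g U] unfolding sobolev_def weak_gradient_def by auto
qed (auto simp: sobolev_def)

lemma W1p_2_iff: "u \<in> W1p 2 U \<longleftrightarrow> (\<exists>g. sobolev U u g)"
  unfolding W1p_def sobolev_iff_weak_gradient by auto

text \<open>The chosen gradient \<open>wgrad\<close> is only known to be locally integrable, so uniqueness is needed in this
  generality.\<close>

lemma weak_gradient_unique:
  assumes U: "open U" and g: "weak_gradient U u g" "weak_gradient U u g'"
  shows "AE x in lebesgue. x \<in> U \<longrightarrow> g x = g' x"
proof -
  have loc: "set_integrable lebesgue B g" "set_integrable lebesgue B g'" if "compact B" "B \<subseteq> U" for B
    using g that unfolding weak_gradient_def L1_loc_def by auto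
  have "AE x in lebesgue. x \<in> U \<longrightarrow> (g x - g' x) \<bullet> b = 0" for b
  proof (rule fundamental_lemma[OF U])
    show "set_integrable lebesgue B (\<lambda>x. (g x - g' x) \<bullet> b)" if "compact B" "B \<subseteq> U" for B
    proof -
      have "integrable lebesgue (\<lambda>x. (indicator B x *\<^sub>R g x - indicator B x *\<^sub>R g' x) \<bullet> b)"
        using loc[OF that] unfolding set_integrable_def by (intro integrable_inner_left
            Bochner_Integration.integrable_diff)
      then show ?thesis unfolding set_integrable_def by (simp add: inner_diff_left right_diff_distrib)
    qed
    show "(LINT x|lebesgue. \<phi> x * ((g x - g' x) \<bullet> b)) = 0" if \<phi>: "test_function U \<phi>" for \<phi>
    proof -
      note D = test_functionD[OF \<phi>]
      obtain M where M: "\<And>x. \<bar>\<phi> x\<bar> \<le> M" using test_function_bounded[OF \<phi>] by blast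
      have m: "\<phi> \<in> borel_measurable lebesgue"
        using square_integrableD(1)[OF test_function_square_integrable(1)[OF \<phi>]] .
      have int: "integrable lebesgue (\<lambda>x. \<phi> x *\<^sub>R h x)"
        if "set_integrable lebesgue (closure {x. \<phi> x \<noteq> 0}) h" for h :: "real^'a \<Rightarrow> real^'a"
      proof -
        have "integrable lebesgue (\<lambda>x. \<phi> x *\<^sub>R (indicator (closure {x. \<phi> x \<noteq> 0}) x *\<^sub>R h x))"
        proof (rule Bochner_Integration.integrable_bound[of lebesgue "\<lambda>x. M *\<^sub>R (indicator
            (closure {x. \<phi> x \<noteq> 0}) x *\<^sub>R h x)"])
          show "AE x in lebesgue. norm (\<phi> x *\<^sub>R indicator (closure {x. \<phi> x \<noteq> 0}) x *\<^sub>R h x) \<le>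
              norm (M *\<^sub>R indicator (closure {x. \<phi> x \<noteq> 0}) x *\<^sub>R h x)"
            unfolding norm_scaleR using M
            by (intro AE_I2 mult_right_mono) (auto intro: order_trans[OF _ abs_ge_self])
          show "(\<lambda>x. \<phi> x *\<^sub>R indicator (closure {x. \<phi> x \<noteq> 0}) x *\<^sub>R h x) \<in> borel_measurable lebesgue"
            using borel_measurable_integrable[OF that[unfolded set_integrable_def]] m by
                (rule borel_measurable_scaleR[rotated])
        qed (use that integrable_scaleR_right in \<open>auto simp only: set_integrable_def\<close>)
        moreover have "\<phi> x *\<^sub>R indicator (closure {x. \<phi> x \<noteq> 0}) x *\<^sub>R h x = \<phi> x *\<^sub>R h x" for x
          using outside_support[of x \<phi>] by (auto simp: indicator_def)
        ultimately show ?thesis by (simp only:)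
      qed
      have eqU: "(LINT x:U|lebesgue. \<phi> x *\<^sub>R h x) = (LINT x|lebesgue. \<phi> x *\<^sub>R h x)" for h :: "real^'a \<Rightarrow> real^'a"
        unfolding set_lebesgue_integral_def
        by (rule Bochner_Integration.integral_cong) (use test_function_outside[OF \<phi>] in \<open>auto simp:
            indicator_def\<close>)
      have "(LINT x:U|lebesgue. u x *\<^sub>R grad \<phi> x) = - (LINT x:U|lebesgue. \<phi> x *\<^sub>R g x)"
        "(LINT x:U|lebesgue. u x *\<^sub>R grad \<phi> x) = - (LINT x:U|lebesgue. \<phi> x *\<^sub>R g' x)"
        using g \<phi> unfolding weak_gradient_def by blast+
      then have "(LINT x|lebesgue. \<phi> x *\<^sub>R g x) = (LINT x|lebesgue. \<phi> x *\<^sub>R g' x)"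
        unfolding eqU by simp
      then have "(LINT x|lebesgue. \<phi> x *\<^sub>R g x - \<phi> x *\<^sub>R g' x) \<bullet> b = 0"
        using int[OF loc(1)[OF D(2,3)]] int[OF loc(2)[OF D(2,3)]] by simp
      moreover have "integrable lebesgue (\<lambda>x. \<phi> x *\<^sub>R g x - \<phi> x *\<^sub>R g' x)"
        using int[OF loc(1)[OF D(2,3)]] int[OF loc(2)[OF D(2,3)]] by (rule Bochner_Integration.integrable_diff)
      ultimately have "(LINT x|lebesgue. (\<phi> x *\<^sub>R g x - \<phi> x *\<^sub>R g' x) \<bullet> b) = 0"
        by (subst integral_inner_left) auto
      then show ?thesis by (simp add: inner_diff_left right_diff_distrib)
    qed
  qed
  then have "AE x in lebesgue. \<forall>b\<in>Basis. x \<in> U \<longrightarrow> (g x - g' x) \<bullet> b = 0"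
    by (intro AE_finite_allI) auto
  then show ?thesis
    by (rule eventually_mono) (auto simp: euclidean_eq_iff[of "g _"] inner_diff_left)
qed

lemma wgrad_eq:
  assumes "open U" "sobolev U u g"
  shows "AE x in lebesgue. x \<in> U \<longrightarrow> wgrad U u x = g x"
proof (rule weak_gradient_unique[OF assms(1)])
  have g: "weak_gradient U u g" using assms(2) by (simp add: sobolev_iff_weak_gradient)
  show "weak_gradient U u g" by fact
  show "weak_gradient U u (wgrad U u)" unfolding wgrad_def by (rule someI[of "weak_gradient U u", OF g])
qed

lemma sobolev_cong_AE:
  assumes "sobolev U u g" "AE x in lebesgue. x \<in> U \<longrightarrow> u' x = u x" "AE x in lebesgue. x \<in> U \<longrightarrow> g' x = g x"
    and "open U"
  shows "sobolev U u' g'"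
proof (rule sobolevI)
  note D = sobolevD[OF assms(1)]
  have ae: "AE x in lebesgue. indicator U x * u' x = indicator U x * u x"
    "AE x in lebesgue. indicator U x *\<^sub>R g' x = indicator U x *\<^sub>R g x"
    by (rule eventually_mono[OF assms(2)], simp add: indicator_def)
      (rule eventually_mono[OF assms(3)], auto simp: indicator_def)
  have ms: "(\<lambda>x. indicator U x * u' x) \<in> borel_measurable lebesgue"
      "(\<lambda>x. indicator U x *\<^sub>R g' x) \<in> borel_measurable lebesgue"
    by (rule borel_measurable_AE[OF square_integrableD(1)[OF D(1)]], rule eventually_mono[OF ae(1)], erule sym)
      (rule borel_measurable_AE[OF square_integrableD(1)[OF D(2)]], rule eventually_mono[OF ae(2)], erule sym)
  show "square_integrable (\<lambda>x. indicator U x * u' x)" "square_integrable (\<lambda>x. indicator U x *\<^sub>R g' x)"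
    using square_integrable_cong_AE[OF D(1) ae(1) ms(1)] square_integrable_cong_AE[OF D(2) ae(2) ms(2)] .
  fix \<phi> e assume \<phi>: "test_function U \<phi>" and e: "e \<in> (Basis :: (real^'a) set)"
  note sq = \<open>square_integrable (\<lambda>x. indicator U x * u' x)\<close> \<open>square_integrable (\<lambda>x. indicator U x *\<^sub>R g' x)\<close>
  have "(LINT x|lebesgue. u' x * (grad \<phi> x \<bullet> e)) = (LINT x|lebesgue. u x * (grad \<phi> x \<bullet> e))"
  proof (rule integral_cong_AE)
    show "AE x in lebesgue. u' x * (grad \<phi> x \<bullet> e) = u x * (grad \<phi> x \<bullet> e)"
      using assms(2) by (rule eventually_mono) (use grad_outside[OF \<phi>] in force)
  qed (use integrable_mult_grad[OF sq(1) \<phi>] integrable_mult_grad[OF D(1) \<phi>] in auto)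
  moreover have "(LINT x|lebesgue. \<phi> x * (g' x \<bullet> e)) = (LINT x|lebesgue. \<phi> x * (g x \<bullet> e))"
  proof (rule integral_cong_AE)
    show "AE x in lebesgue. \<phi> x * (g' x \<bullet> e) = \<phi> x * (g x \<bullet> e)"
      using assms(3) by (rule eventually_mono) (use test_function_outside[OF \<phi>] in force)
  qed (use integrable_test_mult[OF sq(2) \<phi>] integrable_test_mult[OF D(2) \<phi>] in auto)
  ultimately show "(LINT x|lebesgue. u' x * (grad \<phi> x \<bullet> e)) = - (LINT x|lebesgue. \<phi> x * (g' x \<bullet> e))"
    using D(3)[OF \<phi> e] by simp
qed

lemma sobolev_wgrad:
  assumes "open U" "u \<in> W1p 2 U"
  shows "sobolev U u (wgrad U u)"
proof -
  obtain g where g: "sobolev U u g" using assms(2) W1p_2_iff by blast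
  show ?thesis
  proof (rule sobolev_cong_AE[OF g])
    show "AE x in lebesgue. x \<in> U \<longrightarrow> wgrad U u x = g x" by (rule wgrad_eq[OF assms(1) g])
  qed (use assms(1) in auto)
qed

lemma sobolev_add:
  assumes "sobolev U u g" "sobolev U v h"
  shows "sobolev U (\<lambda>x. u x + v x) (\<lambda>x. g x + h x)"
proof (rule sobolevI)
  note D = sobolevD[OF assms(1)] and E = sobolevD[OF assms(2)]
  show "square_integrable (\<lambda>x. indicator U x * (u x + v x))" "square_integrable (\<lambda>x. indicator U x *\<^sub>R (g x
      + h x))"
    using square_integrable_add[OF D(1) E(1)] square_integrable_add[OF D(2) E(2)]
    by (simp_all add: distrib_left scaleR_add_right)
  fix \<phi> e assume \<phi>: "test_function U \<phi>" and e: "e \<in> (Basis :: (real^'a) set)"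
  show "(LINT x|lebesgue. (u x + v x) * (grad \<phi> x \<bullet> e)) = - (LINT x|lebesgue. \<phi> x * ((g x + h x) \<bullet> e))"
    using D(3)[OF \<phi> e] E(3)[OF \<phi> e] integrable_mult_grad[OF D(1) \<phi>, of e] integrable_mult_grad[OF E(1) \<phi>, of e]
      integrable_test_mult[OF D(2) \<phi>, of e] integrable_test_mult[OF E(2) \<phi>, of e]
    by (simp add: distrib_right distrib_left inner_add_left)
qed

lemma sobolev_cmult:
  assumes "sobolev U u g"
  shows "sobolev U (\<lambda>x. c * u x) (\<lambda>x. c *\<^sub>R g x)"
proof (rule sobolevI)
  note D = sobolevD[OF assms(1)]
  show "square_integrable (\<lambda>x. indicator U x * (c * u x))" "square_integrable (\<lambda>x. indicator U x *\<^sub>R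
      (c *\<^sub>R g x))"
    using square_integrable_cmult[OF D(1), of c] square_integrable_cmult[OF D(2), of c]
    by (simp_all only: real_scaleR_def scaleR_left_commute[of c] mult.left_commute[of c])
  fix \<phi> e assume \<phi>: "test_function U \<phi>" and e: "e \<in> (Basis :: (real^'a) set)"
  have "(LINT x|lebesgue. c * u x * (grad \<phi> x \<bullet> e)) = c * (LINT x|lebesgue. u x * (grad \<phi> x \<bullet> e))"
    unfolding mult.assoc by simp
  moreover have "(LINT x|lebesgue. \<phi> x * (c *\<^sub>R g x \<bullet> e)) = c * (LINT x|lebesgue. \<phi> x * (g x \<bullet> e))"
    unfolding inner_scaleR_left mult.left_commute[of "\<phi> _" c] by simp
  ultimately show "(LINT x|lebesgue. c * u x * (grad \<phi> x \<bullet> e)) = - (LINT x|lebesgue. \<phi> x * (c *\<^sub>R g x \<bullet> e))"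
    using D(3)[OF \<phi> e] by simp
qed

lemma sobolev_diff:
  assumes "sobolev U u g" "sobolev U v h"
  shows "sobolev U (\<lambda>x. u x - v x) (\<lambda>x. g x - h x)"
  using sobolev_add[OF assms(1) sobolev_cmult[OF assms(2), of "-1"]] by simp

lemma sobolev_restrict:
  assumes "sobolev V u g" "U \<subseteq> V" "open U"
  shows "sobolev U u g"
proof (rule sobolevI)
  note D = sobolevD[OF assms(1)]
  have U: "U \<in> sets lebesgue" using assms(3) by simp
  have "indicator U x * (indicator V x * u x) = indicator U x * u x"
    "indicator U x *\<^sub>R (indicator V x *\<^sub>R g x) = indicator U x *\<^sub>R g x" for x
    using assms(2) by (auto simp: indicator_def)
  then show "square_integrable (\<lambda>x. indicator U x * u x)" "square_integrable (\<lambda>x. indicator U x *\<^sub>R g x)"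
    using square_integrable_indicator[OF D(1) U] square_integrable_indicator[OF D(2) U]
    by (simp_all only: real_scaleR_def)
qed (use sobolevD(3)[OF assms(1)] test_function_mono[OF _ assms(2)] in blast)

text \<open>The product rule, testing \<open>u\<close> with \<open>\<phi> p\<close>.  It serves two purposes: multiplying by a test function
  on the whole space keeps the domain \<open>U\<close>, and multiplying by a test function on \<open>U\<close> extends to the
  whole space.\<close>

lemma sobolev_mult_aux:
  assumes u: "sobolev U u g"
    and ext: "\<And>\<phi>. test_function W \<phi> \<Longrightarrow> test_function U (\<lambda>x. \<phi> x * p x)"
    and p: "test_function V p" and UV: "W = U \<and> V = UNIV \<or> W = UNIV \<and> V = U" and U: "open U"
  shows "sobolev W (\<lambda>x. p x * u x) (\<lambda>x. p x *\<^sub>R g x + u x *\<^sub>R grad p x)"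
proof (rule sobolevI)
  note D = sobolevD[OF u]
  obtain B where B: "\<And>x. \<bar>p x\<bar> \<le> B" "\<And>x. norm (grad p x) \<le> B" using test_function_bounded[OF p] by blast
  have W: "indicator W x * p x = indicator U x * p x" "indicator W x *\<^sub>R grad p x
      = indicator U x *\<^sub>R grad p x" for x
    using UV test_function_outside[OF p, of x] grad_outside[OF p, of x] by (auto simp: indicator_def)
  have pm: "p \<in> borel_measurable lebesgue" "grad p \<in> borel_measurable lebesgue"
    using test_function_square_integrable[OF p] square_integrableD(1) by blast+
  have s1: "square_integrable (\<lambda>x. p x * (indicator U x * u x))" "square_integrable (\<lambda>x. p x *\<^sub>R
      (indicator U x *\<^sub>R g x))"
    using square_integrable_mult_bounded[OF D(1) pm(1) B(1)] square_integrable_mult_bounded[OF D(2) pm(1)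
        B(1)] by simp_all
  have s2: "square_integrable (\<lambda>x. (indicator U x * u x) *\<^sub>R grad p x)"
  proof (rule square_integrable_bound[OF D(1)])
    show "(\<lambda>x. (indicator U x * u x) *\<^sub>R grad p x) \<in> borel_measurable lebesgue"
      using square_integrableD(1)[OF D(1)] pm(2) by (rule borel_measurable_scaleR)
    show "norm ((indicator U x * u x) *\<^sub>R grad p x) \<le> B * norm (indicator U x * u x)" for x
      unfolding norm_scaleR using mult_left_mono[OF B(2), of "\<bar>indicator U x * u x\<bar>" x] by
          (simp add: mult.commute)
  qed
  have "indicator W x * (p x * u x) = p x * (indicator U x * u x)" for x
    using arg_cong[OF W(1)[of x], of "\<lambda>a. a * u x"] by (simp only: mult.assoc mult.left_commute)
  then show "square_integrable (\<lambda>x. indicator W x * (p x * u x))" using s1(1) by (simp only:)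
  have "indicator W x *\<^sub>R (p x *\<^sub>R g x + u x *\<^sub>R grad p x) =
      p x *\<^sub>R (indicator U x *\<^sub>R g x) + (indicator U x * u x) *\<^sub>R grad p x" for x
  proof -
    have "indicator W x *\<^sub>R (p x *\<^sub>R g x + u x *\<^sub>R grad p x) =
        (indicator W x * p x) *\<^sub>R g x + u x *\<^sub>R (indicator W x *\<^sub>R grad p x)"
      by (simp add: scaleR_add_right mult.commute)
    also have "\<dots> = (indicator U x * p x) *\<^sub>R g x + u x *\<^sub>R (indicator U x *\<^sub>R grad p x)"
      by (simp only: W)
    finally show ?thesis by (simp add: mult.commute)
  qed
  then show "square_integrable (\<lambda>x. indicator W x *\<^sub>R (p x *\<^sub>R g x + u x *\<^sub>R grad p x))"
    using square_integrable_add[OF s1(2) s2] by (simp only:)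
  fix \<phi> e assume \<phi>: "test_function W \<phi>" and e: "e \<in> (Basis :: (real^'a) set)"
  note \<phi>p = ext[OF \<phi>]
  note g\<phi>p = grad_mult[OF test_functionD(1)[OF \<phi>] test_functionD(1)[OF p]]
  have i1: "integrable lebesgue (\<lambda>x. (p x * u x) * (grad \<phi> x \<bullet> e))"
    using integrable_mult_grad[OF \<open>square_integrable (\<lambda>x. indicator W x * (p x * u x))\<close> \<phi>] .
  have i2: "integrable lebesgue (\<lambda>x. u x * (grad (\<lambda>x. \<phi> x * p x) x \<bullet> e))"
    using integrable_mult_grad[OF D(1) \<phi>p] .
  have i3: "integrable lebesgue (\<lambda>x. (\<phi> x * p x) * (g x \<bullet> e))"
    using integrable_test_mult[OF D(2) \<phi>p] .
  have eq: "(\<lambda>x. \<phi> x * (u x * (grad p x \<bullet> e))) = (\<lambda>x. u x * (grad (\<lambda>x. \<phi> x * p x) x \<bullet> e) - (p x * u x) *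
      (grad \<phi> x \<bullet> e))"
    unfolding g\<phi>p by (simp add: inner_add_left algebra_simps)
  have i4: "integrable lebesgue (\<lambda>x. \<phi> x * (u x * (grad p x \<bullet> e)))"
    unfolding eq using i1 i2 by simp
  have "(LINT x|lebesgue. \<phi> x * (u x * (grad p x \<bullet> e))) =
     - (LINT x|lebesgue. (\<phi> x * p x) * (g x \<bullet> e)) - (LINT x|lebesgue. (p x * u x) * (grad \<phi> x \<bullet> e))"
    unfolding eq using i1 i2 D(3)[OF \<phi>p e] by simp
  moreover have "(LINT x|lebesgue. \<phi> x * ((p x *\<^sub>R g x + u x *\<^sub>R grad p x) \<bullet> e)) =
      (LINT x|lebesgue. (\<phi> x * p x) * (g x \<bullet> e)) + (LINT x|lebesgue. \<phi> x * (u x * (grad p x \<bullet> e)))"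
    using i3 i4 by (subst Bochner_Integration.integral_add[symmetric]) (auto simp: inner_add_left algebra_simps)
  ultimately show "(LINT x|lebesgue. (p x * u x) * (grad \<phi> x \<bullet> e)) =
      - (LINT x|lebesgue. \<phi> x * ((p x *\<^sub>R g x + u x *\<^sub>R grad p x) \<bullet> e))" by simp
qed

lemma sobolev_mult_test_function:
  assumes "sobolev U u g" "test_function UNIV p" "open U"
  shows "sobolev U (\<lambda>x. p x * u x) (\<lambda>x. p x *\<^sub>R g x + u x *\<^sub>R grad p x)"
  using assms test_functionD(1)[OF assms(2)] by (intro sobolev_mult_aux[of U u g U p UNIV])
      (auto intro: test_function_mult)

lemma sobolev_extend_by_zero:
  assumes "sobolev U u g" "test_function U p" "open U"
  shows "sobolev UNIV (\<lambda>x. p x * u x) (\<lambda>x. p x *\<^sub>R g x + u x *\<^sub>R grad p x)"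
proof (rule sobolev_mult_aux[of U u g UNIV p U, OF assms(1) _ assms(2) _ assms(3)])
  fix \<phi> :: "real^'a \<Rightarrow> real" assume "test_function UNIV \<phi>"
  from test_function_mult[OF assms(2) test_functionD(1)[OF this]]
  show "test_function U (\<lambda>x. \<phi> x * p x)" by (simp add: mult.commute)
qed auto

lemma sobolev_UNIV_weak_dderiv:
  fixes w q :: "real^'n \<Rightarrow> real"
  assumes "sobolev UNIV w0 g" "e \<in> Basis"
    and w: "L2 w" "AE x in lebesgue. w0 x = w x" and q: "L2 q" "AE x in lebesgue. g x \<bullet> e = q x"
  shows "weak_dderiv e w q"
proof -
  have "(LBINT x. w x * (grad \<phi> x \<bullet> e)) = - (LBINT x. \<phi> x * q x)"
    if \<phi>: "test_function UNIV \<phi>" for \<phi> :: "real^'n \<Rightarrow> real"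
  proof -
    note T = test_function_L2[OF \<phi>]
    have "(LINT x|lebesgue. w0 x * (grad \<phi> x \<bullet> e)) = (LBINT x. w x * (grad \<phi> x \<bullet> e))"
      by (rule lebesgue_integral_eq_lborel) (use T(2)[of e] w in \<open>auto elim: eventually_mono\<close>)
    moreover have "(LINT x|lebesgue. \<phi> x * (g x \<bullet> e)) = (LBINT x. \<phi> x * q x)"
      by (rule lebesgue_integral_eq_lborel) (use T(1) q in \<open>auto elim: eventually_mono\<close>)
    ultimately show ?thesis using sobolevD(3)[OF assms(1) \<phi> assms(2)] by simp
  qed
  then show ?thesis using w q unfolding weak_dderiv_def by blast
qed

lemma sobolev_of_weak_dderivs:
  fixes w :: "real^'n \<Rightarrow> real"
  assumes "\<And>b. b \<in> Basis \<Longrightarrow> weak_dderiv b w (q b)"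
  shows "sobolev UNIV w (\<lambda>x. \<Sum>b\<in>Basis. q b x *\<^sub>R b)"
proof (rule sobolevI)
  have L: "L2 w" "L2 (q b)" if "b \<in> Basis" for b using assms[OF that] unfolding weak_dderiv_def by auto
  obtain b0 where b0: "b0 \<in> (Basis :: (real^'n) set)" using nonempty_Basis by blast
  note Lw = L(1)[OF b0]
  show "square_integrable (\<lambda>x. indicator UNIV x * w x)" using L2_imp_square_integrable[OF Lw] by simp
  show "square_integrable (\<lambda>x. indicator UNIV x *\<^sub>R (\<Sum>b\<in>Basis. q b x *\<^sub>R b))"
    using L(2) by (simp add: square_integrable_sum square_integrable_scaleR_const L2_imp_square_integrable)
  fix \<phi> :: "real^'n \<Rightarrow> real" and e :: "real^'n" assume \<phi>: "test_function UNIV \<phi>" and e: "e \<in> Basis"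
  note T = test_function_L2[OF \<phi>]
  have "(\<Sum>b\<in>Basis. q b x *\<^sub>R b) \<bullet> e = q e x" for x
    using e by (simp add: inner_sum_left inner_Basis if_distrib[of "\<lambda>a. _ * a"] cong: if_cong)
  moreover have "(LINT x|lebesgue. w x * (grad \<phi> x \<bullet> e)) = (LBINT x. w x * (grad \<phi> x \<bullet> e))"
    using T(2)[of e] Lw by (intro integral_completion) auto
  moreover have "(LINT x|lebesgue. \<phi> x * q e x) = (LBINT x. \<phi> x * q e x)"
    using T(1) L(2)[OF e] by (intro integral_completion) auto
  ultimately show "(LINT x|lebesgue. w x * (grad \<phi> x \<bullet> e)) = - (LINT x|lebesgue. \<phi> x *
      ((\<Sum>b\<in>Basis. q b x *\<^sub>R b) \<bullet> e))"
    using assms[OF e] \<phi> unfolding weak_dderiv_def by simp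
qed

text \<open>A cut-off that equals \<open>1\<close> near the support of the test function reduces the claim to the chain rule
  on the whole space.\<close>

lemma (in truncation) sobolev_chain_rule:
  assumes u: "sobolev U u g" and U: "open U"
  shows "sobolev U (\<lambda>x. \<beta> (u x)) (\<lambda>x. \<beta>' (u x) *\<^sub>R g x)"
proof (rule sobolevI)
  note D = sobolevD[OF u]
  have [measurable]: "(\<lambda>x. indicator U x * u x) \<in> borel_measurable lebesgue"
      "(\<lambda>x. indicator U x *\<^sub>R g x) \<in> borel_measurable lebesgue"
    using D(1,2) square_integrableD(1) by blast+
  have e1: "indicator U x * \<beta> (u x) = \<beta> (indicator U x * u x)" for x using at_0 by (simp add: indicator_def)
  have e2: "indicator U x *\<^sub>R (\<beta>' (u x) *\<^sub>R g x) = \<beta>' (indicator U x * u x) *\<^sub>R (indicator U x *\<^sub>R g x)" for x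
    by (simp add: indicator_def)
  show s1: "square_integrable (\<lambda>x. indicator U x * \<beta> (u x))"
    unfolding e1 by (rule square_integrable_bound[OF D(1), of _ 1]) (use abs_le in auto)
  show s2: "square_integrable (\<lambda>x. indicator U x *\<^sub>R (\<beta>' (u x) *\<^sub>R g x))"
    unfolding e2 by (rule square_integrable_mult_bounded[OF D(2), of _ 1]) (use deriv_le_1 in auto)
  fix \<phi> e assume \<phi>: "test_function U \<phi>" and e: "e \<in> (Basis :: (real^'a) set)"
  note T = test_functionD[OF \<phi>]
  have \<phi>': "test_function UNIV \<phi>" using test_function_mono[OF \<phi>] by simp
  note T2 = test_function_L2[OF \<phi>']
  obtain p V where p: "test_function U p" "open V" "closure {x. \<phi> x \<noteq> 0} \<subseteq> V" "\<forall>x\<in>V. p x = 1"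
    using cutoff_exists[OF T(2) U T(3)] by (elim exE conjE)
  have gp: "grad p x = 0" if "x \<in> V" for x
  proof -
    have "GDERIV p x :> 0"
      unfolding gderiv_def
      by (rule has_derivative_transform_within_open[of "\<lambda>_. 1" _ _ _ V]) (use p that in auto)
    then show ?thesis by (rule grad_eqI)
  qed
  note P = sobolev_extend_by_zero[OF u p(1) U]
  obtain w where w: "L2 w" "AE x in lebesgue. p x * u x = w x"
    using square_integrable_borel_version[OF sobolev_UNIV_D(1)[OF P]] by blast
  obtain q where q: "L2 q" "AE x in lebesgue. (p x *\<^sub>R g x + u x *\<^sub>R grad p x) \<bullet> e = q x"
    using square_integrable_borel_version[OF square_integrable_inner[OF sobolev_UNIV_D(2)[OF P]]] by blast
  have "weak_dderiv e (\<lambda>x. \<beta> (w x)) (\<lambda>x. \<beta>' (w x) * q x)"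
    by (rule chain_rule[OF sobolev_UNIV_weak_dderiv[OF P e w q]])
  then have "(LBINT x. \<beta> (w x) * (grad \<phi> x \<bullet> e)) = - (LBINT x. \<phi> x * (\<beta>' (w x) * q x))"
    using \<phi>' unfolding weak_dderiv_def by blast
  moreover have "(LINT x|lebesgue. \<beta> (u x) * (grad \<phi> x \<bullet> e)) = (LBINT x. \<beta> (w x) * (grad \<phi> x \<bullet> e))"
  proof (rule lebesgue_integral_eq_lborel)
    show "(\<lambda>x. \<beta> (w x) * (grad \<phi> x \<bullet> e)) \<in> borel_measurable borel"
      using T2(2)[of e] L2_compose[OF w(1)] by auto
    show "AE x in lebesgue. \<beta> (u x) * (grad \<phi> x \<bullet> e) = \<beta> (w x) * (grad \<phi> x \<bullet> e)"
      using w(2)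
    proof (rule eventually_mono)
      fix x assume *: "p x * u x = w x"
      show "\<beta> (u x) * (grad \<phi> x \<bullet> e) = \<beta> (w x) * (grad \<phi> x \<bullet> e)"
      proof (cases "x \<in> closure {x. \<phi> x \<noteq> 0}")
        case True then show ?thesis using * p(3,4) by auto
      qed (simp add: grad_outside_support)
    qed
  qed
  moreover have "(LINT x|lebesgue. \<phi> x * ((\<beta>' (u x) *\<^sub>R g x) \<bullet> e)) = (LBINT x. \<phi> x * (\<beta>' (w x) * q x))"
  proof (rule lebesgue_integral_eq_lborel)
    show "(\<lambda>x. \<phi> x * (\<beta>' (w x) * q x)) \<in> borel_measurable borel"
      using T2(1) L2_deriv_mult[OF q(1) conjunct1[OF w(1)]] by auto
    show "AE x in lebesgue. \<phi> x * ((\<beta>' (u x) *\<^sub>R g x) \<bullet> e) = \<phi> x * (\<beta>' (w x) * q x)"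
      using w(2) q(2)
    proof (rule eventually_elim2)
      fix x assume *: "p x * u x = w x" "(p x *\<^sub>R g x + u x *\<^sub>R grad p x) \<bullet> e = q x"
      show "\<phi> x * ((\<beta>' (u x) *\<^sub>R g x) \<bullet> e) = \<phi> x * (\<beta>' (w x) * q x)"
      proof (cases "x \<in> closure {x. \<phi> x \<noteq> 0}")
        case True then show ?thesis using * p(3,4) gp[of x] by auto
      next
        case False then show ?thesis using outside_support[of x \<phi>] by simp
      qed
    qed
  qed
  ultimately show "(LINT x|lebesgue. \<beta> (u x) * (grad \<phi> x \<bullet> e)) = - (LINT x|lebesgue. \<phi> x * ((\<beta>'
      (u x) *\<^sub>R g x) \<bullet> e))"
    by simp
qed

text \<open>Averages commute with weak derivatives, so both the function and its gradient converge in \<open>L\<^sup>2\<close>.\<close>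

lemma avg_sobolev_approx:
  fixes w :: "real^'n \<Rightarrow> real"
  assumes av: "averaging \<nu> R" and w: "sobolev UNIV w g" "w \<in> borel_measurable borel" and \<epsilon>: "\<epsilon> > 0"
  shows "\<exists>d>0. \<forall>t. \<bar>t\<bar> < d \<longrightarrow> (\<exists>\<gamma>. sobolev UNIV (averaging.avg \<nu> t w) \<gamma> \<and>
    (LINT x|lebesgue. (averaging.avg \<nu> t w x - w x)\<^sup>2) < \<epsilon> \<and> (LINT x|lebesgue. (norm (\<gamma> x - g x))\<^sup>2) < \<epsilon>)"
proof -
  interpret averaging \<nu> R by fact
  have Lw: "L2 w" using square_integrable_borel[OF sobolev_UNIV_D(1)[OF w(1)] w(2)] .
  have "\<exists>q. L2 q \<and> (AE x in lebesgue. g x \<bullet> b = q x)" for b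
    by (rule square_integrable_borel_version[OF square_integrable_inner[OF sobolev_UNIV_D(2)[OF w(1)]]])
  from choice[OF allI[OF this]] obtain q where "\<forall>b. L2 (q b) \<and> (AE x in lebesgue. g x \<bullet> b = q b x)" ..
  then have q: "\<And>b. L2 (q b)" "\<And>b. AE x in lebesgue. g x \<bullet> b = q b x" by blast+
  define N where "N = real DIM(real^'n)"
  have N: "N > 0" unfolding N_def by simp
  have wd: "weak_dderiv b w (q b)" if "b \<in> Basis" for b
    by (rule sobolev_UNIV_weak_dderiv[OF w(1) that Lw _ q]) simp
  have "\<forall>\<^sub>F t in nhds 0. (LBINT x. (avg t w x - w x)\<^sup>2) < \<epsilon>"
    unfolding eventually_nhds_metric using avg_tendsto[OF Lw \<epsilon>] by simp
  moreover have "\<forall>\<^sub>F t in nhds 0. (LBINT x. (avg t (q b) x - q b x)\<^sup>2) < \<epsilon> / N" for b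
    unfolding eventually_nhds_metric using avg_tendsto[OF q(1), of "\<epsilon> / N" b] \<epsilon> N by simp
  then have "\<forall>\<^sub>F t in nhds 0. \<forall>b\<in>Basis. (LBINT x. (avg t (q b) x - q b x)\<^sup>2) < \<epsilon> / N"
    by (intro eventually_ball_finite) auto
  ultimately have "\<forall>\<^sub>F t in nhds 0. (\<exists>\<gamma>. sobolev UNIV (avg t w) \<gamma> \<and>
    (LINT x|lebesgue. (avg t w x - w x)\<^sup>2) < \<epsilon> \<and> (LINT x|lebesgue. (norm (\<gamma> x - g x))\<^sup>2) < \<epsilon>)"
  proof eventually_elim
    case (elim t)
    have L1: "L2 (\<lambda>x. avg t w x - w x)" by (rule L2_diff[OF avg_L2[OF Lw] Lw])
    have Lb: "L2 (\<lambda>x. avg t (q b) x - q b x)" for b by (rule L2_diff[OF avg_L2[OF q(1)] q(1)])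
    have mb: "(\<lambda>x. (avg t (q b) x - q b x)\<^sup>2) \<in> borel_measurable borel" for b
      by (rule borel_measurable_power[OF conjunct1[OF Lb]])
    define \<gamma> where "\<gamma> x = (\<Sum>b\<in>Basis. avg t (q b) x *\<^sub>R b)" for x
    have sob: "sobolev UNIV (avg t w) \<gamma>"
      unfolding \<gamma>_def by (rule sobolev_of_weak_dderivs[OF avg_weak_dderiv[OF av wd]])
    have "AE x in lebesgue. \<forall>b\<in>Basis. g x \<bullet> b = q b x"
      using q(2) by (intro AE_finite_allI) auto
    then have "AE x in lebesgue. (norm (\<gamma> x - g x))\<^sup>2 = (\<Sum>b\<in>Basis. (avg t (q b) x - q b x)\<^sup>2)"
    proof (rule eventually_mono)
      fix x assume *: "\<forall>b\<in>Basis. g x \<bullet> b = q b x"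
      have "(norm (\<gamma> x - g x))\<^sup>2 = (\<Sum>b\<in>Basis. ((\<gamma> x - g x) \<bullet> b)\<^sup>2)"
        unfolding power2_norm_eq_inner by (subst euclidean_inner) (simp add: power2_eq_square)
      also have "\<dots> = (\<Sum>b\<in>Basis. (avg t (q b) x - q b x)\<^sup>2)"
      proof (rule sum.cong)
        fix b :: "real^'n" assume b: "b \<in> Basis"
        have "\<gamma> x \<bullet> b = avg t (q b) x"
          using b unfolding \<gamma>_def by (simp add: inner_sum_left inner_Basis if_distrib[of
              "\<lambda>a. _ * a"] cong: if_cong)
        then show "((\<gamma> x - g x) \<bullet> b)\<^sup>2 = (avg t (q b) x - q b x)\<^sup>2" using * b by (simp add: inner_diff_left)
      qed simp
      finally show "(norm (\<gamma> x - g x))\<^sup>2 = (\<Sum>b\<in>Basis. (avg t (q b) x - q b x)\<^sup>2)" .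
    qed
    then have "(LINT x|lebesgue. (norm (\<gamma> x - g x))\<^sup>2) = (LBINT x. (\<Sum>b\<in>Basis. (avg t (q b) x - q b x)\<^sup>2))"
      by (rule lebesgue_integral_eq_lborel[rotated]) (use mb in simp)
    also have "\<dots> = (\<Sum>b\<in>Basis. (LBINT x. (avg t (q b) x - q b x)\<^sup>2))"
      using Lb by (intro Bochner_Integration.integral_sum) auto
    also have "\<dots> < (\<Sum>b\<in>(Basis :: (real^'n) set). \<epsilon> / N)"
      using elim by (intro sum_strict_mono) auto
    also have "\<dots> = \<epsilon>" using N unfolding N_def by simp
    finally have "(LINT x|lebesgue. (norm (\<gamma> x - g x))\<^sup>2) < \<epsilon>" .
    moreover have "(LINT x|lebesgue. (avg t w x - w x)\<^sup>2) = (LBINT x. (avg t w x - w x)\<^sup>2)"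
      using L1 by (intro integral_completion) auto
    ultimately show ?case using sob elim by auto
  qed
  then show ?thesis unfolding eventually_nhds_metric by simp
qed

section \<open>Gaussian smoothing\<close>

definition gauss_grad :: "real \<Rightarrow> real^2 \<Rightarrow> real^2" where
  "gauss_grad \<sigma> z = - (gauss \<sigma> z / \<sigma>\<^sup>2) *\<^sub>R z"

lemma GDERIV_gauss:
  assumes "\<sigma> > 0"
  shows "GDERIV (gauss \<sigma>) z :> gauss_grad \<sigma> z"
proof -
  have "((\<lambda>z::real^2. - (z \<bullet> z) / (2 * \<sigma>\<^sup>2)) has_derivative (\<lambda>h. - (2 * (z \<bullet> h)) / (2 * \<sigma>\<^sup>2))) (at z)"
    using assms by (auto intro!: derivative_eq_intros simp: inner_commute divide_simps)
  from has_derivative_exp[OF this]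
  have "((\<lambda>z. 1 / (2 * pi * \<sigma>\<^sup>2) * exp (- (z \<bullet> z) / (2 * \<sigma>\<^sup>2))) has_derivative
      (\<lambda>h. 1 / (2 * pi * \<sigma>\<^sup>2) * (exp (- (z \<bullet> z) / (2 * \<sigma>\<^sup>2)) * (- (2 * (z \<bullet> h)) / (2 * \<sigma>\<^sup>2))))) (at z)"
    by (intro has_derivative_mult_right) (simp add: mult.commute)
  moreover have "(\<lambda>z. 1 / (2 * pi * \<sigma>\<^sup>2) * exp (- (z \<bullet> z) / (2 * \<sigma>\<^sup>2))) = gauss \<sigma>"
    by (simp add: gauss_def[abs_def] power2_norm_eq_inner)
  moreover have "(\<lambda>h. 1 / (2 * pi * \<sigma>\<^sup>2) * (exp (- (z \<bullet> z) / (2 * \<sigma>\<^sup>2)) * (- (2 * (z \<bullet> h)) / (2 * \<sigma>\<^sup>2)))) =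
      (\<lambda>h. h \<bullet> gauss_grad \<sigma> z)"
    by (auto simp: gauss_grad_def gauss_def power2_norm_eq_inner inner_commute)
  ultimately show ?thesis unfolding gderiv_def by simp
qed

text \<open>All bounds on derivatives of the Gaussian come from \<open>1 + 2 s \<le> 2 exp s\<close> with
  \<open>s = (norm z)\<^sup>2 / (2 \<sigma>\<^sup>2)\<close>.\<close>

lemma gauss_weighted_bound:
  assumes "\<sigma> > 0"
  shows "gauss \<sigma> z * (1 + (norm z)\<^sup>2 / \<sigma>\<^sup>2) \<le> 1 / (pi * \<sigma>\<^sup>2)"
proof -
  define s where "s = (norm z)\<^sup>2 / (2 * \<sigma>\<^sup>2)"
  have s: "s \<ge> 0" "(norm z)\<^sup>2 / \<sigma>\<^sup>2 = 2 * s" unfolding s_def by auto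
  have "1 + 2 * s \<le> 2 * exp s" using exp_ge_add_one_self[of s] s by linarith
  then have "exp (- s) * (1 + 2 * s) \<le> 2" by (simp add: exp_minus field_simps)
  then have "1 / (2 * pi * \<sigma>\<^sup>2) * (exp (- s) * (1 + 2 * s)) \<le> 1 / (2 * pi * \<sigma>\<^sup>2) * 2"
    by (intro mult_left_mono) auto
  moreover have "gauss \<sigma> z = 1 / (2 * pi * \<sigma>\<^sup>2) * exp (- s)" by (simp add: gauss_def s_def)
  ultimately show ?thesis using s(2) by (simp add: mult.assoc)
qed

lemma gauss_nonneg: "gauss \<sigma> z \<ge> 0" by (simp add: gauss_def)

lemma gauss_grad_bounded:
  assumes "\<sigma> > 0"
  shows "norm (gauss_grad \<sigma> z) \<le> 1 / (pi * \<sigma> ^ 3)"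
proof -
  have "a \<le> 1 + a\<^sup>2" if "0 \<le> a" for a :: real
    using sum_squares_bound[of 1 a] that by (simp only: power_one mult_1_right)
  from this[of "norm z / \<sigma>"] have "norm z / \<sigma> \<le> 1 + (norm z / \<sigma>)\<^sup>2" using assms by simp
  then have "norm z / \<sigma> \<le> 1 + (norm z)\<^sup>2 / \<sigma>\<^sup>2" by (simp add: power_divide)
  then have "gauss \<sigma> z * (norm z / \<sigma>) \<le> gauss \<sigma> z * (1 + (norm z)\<^sup>2 / \<sigma>\<^sup>2)"
    by (intro mult_left_mono gauss_nonneg)
  also have "\<dots> \<le> 1 / (pi * \<sigma>\<^sup>2)" by (rule gauss_weighted_bound[OF assms])
  finally have "(gauss \<sigma> z * (norm z / \<sigma>)) / \<sigma> \<le> (1 / (pi * \<sigma>\<^sup>2)) / \<sigma>"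
    using assms by (intro divide_right_mono) auto
  moreover have "norm (gauss_grad \<sigma> z) = (gauss \<sigma> z * (norm z / \<sigma>)) / \<sigma>"
    by (simp add: gauss_grad_def gauss_nonneg power2_eq_square)
  ultimately show ?thesis by (simp add: power2_eq_square power3_eq_cube mult.assoc)
qed

lemma gauss_grad_lipschitz:
  assumes "\<sigma> > 0"
  shows "norm (gauss_grad \<sigma> x - gauss_grad \<sigma> y) \<le> 1 / (pi * \<sigma> ^ 4) * norm (x - y)"
proof (rule differentiable_bound[of UNIV "gauss_grad \<sigma>" "\<lambda>z h. - ((h \<bullet> gauss_grad \<sigma> z) / \<sigma>\<^sup>2) *\<^sub>R z -
    (gauss \<sigma> z / \<sigma>\<^sup>2) *\<^sub>R h"])
  fix z :: "real^2"
  have "((\<lambda>z. - (gauss \<sigma> z / \<sigma>\<^sup>2)) has_derivative (\<lambda>h. - ((h \<bullet> gauss_grad \<sigma> z) / \<sigma>\<^sup>2))) (at z)"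
    using GDERIV_gauss[OF assms, of z] unfolding gderiv_def divide_inverse
    by (intro has_derivative_minus has_derivative_mult_left)
  from has_derivative_scaleR[OF this has_derivative_ident]
  show "(gauss_grad \<sigma> has_derivative (\<lambda>h. - ((h \<bullet> gauss_grad \<sigma> z) / \<sigma>\<^sup>2) *\<^sub>R z - (gauss \<sigma> z / \<sigma>\<^sup>2) *\<^sub>R h))
      (at z within UNIV)"
    by (simp add: gauss_grad_def[abs_def] algebra_simps)
  show "onorm (\<lambda>h. - ((h \<bullet> gauss_grad \<sigma> z) / \<sigma>\<^sup>2) *\<^sub>R z - (gauss \<sigma> z / \<sigma>\<^sup>2) *\<^sub>R h) \<le> 1 / (pi * \<sigma> ^ 4)"
  proof (rule onorm_bound)
    fix h :: "real^2"
    have "norm (- ((h \<bullet> gauss_grad \<sigma> z) / \<sigma>\<^sup>2) *\<^sub>R z - (gauss \<sigma> z / \<sigma>\<^sup>2) *\<^sub>R h) \<le>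
        \<bar>h \<bullet> gauss_grad \<sigma> z\<bar> / \<sigma>\<^sup>2 * norm z + gauss \<sigma> z / \<sigma>\<^sup>2 * norm h"
      using norm_triangle_ineq4[of "- ((h \<bullet> gauss_grad \<sigma> z) / \<sigma>\<^sup>2) *\<^sub>R z" "(gauss \<sigma> z / \<sigma>\<^sup>2) *\<^sub>R h"]
      by (simp add: gauss_nonneg abs_divide)
    also have "\<bar>h \<bullet> gauss_grad \<sigma> z\<bar> / \<sigma>\<^sup>2 * norm z \<le> norm h * (gauss \<sigma> z / \<sigma>\<^sup>2 * norm z) / \<sigma>\<^sup>2 * norm z"
    proof -
      have "norm (gauss_grad \<sigma> z) = gauss \<sigma> z / \<sigma>\<^sup>2 * norm z" by (simp add: gauss_grad_def gauss_nonneg)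
      then have "\<bar>h \<bullet> gauss_grad \<sigma> z\<bar> \<le> norm h * (gauss \<sigma> z / \<sigma>\<^sup>2 * norm z)"
        using Cauchy_Schwarz_ineq2[of h "gauss_grad \<sigma> z"] by simp
      then show ?thesis by (intro mult_right_mono divide_right_mono) auto
    qed
    also have "norm h * (gauss \<sigma> z / \<sigma>\<^sup>2 * norm z) / \<sigma>\<^sup>2 * norm z + gauss \<sigma> z / \<sigma>\<^sup>2 * norm h =
        (gauss \<sigma> z * (1 + (norm z)\<^sup>2 / \<sigma>\<^sup>2)) * (norm h / \<sigma>\<^sup>2)"
      using assms by (simp add: field_simps power2_eq_square)
    also have "\<dots> \<le> 1 / (pi * \<sigma>\<^sup>2) * (norm h / \<sigma>\<^sup>2)"
      by (intro mult_right_mono gauss_weighted_bound assms) auto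
    also have "\<dots> = 1 / (pi * \<sigma> ^ 4) * norm h" by (simp add: power2_eq_square power4_eq_xxxx)
    finally show "norm (- ((h \<bullet> gauss_grad \<sigma> z) / \<sigma>\<^sup>2) *\<^sub>R z - (gauss \<sigma> z / \<sigma>\<^sup>2) *\<^sub>R h) \<le> 1 /
        (pi * \<sigma> ^ 4) * norm h"
      by simp
  qed (use assms in simp)
qed auto

text \<open>Taylor's formula with the Lipschitz constant of the gradient.  That the bound does not
  depend on \<open>z\<close> allows differentiation under the integral in \<open>smoothed_gradient\<close>.\<close>

lemma gauss_remainder:
  assumes "\<sigma> > 0"
  shows "\<bar>gauss \<sigma> (z + h) - gauss \<sigma> z - gauss_grad \<sigma> z \<bullet> h\<bar> \<le> 1 / (pi * \<sigma> ^ 4) * (norm h)\<^sup>2"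
proof -
  define F where "F y = gauss \<sigma> y - gauss_grad \<sigma> z \<bullet> y" for y
  have "norm (F (z + h) - F z) \<le> (1 / (pi * \<sigma> ^ 4) * norm h) * norm ((z + h) - z)"
  proof (rule differentiable_bound[of "cball z (norm h)" F "\<lambda>y k. k \<bullet> (gauss_grad \<sigma> y - gauss_grad \<sigma> z)"])
    fix y assume y: "y \<in> cball z (norm h)"
    show "(F has_derivative (\<lambda>k. k \<bullet> (gauss_grad \<sigma> y - gauss_grad \<sigma> z))) (at y within cball z (norm h))"
      unfolding F_def using GDERIV_gauss[OF assms, of y] unfolding gderiv_def
      by (auto intro!: derivative_eq_intros has_derivative_at_withinI[where s="cball z
          (norm h)"] simp: inner_diff_right inner_commute)
    show "onorm (\<lambda>k. k \<bullet> (gauss_grad \<sigma> y - gauss_grad \<sigma> z)) \<le> 1 / (pi * \<sigma> ^ 4) * norm h"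
    proof (rule onorm_bound)
      fix k :: "real^2"
      have "norm (gauss_grad \<sigma> y - gauss_grad \<sigma> z) \<le> 1 / (pi * \<sigma> ^ 4) * norm h"
        using gauss_grad_lipschitz[OF assms, of y z] y assms
        by (elim order_trans) (auto intro!: divide_right_mono simp: dist_norm norm_minus_commute)
      then have "norm k * norm (gauss_grad \<sigma> y - gauss_grad \<sigma> z) \<le> norm k * (1 / (pi * \<sigma> ^ 4) * norm h)"
        by (intro mult_left_mono) auto
      then show "norm (k \<bullet> (gauss_grad \<sigma> y - gauss_grad \<sigma> z)) \<le> 1 / (pi * \<sigma> ^ 4) * norm h * norm k"
        using Cauchy_Schwarz_ineq2[of k "gauss_grad \<sigma> y - gauss_grad \<sigma> z"] by (simp add: mult.commute)
    qed (use assms in simp)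
  qed (auto simp: dist_norm)
  then show ?thesis unfolding F_def by (simp add: inner_add_right power2_eq_square mult.assoc)
qed

lemma gauss_integrable:
  fixes W :: "real^2 \<Rightarrow> real"
  assumes \<sigma>: "\<sigma> > 0" and W: "integrable lebesgue W"
  shows "integrable lebesgue (\<lambda>z. gauss \<sigma> (x - z) * W z)"
    "integrable lebesgue (\<lambda>z. W z *\<^sub>R gauss_grad \<sigma> (x - z))"
proof -
  have cg: "continuous_on UNIV (gauss \<sigma>)"
    using GDERIV_gauss[OF \<sigma>] GDERIV_imp_isCont continuous_at_imp_continuous_on by metis
  then have cgg: "continuous_on UNIV (gauss_grad \<sigma>)"
    unfolding gauss_grad_def[abs_def] using \<sigma> by (intro continuous_intros) auto
  have m: "(\<lambda>z. gauss \<sigma> (x - z)) \<in> borel_measurable lebesgue" "(\<lambda>z. gauss_grad \<sigma>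
      (x - z)) \<in> borel_measurable lebesgue"
    by (intro measurable_completion; simp; rule borel_measurable_continuous_onI,
        rule continuous_on_compose2[OF cg] continuous_on_compose2[OF cgg]; intro continuous_intros subset_UNIV)+
  have "gauss \<sigma> z \<le> 1 / (pi * \<sigma>\<^sup>2)" for z
  proof -
    have "gauss \<sigma> z * 1 \<le> gauss \<sigma> z * (1 + (norm z)\<^sup>2 / \<sigma>\<^sup>2)" by (intro mult_left_mono gauss_nonneg) auto
    with gauss_weighted_bound[OF \<sigma>, of z] show ?thesis by simp
  qed
  note gb = this
  show "integrable lebesgue (\<lambda>z. gauss \<sigma> (x - z) * W z)"
  proof (rule Bochner_Integration.integrable_bound[of lebesgue "\<lambda>z. 1 / (pi * \<sigma>\<^sup>2) * W z"])
    show "AE z in lebesgue. norm (gauss \<sigma> (x - z) * W z) \<le> norm (1 / (pi * \<sigma>\<^sup>2) * W z)"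
      unfolding norm_mult using gb gauss_nonneg \<sigma> by (intro AE_I2 mult_right_mono) (auto intro: order_trans)
  qed (use W m in auto)
  show "integrable lebesgue (\<lambda>z. W z *\<^sub>R gauss_grad \<sigma> (x - z))"
  proof (rule Bochner_Integration.integrable_bound[of lebesgue "\<lambda>z. W z * (1 / (pi * \<sigma> ^ 3))"])
    show "AE z in lebesgue. norm (W z *\<^sub>R gauss_grad \<sigma> (x - z)) \<le> norm (W z * (1 / (pi * \<sigma> ^ 3)))"
      unfolding norm_scaleR real_norm_def abs_mult
      using gauss_grad_bounded[OF \<sigma>] \<sigma> by (intro AE_I2 mult_left_mono) auto
  qed (use W m in auto)
qed

lemma smoothed_gradient:
  fixes w :: "real^2 \<Rightarrow> real"
  assumes \<sigma>: "\<sigma> > 0" and w: "set_integrable lebesgue G w"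
  defines "W \<equiv> \<lambda>z. indicator G z * w z"
  shows "grad (smoothed \<sigma> G w) x = (LINT z|lebesgue. W z *\<^sub>R gauss_grad \<sigma> (x - z))"
proof (rule grad_eqI)
  have W: "integrable lebesgue W" using w unfolding W_def set_integrable_def by simp
  note gi = gauss_integrable[OF \<sigma> W]
  define L where "L = 1 / (pi * \<sigma> ^ 4)"
  define I where "I = (LINT z|lebesgue. \<bar>W z\<bar>)"
  have L0: "L \<ge> 0" using \<sigma> unfolding L_def by simp
  have I0: "I \<ge> 0" unfolding I_def by simp
  define Dx where "Dx = (LINT z|lebesgue. W z *\<^sub>R gauss_grad \<sigma> (x - z))"
  have S: "smoothed \<sigma> G w y = (LINT z|lebesgue. gauss \<sigma> (y - z) * W z)" for y
    unfolding smoothed_def set_lebesgue_integral_def W_def by (simp add: mult.left_commute)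
  have rem: "\<bar>smoothed \<sigma> G w y - smoothed \<sigma> G w x - (y - x) \<bullet> Dx\<bar> \<le> L * I * (norm (y - x))\<^sup>2" for y
  proof -
    define h where "h = y - x"
    have "(LINT z|lebesgue. W z * (gauss_grad \<sigma> (x - z) \<bullet> h)) = Dx \<bullet> h"
      unfolding Dx_def using integral_inner_left[OF gi(2)[of x], of h] by simp
    moreover have "integrable lebesgue (\<lambda>z. W z * (gauss_grad \<sigma> (x - z) \<bullet> h))"
      using integrable_inner_left[OF gi(2)[of x], of h] by simp
    ultimately have "smoothed \<sigma> G w y - smoothed \<sigma> G w x - h \<bullet> Dx =
      (LINT z|lebesgue. gauss \<sigma> (y - z) * W z - gauss \<sigma> (x - z) * W z - W z * (gauss_grad \<sigma> (x - z) \<bullet> h))"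
      unfolding S using gi(1)[of y] gi(1)[of x] by (simp add: inner_commute)
    also have "\<bar>\<dots>\<bar> \<le> (LINT z|lebesgue. (L * (norm h)\<^sup>2) * \<bar>W z\<bar>)"
    proof (rule order_trans[OF integral_abs_bound integral_mono_AE'])
      show "integrable lebesgue (\<lambda>z. (L * (norm h)\<^sup>2) * \<bar>W z\<bar>)" using W by simp
      show "AE z in lebesgue. \<bar>gauss \<sigma> (y - z) * W z - gauss \<sigma> (x - z) * W z - W z * (gauss_grad \<sigma>
          (x - z) \<bullet> h)\<bar> \<le> (L * (norm h)\<^sup>2) * \<bar>W z\<bar>"
      proof (rule AE_I2)
        fix z
        have "\<bar>gauss \<sigma> (y - z) - gauss \<sigma> (x - z) - gauss_grad \<sigma> (x - z) \<bullet> h\<bar> \<le> L * (norm h)\<^sup>2"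
          using gauss_remainder[OF \<sigma>, of "x - z" h] unfolding L_def h_def by (simp add: algebra_simps)
        then have "\<bar>gauss \<sigma> (y - z) - gauss \<sigma> (x - z) - gauss_grad \<sigma> (x - z) \<bullet> h\<bar> * \<bar>W z\<bar> \<le> (L *
            (norm h)\<^sup>2) * \<bar>W z\<bar>"
          by (rule mult_right_mono) simp
        moreover have "gauss \<sigma> (y - z) * W z - gauss \<sigma> (x - z) * W z - W z * (gauss_grad \<sigma> (x - z) \<bullet> h) =
            (gauss \<sigma> (y - z) - gauss \<sigma> (x - z) - gauss_grad \<sigma> (x - z) \<bullet> h) * W z"
          by (simp add: algebra_simps)
        ultimately show "\<bar>gauss \<sigma> (y - z) * W z - gauss \<sigma> (x - z) * W z - W z * (gauss_grad \<sigma> (x - z) \<bullet> h)\<bar>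
            \<le> (L * (norm h)\<^sup>2) * \<bar>W z\<bar>"
          by (simp only: abs_mult)
      qed
    qed (use L0 in auto)
    also have "\<dots> = L * I * (norm h)\<^sup>2" unfolding I_def by simp
    finally show ?thesis unfolding h_def .
  qed
  have "(smoothed \<sigma> G w has_derivative (\<lambda>h. h \<bullet> Dx)) (at x)"
    unfolding has_derivative_at2
  proof (intro conjI)
    show "bounded_linear (\<lambda>h. h \<bullet> Dx)" by (rule bounded_linear_inner_left)
    show "((\<lambda>y. (1 / norm (y - x)) *\<^sub>R (smoothed \<sigma> G w y - (smoothed \<sigma> G w x + (y - x) \<bullet> Dx))) \<longlongrightarrow> 0) (at x)"
    proof (rule Lim_null_comparison)
      show "\<forall>\<^sub>F y in at x. norm ((1 / norm (y - x)) *\<^sub>R (smoothed \<sigma> G w y - (smoothed \<sigma> G w x +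
          (y - x) \<bullet> Dx))) \<le> L * I * norm (y - x)"
      proof (intro always_eventually allI)
        fix y
        have "1 / norm (y - x) * \<bar>smoothed \<sigma> G w y - smoothed \<sigma> G w x - (y - x) \<bullet> Dx\<bar> \<le> 1 / norm (y - x) *
            (L * I * (norm (y - x))\<^sup>2)"
          by (intro mult_left_mono rem) auto
        then show "norm ((1 / norm (y - x)) *\<^sub>R (smoothed \<sigma> G w y - (smoothed \<sigma> G w x + (y - x) \<bullet> Dx)))
            \<le> L * I * norm (y - x)"
          by (cases "y = x") (simp_all add: abs_mult diff_diff_eq power2_eq_square)
      qed
      have "((\<lambda>y. L * I * norm (y - x)) \<longlongrightarrow> L * I * norm (x - x)) (at x)"
        by (intro tendsto_intros)
      then show "((\<lambda>y. L * I * norm (y - x)) \<longlongrightarrow> 0) (at x)" by simp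
    qed
  qed
  then show "GDERIV (smoothed \<sigma> G w) x :> (LINT z|lebesgue. W z *\<^sub>R gauss_grad \<sigma> (x - z))"
    unfolding gderiv_def Dx_def .
qed

lemma smoothed_gradient_bound:
  assumes \<sigma>: "\<sigma> > 0" and w: "set_integrable lebesgue G w"
  shows "norm (grad (smoothed \<sigma> G w) x) \<le> 1 / (pi * \<sigma> ^ 3) * (LINT z|lebesgue. \<bar>indicator G z * w z\<bar>)"
proof -
  define W where "W z = indicator G z * w z" for z
  have W: "integrable lebesgue W" using w unfolding W_def set_integrable_def by simp
  have "norm (grad (smoothed \<sigma> G w) x) \<le> (LINT z|lebesgue. norm (W z *\<^sub>R gauss_grad \<sigma> (x - z)))"
    unfolding smoothed_gradient[OF \<sigma> w] W_def[symmetric] by (rule integral_norm_bound)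
  also have "\<dots> \<le> (LINT z|lebesgue. \<bar>W z\<bar> * (1 / (pi * \<sigma> ^ 3)))"
  proof (intro integral_mono_AE' AE_I2)
    fix z
    show "norm (W z *\<^sub>R gauss_grad \<sigma> (x - z)) \<le> \<bar>W z\<bar> * (1 / (pi * \<sigma> ^ 3))"
      unfolding norm_scaleR real_norm_def by (intro mult_left_mono gauss_grad_bounded[OF \<sigma>]) simp
    show "0 \<le> \<bar>W z\<bar> * (1 / (pi * \<sigma> ^ 3))" using \<sigma> by simp
  qed (use W in simp)
  finally show ?thesis unfolding W_def by (simp add: mult.commute)
qed

lemma smoothed_gradient_continuous:
  assumes \<sigma>: "\<sigma> > 0" and w: "set_integrable lebesgue G w"
  shows "continuous_on UNIV (grad (smoothed \<sigma> G w))"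
proof -
  define W where "W z = indicator G z * w z" for z
  have W: "integrable lebesgue W" using w unfolding W_def set_integrable_def by simp
  note gi = gauss_integrable[OF \<sigma> W]
  define L where "L = 1 / (pi * \<sigma> ^ 4) * (LINT z|lebesgue. \<bar>W z\<bar>)"
  have "norm (grad (smoothed \<sigma> G w) x - grad (smoothed \<sigma> G w) y) \<le> L * norm (x - y)" for x y
  proof -
    have "grad (smoothed \<sigma> G w) x - grad (smoothed \<sigma> G w) y =
        (LINT z|lebesgue. W z *\<^sub>R gauss_grad \<sigma> (x - z) - W z *\<^sub>R gauss_grad \<sigma> (y - z))"
      unfolding smoothed_gradient[OF \<sigma> w] W_def[symmetric] using gi(2) by simp
    also have "norm \<dots> \<le> (LINT z|lebesgue. norm (W z *\<^sub>R gauss_grad \<sigma> (x - z) - W z *\<^sub>R gauss_grad \<sigma> (y - z)))"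
      by (rule integral_norm_bound)
    also have "\<dots> \<le> (LINT z|lebesgue. \<bar>W z\<bar> * (1 / (pi * \<sigma> ^ 4) * norm (x - y)))"
    proof (intro integral_mono_AE' AE_I2)
      show "integrable lebesgue (\<lambda>z. \<bar>W z\<bar> * (1 / (pi * \<sigma> ^ 4) * norm (x - y)))" using W by simp
      fix z
      have "norm (gauss_grad \<sigma> (x - z) - gauss_grad \<sigma> (y - z)) \<le> 1 / (pi * \<sigma> ^ 4) * norm (x - y)"
        using gauss_grad_lipschitz[OF \<sigma>, of "x - z" "y - z"] by simp
      then show "norm (W z *\<^sub>R gauss_grad \<sigma> (x - z) - W z *\<^sub>R gauss_grad \<sigma> (y - z)) \<le> \<bar>W z\<bar> * (1 /
          (pi * \<sigma> ^ 4) * norm (x - y))"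
        unfolding scaleR_diff_right[symmetric] norm_scaleR by (rule mult_left_mono) simp
    qed simp
    also have "\<dots> = L * norm (x - y)" unfolding L_def by simp
    finally show ?thesis .
  qed
  moreover have "L \<ge> 0" unfolding L_def using \<sigma> by simp
  ultimately have "L-lipschitz_on UNIV (grad (smoothed \<sigma> G w))"
    by (auto intro!: lipschitz_onI simp: dist_norm)
  then show ?thesis by (rule lipschitz_on_continuous_on)
qed

section \<open>A bounded truncation\<close>

text \<open>The arcus tangens has slope \<open>1\<close> at \<open>0\<close>, so the three pieces fit together to a bounded \<open>C\<^sup>1\<close> function
  with slopes in \<open>(0, 1]\<close>.\<close>

definition trunc :: "real \<Rightarrow> real" where
  "trunc s = (if s \<le> 0 then arctan s else if s \<le> 1 then s else 1 + arctan (s - 1))"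

definition trunc' :: "real \<Rightarrow> real" where
  "trunc' s = 1 / (1 + (min s 0)\<^sup>2 + (max (s - 1) 0)\<^sup>2)"

lemma trunc_eq: "0 \<le> s \<Longrightarrow> s \<le> 1 \<Longrightarrow> trunc s = s"
  by (auto simp: trunc_def)

lemma trunc_bounded: "\<bar>trunc s\<bar> \<le> 3"
  using arctan_lbound[of s] arctan_ubound[of s] arctan_lbound[of "s - 1"] arctan_ubound[of "s - 1"] pi_less_4
  by (auto simp: trunc_def)

lemma real_derivative_glue:
  fixes F H :: "real \<Rightarrow> real"
  assumes "(F has_real_derivative d) (at a)" "(H has_real_derivative d) (at a)" "F a = H a"
  shows "((\<lambda>s. if s \<le> a then F s else H s) has_real_derivative d) (at a)"
proof -
  have "((\<lambda>h. (F (a + h) - F a) / h) \<longlongrightarrow> d) (at_left 0)" "((\<lambda>h. (H (a + h) - H a) / h) \<longlongrightarrow> d) (at_right 0)"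
    using assms(1,2) by (auto simp: DERIV_def filterlim_at_split)
  then have "((\<lambda>h. ((if a + h \<le> a then F (a + h) else H (a + h)) - F a) / h) \<longlongrightarrow> d) (at_left 0)"
    "((\<lambda>h. ((if a + h \<le> a then F (a + h) else H (a + h)) - F a) / h) \<longlongrightarrow> d) (at_right 0)"
    using assms(3)
    by (auto elim!: Lim_transform_eventually intro!: eventually_at_leftI[of "-1"] eventually_at_rightI[of _ 1])
  then show ?thesis unfolding DERIV_def by (auto simp: filterlim_at_split)
qed

lemma trunc_deriv: "(trunc has_real_derivative trunc' s) (at s)"
proof -
  have A: "(arctan has_real_derivative 1 / (1 + s\<^sup>2)) (at s)" for s
    using DERIV_arctan[of s] by (simp add: inverse_eq_divide)
  have B: "((\<lambda>s. 1 + arctan (s - 1)) has_real_derivative 1 / (1 + (s - 1)\<^sup>2)) (at s)" for s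
    by (auto intro!: derivative_eq_intros simp: inverse_eq_divide)
  consider "s < 0" | "s = 0" | "0 < s" "s < 1" | "s = 1" | "s > 1" by linarith
  then show ?thesis
  proof cases
    case 1
    have "(arctan has_real_derivative trunc' s) (at s)" using A[of s] 1 by (simp add: trunc'_def)
    then show ?thesis
      by (rule has_field_derivative_transform_within_open[of _ _ _ "{..<0}"]) (use 1 in \<open>auto simp: trunc_def\<close>)
  next
    case 2
    have "((\<lambda>s. if s \<le> 0 then arctan s else s) has_real_derivative 1) (at 0)"
      using A[of 0] by (intro real_derivative_glue) auto
    then have "(trunc has_real_derivative 1) (at 0)"
      by (rule has_field_derivative_transform_within_open[of _ _ _ "{..<1}"]) (auto simp: trunc_def)
    then show ?thesis using 2 by (simp add: trunc'_def)
  next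
    case 3
    have "((\<lambda>s. s) has_real_derivative trunc' s) (at s)" using 3 by (simp add: trunc'_def)
    then show ?thesis
      by (rule has_field_derivative_transform_within_open[of _ _ _ "{0<..<1}"])
          (use 3 in \<open>auto simp: trunc_def\<close>)
  next
    case 4
    have "((\<lambda>s. if s \<le> 1 then s else 1 + arctan (s - 1)) has_real_derivative 1) (at 1)"
      using B[of 1] by (intro real_derivative_glue) auto
    then have "(trunc has_real_derivative 1) (at 1)"
      by (rule has_field_derivative_transform_within_open[of _ _ _ "{0<..}"]) (auto simp: trunc_def)
    then show ?thesis using 4 by (simp add: trunc'_def)
  next
    case 5
    have "((\<lambda>s. 1 + arctan (s - 1)) has_real_derivative trunc' s) (at s)" using B[of s] 5 by
        (simp add: trunc'_def)
    then show ?thesis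
      by (rule has_field_derivative_transform_within_open[of _ _ _ "{1<..}"]) (use 5 in \<open>auto simp: trunc_def\<close>)
  qed
qed

interpretation trunc: truncation trunc trunc'
proof
  have pos: "1 + (min s 0)\<^sup>2 + (max (s - 1) 0)\<^sup>2 \<ge> 1" for s :: real by simp
  show "\<bar>trunc' s\<bar> \<le> 1" for s
    unfolding trunc'_def using pos[of s] by (auto simp: abs_divide divide_le_eq_1)
  have "1 + (min s 0)\<^sup>2 + (max (s - 1) 0)\<^sup>2 \<noteq> 0" for s :: real using pos[of s] by linarith
  then show "continuous_on UNIV trunc'"
    unfolding trunc'_def[abs_def] by (intro continuous_intros) auto
qed (auto simp: trunc_deriv trunc_def)

section \<open>Convergence in \<open>W\<^sup>1\<^sup>,\<^sup>2\<close>\<close>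

definition W12_sq :: "(real^'n) set \<Rightarrow> (real^'n \<Rightarrow> real) \<Rightarrow> (real^'n \<Rightarrow> real^'n) \<Rightarrow> real" where
  "W12_sq U u g = (LINT x|lebesgue. (indicator U x * u x)\<^sup>2) + (LINT x|lebesgue. (norm
      (indicator U x *\<^sub>R g x))\<^sup>2)"

lemma W12_sq_nonneg: "W12_sq U u g \<ge> 0"
  unfolding W12_sq_def by (intro add_nonneg_nonneg integral_nonneg) auto

lemma W1p_norm_2_eq:
  assumes "open U" "sobolev U u g"
  shows "W1p_norm 2 U u = sqrt (W12_sq U u g)"
proof -
  have w: "sobolev U u (wgrad U u)"
    using assms by (intro sobolev_wgrad) (auto simp: W1p_2_iff)
  have "(LINT x:U|lebesgue. \<bar>u x\<bar> ^ 2) = (LINT x|lebesgue. (indicator U x * u x)\<^sup>2)"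
    unfolding set_lebesgue_integral_def
    by (rule Bochner_Integration.integral_cong) (auto simp: indicator_def)
  moreover have "(LINT x:U|lebesgue. norm (wgrad U u x) ^ 2) = (LINT x|lebesgue. (norm
      (indicator U x *\<^sub>R g x))\<^sup>2)"
  proof -
    have "(LINT x:U|lebesgue. norm (wgrad U u x) ^ 2) = (LINT x|lebesgue. (norm
        (indicator U x *\<^sub>R wgrad U u x))\<^sup>2)"
      unfolding set_lebesgue_integral_def
      by (rule Bochner_Integration.integral_cong) (auto simp: indicator_def)
    also have "\<dots> = (LINT x|lebesgue. (norm (indicator U x *\<^sub>R g x))\<^sup>2)"
    proof (rule integral_cong_AE)
      show "AE x in lebesgue. (norm (indicator U x *\<^sub>R wgrad U u x))\<^sup>2 = (norm (indicator U x *\<^sub>R g x))\<^sup>2"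
        using wgrad_eq[OF assms] by (rule eventually_mono) (auto simp: indicator_def)
    qed (use square_integrableD(2)[OF sobolevD(2)[OF w]] square_integrableD(2)[OF sobolevD(2)[OF assms(2)]]
        in auto)
    finally show ?thesis .
  qed
  ultimately show ?thesis unfolding W1p_norm_def W12_sq_def by (simp add: sqrt_def)
qed

lemma W12_sq_mono:
  assumes "sobolev U u g"
    and "(\<lambda>x. indicator V x * v x) \<in> borel_measurable lebesgue"
        "(\<lambda>x. indicator V x *\<^sub>R h x) \<in> borel_measurable lebesgue"
    and "\<And>x. (indicator V x * v x)\<^sup>2 \<le> (indicator U x * u x)\<^sup>2"
    and "\<And>x. (norm (indicator V x *\<^sub>R h x))\<^sup>2 \<le> (norm (indicator U x *\<^sub>R g x))\<^sup>2"
  shows "W12_sq V v h \<le> W12_sq U u g"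
  unfolding W12_sq_def
proof (intro add_mono integral_mono_AE' AE_I2 assms)
  show "integrable lebesgue (\<lambda>x. (indicator U x * u x)\<^sup>2)" "integrable lebesgue (\<lambda>x. (norm
      (indicator U x *\<^sub>R g x))\<^sup>2)"
    using square_integrableD(2)[OF sobolevD(1)[OF assms(1)]] square_integrableD(2)[OF sobolevD(2)[OF
        assms(1)]] by simp_all
qed auto

lemma W12_sq_restrict:
  assumes "sobolev V u g" "U \<subseteq> V" "open U"
  shows "W12_sq U u g \<le> W12_sq V u g"
proof (rule W12_sq_mono[OF assms(1)])
  note s = sobolev_restrict[OF assms]
  show "(\<lambda>x. indicator U x * u x) \<in> borel_measurable lebesgue"
      "(\<lambda>x. indicator U x *\<^sub>R g x) \<in> borel_measurable lebesgue"
    using square_integrableD(1)[OF sobolevD(1)[OF s]] square_integrableD(1)[OF sobolevD(2)[OF s]] .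
qed (use assms(2) in \<open>auto simp: indicator_def\<close>)

lemma W12_sq_add:
  assumes "sobolev U u g" "sobolev U v h"
  shows "W12_sq U (\<lambda>x. u x + v x) (\<lambda>x. g x + h x) \<le> 2 * W12_sq U u g + 2 * W12_sq U v h"
proof -
  note D = sobolevD[OF assms(1)] and E = sobolevD[OF assms(2)]
  have i: "integrable lebesgue (\<lambda>x. (indicator U x * u x)\<^sup>2)" "integrable lebesgue (\<lambda>x.
      (indicator U x * v x)\<^sup>2)"
    "integrable lebesgue (\<lambda>x. (norm (indicator U x *\<^sub>R g x))\<^sup>2)" "integrable lebesgue (\<lambda>x. (norm
        (indicator U x *\<^sub>R h x))\<^sup>2)"
    using square_integrableD(2)[OF D(1)] square_integrableD(2)[OF E(1)] square_integrableD(2)[OF D(2)]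
        square_integrableD(2)[OF E(2)]
    by simp_all
  have "(LINT x|lebesgue. (indicator U x * (u x + v x))\<^sup>2) \<le> (LINT x|lebesgue. 2 * (indicator U x * u x)\<^sup>2
      + 2 * (indicator U x * v x)\<^sup>2)"
  proof (intro integral_mono_AE' AE_I2)
    fix x show "(indicator U x * (u x + v x))\<^sup>2 \<le> 2 * (indicator U x * u x)\<^sup>2 + 2 * (indicator U x * v x)\<^sup>2"
      using norm_add_sq_le[of "indicator U x * u x" "indicator U x * v x"] by (simp add: distrib_left)
  qed (use i in auto)
  moreover have "(LINT x|lebesgue. (norm (indicator U x *\<^sub>R (g x + h x)))\<^sup>2) \<le>
      (LINT x|lebesgue. 2 * (norm (indicator U x *\<^sub>R g x))\<^sup>2 + 2 * (norm (indicator U x *\<^sub>R h x))\<^sup>2)"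
  proof (intro integral_mono_AE' AE_I2)
    fix x show "(norm (indicator U x *\<^sub>R (g x + h x)))\<^sup>2 \<le> 2 * (norm (indicator U x *\<^sub>R g x))\<^sup>2 + 2 * (norm
        (indicator U x *\<^sub>R h x))\<^sup>2"
      using norm_add_sq_le[of "indicator U x *\<^sub>R g x" "indicator U x *\<^sub>R h x"] by (simp add: scaleR_add_right)
  qed (use i in \<open>simp_all del: norm_scaleR\<close>)
  ultimately show ?thesis unfolding W12_sq_def using i by (simp del: norm_scaleR)
qed

text \<open>The point is that one constant serves all \<open>u\<close>: multiplication by \<open>p\<close> preserves convergence.\<close>

lemma W12_sq_mult_test_function:
  fixes p :: "real^'n \<Rightarrow> real"
  assumes "test_function UNIV p" "open U"
  shows "\<exists>C\<ge>0. \<forall>u g. sobolev U u g \<longrightarrow> W12_sq U (\<lambda>x. p x * u x) (\<lambda>x. p x *\<^sub>R g x + u x *\<^sub>R grad p x)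
      \<le> C * W12_sq U u g"
proof -
  obtain B where B: "B \<ge> 0" "\<And>x. \<bar>p x\<bar> \<le> B" "\<And>x. norm (grad p x) \<le> B"
      using test_function_bounded[OF assms(1)] by blast
  have "W12_sq U (\<lambda>x. p x * u x) (\<lambda>x. p x *\<^sub>R g x + u x *\<^sub>R grad p x) \<le> (3 * B\<^sup>2) * W12_sq U u g"
    if s: "sobolev U u g" for u g
  proof -
    have i: "integrable lebesgue (\<lambda>x. (indicator U x * u x)\<^sup>2)" "integrable lebesgue (\<lambda>x. (norm
        (indicator U x *\<^sub>R g x))\<^sup>2)"
      using square_integrableD(2)[OF sobolevD(1)[OF s]] square_integrableD(2)[OF sobolevD(2)[OF s]] by simp_all
    have "(LINT x|lebesgue. (indicator U x * (p x * u x))\<^sup>2) \<le> (LINT x|lebesgue. B\<^sup>2 * (indicator U x * u x)\<^sup>2)"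
    proof (intro integral_mono_AE' AE_I2)
      fix x
      have "(p x)\<^sup>2 \<le> B\<^sup>2" using B(1) B(2)[of x] by (simp add: abs_le_square_iff[symmetric])
      then have "(p x)\<^sup>2 * (indicator U x * u x)\<^sup>2 \<le> B\<^sup>2 * (indicator U x * u x)\<^sup>2" by
          (rule mult_right_mono) simp
      then show "(indicator U x * (p x * u x))\<^sup>2 \<le> B\<^sup>2 * (indicator U x * u x)\<^sup>2"
        by (simp add: power_mult_distrib mult.left_commute)
    qed (use i in auto)
    moreover have "(LINT x|lebesgue. (norm (indicator U x *\<^sub>R (p x *\<^sub>R g x + u x *\<^sub>R grad p x)))\<^sup>2) \<le>
        (LINT x|lebesgue. 2 * B\<^sup>2 * (norm (indicator U x *\<^sub>R g x))\<^sup>2 + 2 * B\<^sup>2 * (indicator U x * u x)\<^sup>2)"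
    proof (intro integral_mono_AE' AE_I2)
      fix x
      have "norm (p x *\<^sub>R (indicator U x *\<^sub>R g x)) \<le> B * norm (indicator U x *\<^sub>R g x)"
        unfolding norm_scaleR[of "p x"] real_norm_def by (intro mult_right_mono B) simp
      then have 1: "(norm (p x *\<^sub>R (indicator U x *\<^sub>R g x)))\<^sup>2 \<le> B\<^sup>2 * (norm (indicator U x *\<^sub>R g x))\<^sup>2"
        unfolding power_mult_distrib[symmetric] by (intro power_mono) auto
      have "norm ((indicator U x * u x) *\<^sub>R grad p x) \<le> B * \<bar>indicator U x * u x\<bar>"
        unfolding norm_scaleR[of "indicator U x * u x"] real_norm_def by (subst mult.commute)
            (intro mult_right_mono B; simp)
      then have "(norm ((indicator U x * u x) *\<^sub>R grad p x))\<^sup>2 \<le> (B * \<bar>indicator U x * u x\<bar>)\<^sup>2"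
        by (rule power_mono) simp
      then have 2: "(norm ((indicator U x * u x) *\<^sub>R grad p x))\<^sup>2 \<le> B\<^sup>2 * (indicator U x * u x)\<^sup>2"
        by (simp only: power_mult_distrib[of B] power2_abs)
      have "indicator U x *\<^sub>R (p x *\<^sub>R g x + u x *\<^sub>R grad p x) = p x *\<^sub>R (indicator U x *\<^sub>R g x) +
          (indicator U x * u x) *\<^sub>R grad p x"
        by (simp add: scaleR_add_right mult.commute)
      then show "(norm (indicator U x *\<^sub>R (p x *\<^sub>R g x + u x *\<^sub>R grad p x)))\<^sup>2 \<le>
          2 * B\<^sup>2 * (norm (indicator U x *\<^sub>R g x))\<^sup>2 + 2 * B\<^sup>2 * (indicator U x * u x)\<^sup>2"
        using norm_add_sq_le[of "p x *\<^sub>R (indicator U x *\<^sub>R g x)" "(indicator U x * u x) *\<^sub>R grad p x"] 1 2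
        by (simp only:)
    qed (use i in \<open>simp_all del: norm_scaleR\<close>)
    ultimately have "W12_sq U (\<lambda>x. p x * u x) (\<lambda>x. p x *\<^sub>R g x + u x *\<^sub>R grad p x) \<le>
       3 * B\<^sup>2 * (LINT x|lebesgue. (indicator U x * u x)\<^sup>2) + 2 * B\<^sup>2 * (LINT x|lebesgue. (norm
           (indicator U x *\<^sub>R g x))\<^sup>2)"
      unfolding W12_sq_def using i by (simp del: norm_scaleR)
    also have "\<dots> \<le> 3 * B\<^sup>2 * W12_sq U u g"
    proof -
      have "0 \<le> B\<^sup>2 * (LINT x|lebesgue. (norm (indicator U x *\<^sub>R g x))\<^sup>2)" by
          (intro mult_nonneg_nonneg integral_nonneg) auto
      then show ?thesis unfolding W12_sq_def by (simp add: algebra_simps)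
    qed
    finally show ?thesis .
  qed
  then show ?thesis by (intro exI[of _ "3 * B\<^sup>2"]) auto
qed

text \<open>Composition with a truncation is continuous in \<open>W\<^sup>1\<^sup>,\<^sup>2\<close> along a subsequence converging almost
  everywhere: the gradients are \<open>\<beta>' (\<phi>\<^sub>n) \<gamma>\<^sub>n\<close>, and \<open>\<beta>' (\<phi>\<^sub>n) - \<beta>' (u)\<close> tends to \<open>0\<close> boundedly.\<close>

lemma (in truncation) compose_tendsto:
  fixes u :: "real^'n \<Rightarrow> real"
  assumes U: "open U" and u: "sobolev U u g" and \<phi>: "\<And>n::nat. sobolev U (\<phi> n) (\<gamma> n)"
    and lim: "(\<lambda>n. W12_sq U (\<lambda>x. \<phi> n x - u x) (\<lambda>x. \<gamma> n x - g x)) \<longlonglongrightarrow> 0"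
  shows "\<exists>r::nat \<Rightarrow> nat. strict_mono r \<and>
    (\<lambda>n. W12_sq U (\<lambda>x. \<beta> (\<phi> (r n) x) - \<beta> (u x)) (\<lambda>x. \<beta>' (\<phi> (r n) x) *\<^sub>R \<gamma> (r n) x - \<beta>' (u x) *\<^sub>R g x)) \<longlonglongrightarrow> 0"
proof -
  define d where "d n x = (indicator U x * (\<phi> n x - u x))\<^sup>2" for n x
  define a where "a n x = (norm (indicator U x *\<^sub>R (\<gamma> n x - g x)))\<^sup>2" for n x
  note S = sobolev_diff[OF \<phi> u]
  have id: "integrable lebesgue (d n)" for n
    unfolding d_def using square_integrableD(2)[OF sobolevD(1)[OF S[of n]]] by simp
  have ia: "integrable lebesgue (a n)" for n
    unfolding a_def using square_integrableD(2)[OF sobolevD(2)[OF S[of n]]] by simp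
  have Wd: "W12_sq U (\<lambda>x. \<phi> n x - u x) (\<lambda>x. \<gamma> n x - g x) = (LINT x|lebesgue. d n x) +
      (LINT x|lebesgue. a n x)" for n
    unfolding W12_sq_def d_def a_def ..
  have d0: "0 \<le> (LINT x|lebesgue. d n x)" "0 \<le> (LINT x|lebesgue. a n x)" for n
    unfolding d_def a_def by simp_all
  have limd: "(\<lambda>n. \<integral>x. d n x \<partial>lebesgue) \<longlonglongrightarrow> 0" and lima: "(\<lambda>n. \<integral>x. a n x \<partial>lebesgue) \<longlonglongrightarrow> 0"
    by (rule tendsto_sandwich[OF _ _ tendsto_const lim]; use d0 in \<open>simp add: Wd\<close>)+
  have "(\<lambda>n. \<integral>x. norm (d n x) \<partial>lebesgue) \<longlonglongrightarrow> 0" using limd by (simp add: d_def)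
  from tendsto_L1_AE_subseq[OF id this] obtain r where r: "strict_mono r" "AE x in lebesgue. (\<lambda>n. d (r n) x)
      \<longlonglongrightarrow> 0"
    by blast
  define T where "T n x = (norm ((\<beta>' (indicator U x * \<phi> (r n) x) - \<beta>' (indicator U x * u x)) *\<^sub>R
      (indicator U x *\<^sub>R g x)))\<^sup>2" for n x
  have [measurable]: "(\<lambda>x. indicator U x * \<phi> n x) \<in> borel_measurable lebesgue"
      "(\<lambda>x. indicator U x * u x) \<in> borel_measurable lebesgue"
     "(\<lambda>x. indicator U x *\<^sub>R g x) \<in> borel_measurable lebesgue" for n
    using square_integrableD(1)[OF sobolevD(1)[OF \<phi>[of n]]] square_integrableD(1)[OF sobolevD(1)[OF u]]
        square_integrableD(1)[OF sobolevD(2)[OF u]]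
    by simp_all
  have i4: "integrable lebesgue (\<lambda>x. 4 * (norm (indicator U x *\<^sub>R g x))\<^sup>2)"
    using square_integrableD(2)[OF sobolevD(2)[OF u]] by (intro integrable_mult_right)
  have Tb: "T n x \<le> 4 * (norm (indicator U x *\<^sub>R g x))\<^sup>2" for n x
  proof -
    define b where "b = \<beta>' (indicator U x * \<phi> (r n) x) - \<beta>' (indicator U x * u x)"
    have "\<bar>b\<bar> \<le> 2"
      unfolding b_def using deriv_le_1[of "indicator U x * \<phi> (r n) x"] deriv_le_1[of "indicator U x * u x"]
          by linarith
    then have "b\<^sup>2 \<le> 2\<^sup>2" by (simp only: abs_le_square_iff[symmetric])
    then have "b\<^sup>2 * (norm (indicator U x *\<^sub>R g x))\<^sup>2 \<le> 2\<^sup>2 * (norm (indicator U x *\<^sub>R g x))\<^sup>2" by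
        (rule mult_right_mono) simp
    then show ?thesis unfolding T_def b_def[symmetric] norm_scaleR[of b] power_mult_distrib by simp
  qed
  have mT: "T n \<in> borel_measurable lebesgue" for n unfolding T_def by measurable
  have iT: "integrable lebesgue (T n)" for n
    by (rule Bochner_Integration.integrable_bound[OF i4 mT]) (use Tb[of n] in \<open>auto simp: T_def\<close>)
  have limT: "(\<lambda>n. \<integral>x. T n x \<partial>lebesgue) \<longlonglongrightarrow> (\<integral>x. 0 \<partial>(lebesgue :: (real^'n) measure))"
  proof (rule integral_dominated_convergence[where w="\<lambda>x. 4 * (norm (indicator U x *\<^sub>R g x))\<^sup>2"])
    show "AE x in lebesgue. (\<lambda>n. T n x) \<longlonglongrightarrow> 0"
      using r(2)
    proof (rule eventually_mono)
      fix x assume "(\<lambda>n. d (r n) x) \<longlonglongrightarrow> 0"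
      then have "(\<lambda>n. sqrt (d (r n) x)) \<longlonglongrightarrow> sqrt 0" by (intro tendsto_real_sqrt)
      then have "(\<lambda>n. \<bar>indicator U x * \<phi> (r n) x - indicator U x * u x\<bar>) \<longlonglongrightarrow> 0"
        unfolding d_def by (simp add: right_diff_distrib)
      then have "(\<lambda>n. indicator U x * \<phi> (r n) x) \<longlonglongrightarrow> indicator U x * u x"
        by (simp add: tendsto_rabs_zero_iff LIM_zero_iff)
      moreover have "isCont \<beta>' (indicator U x * u x)"
        using cont_deriv by (simp add: continuous_on_eq_continuous_at)
      ultimately have "(\<lambda>n. \<beta>' (indicator U x * \<phi> (r n) x)) \<longlonglongrightarrow> \<beta>' (indicator U x * u x)"
        by (rule isCont_tendsto_compose[rotated])
      then have "(\<lambda>n. (norm ((\<beta>' (indicator U x * \<phi> (r n) x) - \<beta>' (indicator U x * u x)) *\<^sub>R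
          (indicator U x *\<^sub>R g x)))\<^sup>2) \<longlonglongrightarrow>
         (norm ((\<beta>' (indicator U x * u x) - \<beta>' (indicator U x * u x)) *\<^sub>R (indicator U x *\<^sub>R g x)))\<^sup>2"
        by (intro tendsto_intros)
      then show "(\<lambda>n. T n x) \<longlonglongrightarrow> 0" unfolding T_def by simp
    qed
    show "AE x in lebesgue. norm (T n x) \<le> 4 * (norm (indicator U x *\<^sub>R g x))\<^sup>2" for n
      using Tb[of n] by (intro AE_I2) (simp add: T_def)
  qed (use i4 mT in auto)
  have bound: "W12_sq U (\<lambda>x. \<beta> (\<phi> (r n) x) - \<beta> (u x)) (\<lambda>x. \<beta>' (\<phi> (r n) x) *\<^sub>R \<gamma> (r n) x - \<beta>' (u x) *\<^sub>R g x) \<le>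
      (LINT x|lebesgue. d (r n) x) + (2 * (LINT x|lebesgue. a (r n) x) + 2 * (LINT x|lebesgue. T n x))" for n
  proof -
    have "(LINT x|lebesgue. (indicator U x * (\<beta> (\<phi> (r n) x) - \<beta> (u x)))\<^sup>2) \<le> (LINT x|lebesgue. d (r n) x)"
      unfolding d_def
    proof (intro integral_mono_AE' AE_I2)
      fix x show "(indicator U x * (\<beta> (\<phi> (r n) x) - \<beta> (u x)))\<^sup>2 \<le> (indicator U x * (\<phi> (r n) x - u x))\<^sup>2"
        using lipschitz[of "\<phi> (r n) x" "u x"] by (simp add: indicator_def abs_le_square_iff[symmetric])
    qed (use id[of "r n"] in \<open>auto simp: d_def[abs_def]\<close>)
    moreover have "(LINT x|lebesgue. (norm (indicator U x *\<^sub>R (\<beta>' (\<phi> (r n) x) *\<^sub>R \<gamma> (r n) x - \<beta>'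
        (u x) *\<^sub>R g x)))\<^sup>2) \<le>
        (LINT x|lebesgue. 2 * a (r n) x + 2 * T n x)"
    proof (intro integral_mono_AE' AE_I2)
      fix x
      define v where "v = \<beta>' (\<phi> (r n) x) *\<^sub>R (indicator U x *\<^sub>R (\<gamma> (r n) x - g x))"
      have eq: "indicator U x *\<^sub>R (\<beta>' (\<phi> (r n) x) *\<^sub>R \<gamma> (r n) x - \<beta>' (u x) *\<^sub>R g x) =
        v + (\<beta>' (indicator U x * \<phi> (r n) x) - \<beta>' (indicator U x * u x)) *\<^sub>R (indicator U x *\<^sub>R g x)"
        unfolding v_def by (cases "x \<in> U") (simp_all add: algebra_simps)
      have "(norm v)\<^sup>2 \<le> a (r n) x"
      proof -
        have "norm v \<le> 1 * norm (indicator U x *\<^sub>R (\<gamma> (r n) x - g x))"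
          unfolding v_def norm_scaleR[of "\<beta>' _"] real_norm_def by (intro mult_right_mono deriv_le_1) simp
        then show ?thesis unfolding a_def by (intro power_mono) auto
      qed
      then show "(norm (indicator U x *\<^sub>R (\<beta>' (\<phi> (r n) x) *\<^sub>R \<gamma> (r n) x - \<beta>' (u x) *\<^sub>R g x)))\<^sup>2 \<le> 2 * a
          (r n) x + 2 * T n x"
        unfolding eq using norm_add_sq_le[of v "(\<beta>' (indicator U x * \<phi> (r n) x) - \<beta>'
            (indicator U x * u x)) *\<^sub>R (indicator U x *\<^sub>R g x)"]
        unfolding T_def by linarith
    next
      fix x show "0 \<le> 2 * a (r n) x + 2 * T n x" unfolding a_def T_def by simp
    qed (use ia iT in auto)
    ultimately show ?thesis unfolding W12_sq_def using ia[of "r n"] iT[of n] by simp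
  qed
  have limr: "(\<lambda>n. \<integral>x. d (r n) x \<partial>lebesgue) \<longlonglongrightarrow> 0" "(\<lambda>n. \<integral>x. a (r n) x \<partial>lebesgue) \<longlonglongrightarrow> 0"
    using LIMSEQ_subseq_LIMSEQ[OF limd r(1)] LIMSEQ_subseq_LIMSEQ[OF lima r(1)] by (simp_all add: o_def)
  have "(\<lambda>n. (LINT x|lebesgue. d (r n) x) + (2 * (LINT x|lebesgue. a (r n) x) + 2 *
      (LINT x|lebesgue. T n x))) \<longlonglongrightarrow> 0 + (2 * 0 + 2 * 0)"
    using limT by (intro tendsto_intros limr) simp
  then have up: "(\<lambda>n. (LINT x|lebesgue. d (r n) x) + (2 * (LINT x|lebesgue. a (r n) x) + 2 *
      (LINT x|lebesgue. T n x))) \<longlonglongrightarrow> 0" by simp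
  have "(\<lambda>n. W12_sq U (\<lambda>x. \<beta> (\<phi> (r n) x) - \<beta> (u x)) (\<lambda>x. \<beta>' (\<phi> (r n) x) *\<^sub>R \<gamma> (r n) x - \<beta>' (u x) *\<^sub>R g x)) \<longlonglongrightarrow> 0"
    by (rule tendsto_sandwich[OF _ _ tendsto_const up]) (auto intro!: always_eventually bound W12_sq_nonneg)
  with r(1) show ?thesis by blast
qed

section \<open>Approximation by continuous functions vanishing on a set\<close>

text \<open>Membership in the closure, in \<open>W\<^sup>1\<^sup>,\<^sup>2(U)\<close>, of the functions continuous up to the boundary that vanish
  on \<open>S\<close>.\<close>

definition vanishing_approx :: "(real^'n) set \<Rightarrow> (real^'n) set \<Rightarrow> (real^'n \<Rightarrow> real) \<Rightarrow>
    (real^'n \<Rightarrow> real^'n) \<Rightarrow> bool" where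
  "vanishing_approx U S u g \<longleftrightarrow> sobolev U u g \<and>
    (\<forall>\<epsilon>>0. \<exists>\<eta> \<gamma>. sobolev U \<eta> \<gamma> \<and> continuous_on (closure U) \<eta> \<and> (\<forall>x\<in>S. \<eta> x = 0) \<and>
       W12_sq U (\<lambda>x. \<eta> x - u x) (\<lambda>x. \<gamma> x - g x) < \<epsilon>)"

lemma vanishing_approx_add:
  assumes "vanishing_approx U S u g" "vanishing_approx U S v h"
  shows "vanishing_approx U S (\<lambda>x. u x + v x) (\<lambda>x. g x + h x)"
  unfolding vanishing_approx_def
proof (intro conjI allI impI)
  have uv: "sobolev U u g" "sobolev U v h" using assms unfolding vanishing_approx_def by auto
  then show "sobolev U (\<lambda>x. u x + v x) (\<lambda>x. g x + h x)" by (rule sobolev_add)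
  fix \<epsilon> :: real assume "\<epsilon> > 0"
  then have e4: "\<epsilon> / 4 > 0" by simp
  obtain \<eta>1 \<gamma>1 where 1: "sobolev U \<eta>1 \<gamma>1" "continuous_on (closure U) \<eta>1" "\<forall>x\<in>S. \<eta>1 x = 0"
    "W12_sq U (\<lambda>x. \<eta>1 x - u x) (\<lambda>x. \<gamma>1 x - g x) < \<epsilon> / 4"
    using assms(1) e4 unfolding vanishing_approx_def by blast
  obtain \<eta>2 \<gamma>2 where 2: "sobolev U \<eta>2 \<gamma>2" "continuous_on (closure U) \<eta>2" "\<forall>x\<in>S. \<eta>2 x = 0"
    "W12_sq U (\<lambda>x. \<eta>2 x - v x) (\<lambda>x. \<gamma>2 x - h x) < \<epsilon> / 4"
    using assms(2) e4 unfolding vanishing_approx_def by blast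
  have "W12_sq U (\<lambda>x. (\<eta>1 x - u x) + (\<eta>2 x - v x)) (\<lambda>x. (\<gamma>1 x - g x) + (\<gamma>2 x - h x)) < \<epsilon>"
    using W12_sq_add[OF sobolev_diff[OF 1(1) uv(1)] sobolev_diff[OF 2(1) uv(2)]] 1(4) 2(4) by linarith
  then show "\<exists>\<eta> \<gamma>. sobolev U \<eta> \<gamma> \<and> continuous_on (closure U) \<eta> \<and> (\<forall>x\<in>S. \<eta> x = 0) \<and>
       W12_sq U (\<lambda>x. \<eta> x - (u x + v x)) (\<lambda>x. \<gamma> x - (g x + h x)) < \<epsilon>"
    using 1 2 sobolev_add[OF 1(1) 2(1)]
    by (intro exI[of _ "\<lambda>x. \<eta>1 x + \<eta>2 x"] exI[of _ "\<lambda>x. \<gamma>1 x + \<gamma>2 x"])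
        (auto intro: continuous_intros simp: algebra_simps)
qed

lemma vanishing_approx_sum:
  assumes "finite I" "\<And>i. i \<in> I \<Longrightarrow> vanishing_approx U S (u i) (g i)"
  shows "vanishing_approx U S (\<lambda>x. \<Sum>i\<in>I. u i x) (\<lambda>x. \<Sum>i\<in>I. g i x)"
  using assms
proof (induction I rule: finite_induct)
  case empty
  have "sobolev U (\<lambda>x. 0) (\<lambda>x. 0)" by (intro sobolevI) (auto simp: square_integrable_def)
  then show ?case
    unfolding vanishing_approx_def by (auto intro!: exI[of _ "\<lambda>x. 0"] simp: W12_sq_def)
next
  case (insert i I)
  then show ?case by (simp add: vanishing_approx_add)
qed

definition ball_measure :: "'a::euclidean_space \<Rightarrow> real \<Rightarrow> 'a measure" where
  "ball_measure c \<delta> = uniform_measure lborel (ball c \<delta>)"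

lemma ball_emeasure:
  fixes c :: "'a::euclidean_space"
  assumes "\<delta> > 0"
  shows "emeasure lborel (ball c \<delta>) \<noteq> 0" "emeasure lborel (ball c \<delta>) \<noteq> \<infinity>"
proof -
  show "emeasure lborel (ball c \<delta>) \<noteq> \<infinity>"
    using emeasure_bounded_finite[of "ball c \<delta>"] by auto
  show "emeasure lborel (ball c \<delta>) \<noteq> 0"
  proof
    assume "emeasure lborel (ball c \<delta>) = 0"
    then have "ball c \<delta> \<in> null_sets lborel" by (simp add: null_sets_def)
    then have "negligible (ball c \<delta>)" using negligible_iff_null_sets null_sets_completionI by blast
    then show False using open_not_negligible[of "ball c \<delta>"] assms by simp
  qed
qed

lemma averaging_ball:
  assumes "\<delta> > 0"
  shows "averaging (ball_measure c \<delta>) (norm c + \<delta>)"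
proof -
  interpret prob_space "ball_measure c \<delta>"
    unfolding ball_measure_def by (rule prob_space_uniform_measure) (use ball_emeasure[OF assms, of c] in auto)
  show ?thesis
  proof
    show "sets (ball_measure c \<delta>) = sets borel" by (simp add: ball_measure_def)
    show "AE y in ball_measure c \<delta>. norm y \<le> norm c + \<delta>"
      unfolding ball_measure_def
    proof (rule AE_uniform_measureI)
      show "AE x in lborel. x \<in> ball c \<delta> \<longrightarrow> norm x \<le> norm c + \<delta>"
      proof (intro AE_I2 impI)
        fix x assume "x \<in> ball c \<delta>"
        then show "norm x \<le> norm c + \<delta>"
          using norm_triangle_ineq4[of c "c - x"] by (simp add: dist_norm)
      qed
    qed simp
  qed
qed

lemma ball_avg_eq_0:
  assumes "\<And>y. y \<in> ball c \<delta> \<Longrightarrow> w (x + t *\<^sub>R y) = 0" "\<delta> > 0"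
  shows "averaging.avg (ball_measure c \<delta>) t w x = 0"
proof -
  interpret averaging "ball_measure c \<delta>" "norm c + \<delta>" by (rule averaging_ball[OF assms(2)])
  have "AE y in ball_measure c \<delta>. w (x + t *\<^sub>R y) = 0"
    unfolding ball_measure_def by (rule AE_uniform_measureI) (use assms(1) in auto)
  then show ?thesis unfolding avg_def by (rule integral_eq_zero_AE)
qed

text \<open>An average over a ball is continuous because, after a change of variables, moving the base
  point amounts to translating the function in \<open>L\<^sup>2\<close>.\<close>

lemma ball_avg_continuous:
  fixes c :: "'a::euclidean_space"
  assumes \<delta>: "\<delta> > 0" and t: "t \<noteq> 0" and w: "L2 w"
  shows "continuous_on UNIV (averaging.avg (ball_measure c \<delta>) t w)"
proof -
  interpret averaging "ball_measure c \<delta>" "norm c + \<delta>" by (rule averaging_ball[OF \<delta>])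
  have [measurable]: "w \<in> borel_measurable borel" using w by auto
  define m where "m = enn2real (emeasure lborel (ball c \<delta>))"
  have m: "m > 0" "emeasure lborel (ball c \<delta>) = ennreal m"
    using ball_emeasure[OF \<delta>, of c] unfolding m_def by (auto simp: enn2real_positive_iff less_top
        zero_less_iff_neq_zero)
  define D where "D = \<bar>t\<bar> ^ DIM('a)"
  have D: "D > 0" using t unfolding D_def by simp
  have scale: "(\<integral>\<^sup>+y. f (t *\<^sub>R y) \<partial>lborel) = ennreal (1 / D) * (\<integral>\<^sup>+y. f y \<partial>lborel)"
    if [measurable]: "f \<in> borel_measurable borel" for f :: "'a \<Rightarrow> ennreal"
  proof -
    have "(\<integral>\<^sup>+y. f y \<partial>lborel) = (\<integral>\<^sup>+y. f y \<partial>density (distr lborel borel (\<lambda>x. 0 + t *\<^sub>R x)) (\<lambda>_. ennreal D))"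
      unfolding D_def by (subst lborel_affine[OF t, of 0]) simp
    also have "\<dots> = ennreal D * (\<integral>\<^sup>+y. f (t *\<^sub>R y) \<partial>lborel)"
      by (simp add: nn_integral_density nn_integral_distr nn_integral_cmult)
    finally show ?thesis using D by (simp add: mult.assoc[symmetric] ennreal_mult[symmetric])
  qed
  have bound: "(avg t w x - avg t w x')\<^sup>2 \<le> (1 / m) * (1 / D) * (LBINT z. (w (z + (x - x')) - w z)\<^sup>2)" for x x'
  proof -
    define I where "I = (LBINT z. (w (z + (x - x')) - w z)\<^sup>2)"
    have L: "L2 (\<lambda>z. w (z + (x - x')) - w z)" by (rule L2_diff[OF L2_translate[OF w] w])
    have I: "(\<integral>\<^sup>+z. ennreal ((w (z + (x - x')) - w z)\<^sup>2) \<partial>lborel) = ennreal I"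
      unfolding I_def using L by (intro nn_integral_eq_integral) auto
    have wi: "integrable (ball_measure c \<delta>) (\<lambda>y. w (x + t *\<^sub>R y))" for x
    proof (rule square_integrable_imp_integrable)
      have "(\<integral>\<^sup>+y. ennreal ((w (x + t *\<^sub>R y))\<^sup>2) \<partial>ball_measure c \<delta>) \<le> (\<integral>\<^sup>+y. ennreal ((w (x
          + t *\<^sub>R y))\<^sup>2) \<partial>lborel) / ennreal m"
        unfolding ball_measure_def
        by (subst nn_integral_uniform_measure)
          (auto simp: m intro!: divide_right_mono_ennreal nn_integral_mono split: split_indicator)
      also have "(\<integral>\<^sup>+y. ennreal ((w (x + t *\<^sub>R y))\<^sup>2) \<partial>lborel) = ennreal (1 / D) * (\<integral>\<^sup>+y. ennreal ((w (x
          + y))\<^sup>2) \<partial>lborel)"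
        using scale[of "\<lambda>y. ennreal ((w (x + y))\<^sup>2)"] by simp
      also have "(\<integral>\<^sup>+y. ennreal ((w (x + y))\<^sup>2) \<partial>lborel) = (\<integral>\<^sup>+y. ennreal ((w y)\<^sup>2) \<partial>lborel)"
        using nn_integral_translate[of "\<lambda>y. ennreal ((w y)\<^sup>2)" x] by (simp add: add.commute)
      also have "\<dots> = ennreal (LBINT y. (w y)\<^sup>2)" using w by (intro nn_integral_eq_integral) auto
      also have "ennreal (1 / D) * ennreal (LBINT y. (w y)\<^sup>2) / ennreal m < \<infinity>"
        using m(1) D by (simp add: ennreal_mult[symmetric] divide_ennreal)
      finally show "integrable (ball_measure c \<delta>) (\<lambda>y. (w (x + t *\<^sub>R y))\<^sup>2)"
        by (intro integrableI_nonneg) (auto simp: ball_measure_def)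
    qed (auto simp: ball_measure_def)
    have "avg t w x - avg t w x' = (\<integral>y. w (x + t *\<^sub>R y) - w (x' + t *\<^sub>R y) \<partial>ball_measure c \<delta>)"
      unfolding avg_def using wi by simp
    then have "ennreal ((avg t w x - avg t w x')\<^sup>2) \<le> (\<integral>\<^sup>+y. ennreal ((w (x + t *\<^sub>R y) - w (x'
        + t *\<^sub>R y))\<^sup>2) \<partial>ball_measure c \<delta>)"
      using square_integral_diff_le[of "\<lambda>y. w (x + t *\<^sub>R y) - w (x' + t *\<^sub>R y)" 0] by
          (simp add: ball_measure_def)
    also have "\<dots> \<le> (\<integral>\<^sup>+y. ennreal ((w (x + t *\<^sub>R y) - w (x' + t *\<^sub>R y))\<^sup>2) \<partial>lborel) / ennreal m"
      unfolding ball_measure_def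
      by (subst nn_integral_uniform_measure)
        (auto simp: m intro!: divide_right_mono_ennreal nn_integral_mono split: split_indicator)
    also have "(\<integral>\<^sup>+y. ennreal ((w (x + t *\<^sub>R y) - w (x' + t *\<^sub>R y))\<^sup>2) \<partial>lborel) =
        ennreal (1 / D) * (\<integral>\<^sup>+y. ennreal ((w (x + y) - w (x' + y))\<^sup>2) \<partial>lborel)"
      using scale[of "\<lambda>y. ennreal ((w (x + y) - w (x' + y))\<^sup>2)"] by simp
    also have "(\<integral>\<^sup>+y. ennreal ((w (x + y) - w (x' + y))\<^sup>2) \<partial>lborel) = ennreal I"
      unfolding I[symmetric]
      using nn_integral_translate[of "\<lambda>z. ennreal ((w (z + (x - x')) - w z)\<^sup>2)" x'] by (simp add: algebra_simps)
    also have "ennreal (1 / D) * ennreal I / ennreal m = ennreal ((1 / m) * (1 / D) * I)"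
      using m(1) D by (simp add: ennreal_mult[symmetric] divide_ennreal I_def mult.commute)
    finally show ?thesis unfolding I_def[symmetric]
      using m(1) D by (subst (asm) ennreal_le_iff) (auto simp: I_def)
  qed
  show ?thesis
    unfolding continuous_on_iff
  proof (intro ballI allI impI)
    fix x' :: 'a and e :: real assume e: "e > 0"
    have "e\<^sup>2 * (m * D) > 0" using e m(1) D by simp
    then obtain d where d: "d > 0" "\<And>z. norm z < d \<Longrightarrow> (LBINT x. (w (x + z) - w x)\<^sup>2) < e\<^sup>2 * (m * D)"
      using L2_translation[OF w] by blast
    show "\<exists>d>0. \<forall>x\<in>UNIV. dist x x' < d \<longrightarrow> dist (avg t w x) (avg t w x') < e"
    proof (intro exI[of _ d] conjI ballI impI d(1))
      fix x assume "dist x x' < d"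
      then have "(LBINT z. (w (z + (x - x')) - w z)\<^sup>2) < e\<^sup>2 * (m * D)" by (intro d(2)) (simp add: dist_norm)
      then have "(1 / m) * (1 / D) * (LBINT z. (w (z + (x - x')) - w z)\<^sup>2) < e\<^sup>2"
        using m(1) D by (simp add: field_simps)
      with bound[of x x'] have "(avg t w x - avg t w x')\<^sup>2 < e\<^sup>2" by linarith
      then show "dist (avg t w x) (avg t w x') < e"
        using power2_less_imp_less[of "\<bar>avg t w x - avg t w x'\<bar>" e] e by (simp add: dist_real_def)
    qed
  qed
qed

section \<open>Lipschitz boundaries\<close>

text \<open>The interior cone condition: directions \<open>y\<close> close to the upward vector \<open>e2\<close> have a horizontal part below
  \<open>1 / (L + 2)\<close> and a vertical part above \<open>1 - 1 / (L + 2)\<close>, that is, a slope exceeding \<open>L\<close>.\<close>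

lemma lipschitz_graph_translate:
  fixes e1 e2 x y :: "'a::real_inner"
  assumes e: "norm e1 = 1" "norm e2 = 1" "e1 \<bullet> e2 = 0" and \<gamma>: "L-lipschitz_on UNIV \<gamma>" and t: "t > 0"
    and x: "\<gamma> (x \<bullet> e1) \<le> x \<bullet> e2" and y: "dist e2 y < 1 / (L + 2)"
  shows "\<gamma> ((x + t *\<^sub>R y) \<bullet> e1) < (x + t *\<^sub>R y) \<bullet> (e2 :: 'a)"
proof -
  have L: "L \<ge> 0" using \<gamma> by (rule lipschitz_on_nonneg)
  define \<delta> where "\<delta> = 1 / (L + 2)"
  have \<delta>: "\<delta> > 0" "(L + 1) * \<delta> < 1" using L unfolding \<delta>_def by (auto simp: field_simps)
  have n: "norm (y - e2) < \<delta>" using y unfolding \<delta>_def by (simp add: dist_norm norm_minus_commute)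
  have "\<bar>(y - e2) \<bullet> e1\<bar> \<le> norm (y - e2)" "\<bar>(y - e2) \<bullet> e2\<bar> \<le> norm (y - e2)"
    using Cauchy_Schwarz_ineq2[of "y - e2" e1] Cauchy_Schwarz_ineq2[of "y - e2" e2] e by simp_all
  moreover have "(y - e2) \<bullet> e1 = y \<bullet> e1" "(y - e2) \<bullet> e2 = y \<bullet> e2 - 1"
    using e by (simp_all add: inner_diff_left inner_commute[of e2] dot_square_norm)
  ultimately have y1: "\<bar>y \<bullet> e1\<bar> < \<delta>" and y2: "y \<bullet> e2 > 1 - \<delta>" using n by linarith+
  have "\<gamma> ((x + t *\<^sub>R y) \<bullet> e1) - \<gamma> (x \<bullet> e1) \<le> L * \<bar>t * (y \<bullet> e1)\<bar>"
    using lipschitz_onD[OF \<gamma>, of "(x + t *\<^sub>R y) \<bullet> e1" "x \<bullet> e1"] by (simp add: dist_real_def inner_add_left)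
  also have "\<dots> \<le> L * (t * \<delta>)"
    using L t y1 by (intro mult_left_mono) (auto simp: abs_mult)
  also have "\<dots> < t * (1 - \<delta>)" using mult_strict_left_mono[OF \<delta>(2) t] by (simp add: algebra_simps)
  also have "\<dots> < t * (y \<bullet> e2)" using y2 t by (intro mult_strict_left_mono)
  finally show ?thesis using x by (simp add: inner_add_left)
qed

lemma lipschitz_graph_closure:
  fixes e1 e2 :: "'a::real_inner"
  assumes "C \<inter> ball x0 r = {x \<in> ball x0 r. \<gamma> (x \<bullet> e1) < x \<bullet> e2}" "continuous_on UNIV (\<gamma> :: real \<Rightarrow> real)"
    and x: "x \<in> closure C" "x \<in> ball x0 r"
  shows "\<gamma> (x \<bullet> e1) \<le> x \<bullet> e2"
proof (rule ccontr)
  define W where "W = ball x0 r \<inter> {y. y \<bullet> e2 < \<gamma> (y \<bullet> e1)}"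
  assume "\<not> ?thesis"
  then have "x \<in> W" using x(2) unfolding W_def by simp
  moreover have "open W"
    unfolding W_def
    by (intro open_Int open_ball open_Collect_less continuous_intros continuous_on_compose2[OF assms(2)]) auto
  ultimately have "W \<inter> C \<noteq> {}" using x(1) open_Int_closure_eq_empty[of W C] by blast
  then obtain z where z: "z \<in> W" "z \<in> C" by blast
  then have "z \<in> C \<inter> ball x0 r" unfolding W_def by simp
  then have "\<gamma> (z \<bullet> e1) < z \<bullet> e2" unfolding assms(1) by simp
  then show False using z(1) unfolding W_def by simp
qed

text \<open>The approximations are averages of \<open>p h\<close> over balls \<open>x + t Q\<close> that lie off centre, in the direction
  pointing into \<open>C\<close>.  By the cone condition, a point of \<open>S\<close> sees only values of \<open>h\<close> on \<open>C\<close>, and these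
  are \<open>0\<close>.\<close>

lemma local_vanishing_approx:
  fixes h :: "real^2 \<Rightarrow> real"
  assumes \<Omega>: "open \<Omega>" and G: "open G" "G \<subseteq> \<Omega>" and h: "sobolev \<Omega> h g" "\<And>x. x \<in> C \<Longrightarrow> h x = 0"
    and C: "open C" "C \<inter> ball x0 r = {x \<in> ball x0 r. \<gamma> (x \<bullet> e1) < x \<bullet> e2}"
    and e: "norm e1 = 1" "norm e2 = 1" "e1 \<bullet> e2 = 0" and \<gamma>: "L-lipschitz_on UNIV \<gamma>"
    and r: "ball x0 r \<subseteq> \<Omega>" and S: "S \<inter> ball x0 r \<subseteq> closure C" and p: "test_function (ball x0 r) p"
  shows "vanishing_approx G S (\<lambda>x. p x * h x) (\<lambda>x. p x *\<^sub>R g x + h x *\<^sub>R grad p x)"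
  unfolding vanishing_approx_def
proof (intro conjI allI impI)
  define A where "A = closure {x. p x \<noteq> 0}"
  have A: "compact A" "A \<subseteq> ball x0 r" using test_functionD[OF p] unfolding A_def by auto
  define w where "w x = p x * h x" for x
  define gw where "gw x = p x *\<^sub>R g x + h x *\<^sub>R grad p x" for x
  have sw: "sobolev UNIV w gw"
    unfolding w_def[abs_def] gw_def[abs_def]
    by (rule sobolev_extend_by_zero[OF h(1) test_function_mono[OF p r] \<Omega>])
  have swG: "sobolev G w gw" by (rule sobolev_restrict[OF sw]) (use G in auto)
  then show "sobolev G (\<lambda>x. p x * h x) (\<lambda>x. p x *\<^sub>R g x + h x *\<^sub>R grad p x)"
    unfolding w_def[abs_def] gw_def[abs_def] .
  obtain w0 where w0: "L2 w0" "AE x in lebesgue. w x = w0 x"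
    using square_integrable_borel_version[OF sobolev_UNIV_D(1)[OF sw]] by blast
  \<comment> \<open>A Borel version of \<open>w\<close> that vanishes at every point of \<open>C\<close> and outside the support of \<open>p\<close>.\<close>
  define w1 where "w1 x = indicator (A - C) x * w0 x" for x
  have w1_zero: "w1 x = 0" if "x \<notin> A \<or> x \<in> C" for x using that by (auto simp: w1_def)
  have w_zero: "w x = 0" if "x \<notin> A \<or> x \<in> C" for x
    using that h(2) outside_support[of x p] unfolding w_def A_def by auto
  have ae: "AE x in lebesgue. x \<in> UNIV \<longrightarrow> w1 x = w x"
    using w0(2)
  proof (rule eventually_mono)
    fix x assume "w x = w0 x"
    then show "x \<in> UNIV \<longrightarrow> w1 x = w x"
      using w_zero[of x] w1_zero[of x] by (cases "x \<in> A - C") (auto simp: w1_def)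
  qed
  have [measurable]: "A \<in> sets borel" "C \<in> sets borel" "w0 \<in> borel_measurable borel"
    using borel_compact[OF A(1)] C(1) w0(1) by auto
  have mw1: "w1 \<in> borel_measurable borel" unfolding w1_def[abs_def] by measurable
  have sw1: "sobolev UNIV w1 gw" by (rule sobolev_cong_AE[OF sw ae]) auto
  have Lw1: "L2 w1" using square_integrable_borel[OF sobolev_UNIV_D(1)[OF sw1] mw1] .
  fix \<epsilon> :: real assume \<epsilon>: "\<epsilon> > 0"
  have L: "L \<ge> 0" using \<gamma> by (rule lipschitz_on_nonneg)
  define \<delta> where "\<delta> = 1 / (L + 2)"
  have \<delta>: "\<delta> > 0" "\<delta> \<le> 1" using L unfolding \<delta>_def by auto
  note av = averaging_ball[OF \<delta>(1), of e2]
  interpret averaging "ball_measure e2 \<delta>" "norm e2 + \<delta>" by (rule av)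
  obtain d where d: "d > 0" "\<And>t. \<bar>t\<bar> < d \<Longrightarrow> \<exists>\<gamma>'. sobolev UNIV (avg t w1) \<gamma>' \<and>
     (LINT x|lebesgue. (avg t w1 x - w1 x)\<^sup>2) < \<epsilon> / 2 \<and> (LINT x|lebesgue. (norm (\<gamma>' x - gw x))\<^sup>2) < \<epsilon> / 2"
    using avg_sobolev_approx[OF av sw1 mw1, of "\<epsilon> / 2"] \<epsilon> by auto
  obtain d0 where d0: "d0 > 0" "(\<Union>a\<in>A. ball a d0) \<subseteq> ball x0 r"
    using compact_subset_open_imp_ball_epsilon_subset[OF A(1) open_ball A(2)] .
  \<comment> \<open>\<open>t\<close> is so small that \<open>x + t y \<in> A\<close> with \<open>norm y < 2\<close> forces \<open>x\<close> into the ball around \<open>x0\<close>.\<close>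
  define t where "t = min d d0 / 4"
  have t: "t > 0" "\<bar>t\<bar> < d" "2 * t < d0" using d(1) d0(1) unfolding t_def by auto
  obtain \<gamma>' where \<gamma>': "sobolev UNIV (avg t w1) \<gamma>'"
    "(LINT x|lebesgue. (avg t w1 x - w1 x)\<^sup>2) < \<epsilon> / 2" "(LINT x|lebesgue. (norm (\<gamma>' x - gw x))\<^sup>2) < \<epsilon> / 2"
    using d(2)[OF t(2)] by blast
  have zero: "avg t w1 x = 0" if x: "x \<in> S" for x
  proof (rule ball_avg_eq_0[OF _ \<delta>(1)])
    fix y assume y: "y \<in> ball e2 \<delta>"
    have "norm y \<le> norm e2 + norm (y - e2)" using norm_triangle_ineq[of e2 "y - e2"] by simp
    then have ny: "norm y < 2" using y e(2) \<delta>(2) by (simp add: dist_norm norm_minus_commute)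
    show "w1 (x + t *\<^sub>R y) = 0"
    proof (cases "x + t *\<^sub>R y \<in> A")
      case True
      have "norm (t *\<^sub>R y) \<le> t * 2" using ny t(1) by (simp add: mult_left_mono)
      then have "x \<in> ball (x + t *\<^sub>R y) d0" using t(3) by (simp add: dist_norm)
      then have xb: "x \<in> ball x0 r" using True d0(2) by blast
      have "x \<in> closure C" using x xb S by blast
      then have "\<gamma> (x \<bullet> e1) \<le> x \<bullet> e2"
        by (rule lipschitz_graph_closure[OF C(2) lipschitz_on_continuous_on[OF \<gamma>] _ xb])
      then have "\<gamma> ((x + t *\<^sub>R y) \<bullet> e1) < (x + t *\<^sub>R y) \<bullet> e2"
        by (rule lipschitz_graph_translate[OF e \<gamma> t(1)]) (use y \<delta>_def in auto)
      then have "x + t *\<^sub>R y \<in> C \<inter> ball x0 r" unfolding C(2) using True A(2) by auto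
      then show ?thesis by (intro w1_zero) auto
    qed (intro w1_zero, simp)
  qed
  have "sobolev G (avg t w1) \<gamma>'" by (rule sobolev_restrict[OF \<gamma>'(1)]) (use G in auto)
  moreover have "continuous_on (closure G) (avg t w1)"
    by (rule continuous_on_subset[OF ball_avg_continuous[OF \<delta>(1) _ Lw1]]) (use t(1) in auto)
  moreover have "W12_sq G (\<lambda>x. avg t w1 x - w x) (\<lambda>x. \<gamma>' x - gw x) < \<epsilon>"
  proof -
    have "W12_sq G (\<lambda>x. avg t w1 x - w x) (\<lambda>x. \<gamma>' x - gw x) \<le> W12_sq UNIV (\<lambda>x. avg t w1 x - w x)
        (\<lambda>x. \<gamma>' x - gw x)"
      by (rule W12_sq_restrict[OF sobolev_diff[OF \<gamma>'(1) sw]]) (use G in auto)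
    also have "\<dots> = (LINT x|lebesgue. (avg t w1 x - w x)\<^sup>2) + (LINT x|lebesgue. (norm (\<gamma>' x - gw x))\<^sup>2)"
      by (simp add: W12_sq_def)
    also have "(LINT x|lebesgue. (avg t w1 x - w x)\<^sup>2) = (LINT x|lebesgue. (avg t w1 x - w1 x)\<^sup>2)"
    proof (rule integral_cong_AE)
      show "AE x in lebesgue. (avg t w1 x - w x)\<^sup>2 = (avg t w1 x - w1 x)\<^sup>2"
        using ae by (rule eventually_mono) simp
    qed (use square_integrableD(1)[OF sobolev_UNIV_D(1)[OF sobolev_diff[OF \<gamma>'(1) sw]]]
           square_integrableD(1)[OF sobolev_UNIV_D(1)[OF sobolev_diff[OF \<gamma>'(1) sw1]]] in auto)
    finally show ?thesis using \<gamma>'(2,3) by simp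
  qed
  ultimately show "\<exists>\<eta> \<gamma>'. sobolev G \<eta> \<gamma>' \<and> continuous_on (closure G) \<eta> \<and> (\<forall>x\<in>S. \<eta> x = 0) \<and>
     W12_sq G (\<lambda>x. \<eta> x - p x * h x) (\<lambda>x. \<gamma>' x - (p x *\<^sub>R g x + h x *\<^sub>R grad p x)) < \<epsilon>"
    using zero unfolding w_def gw_def by blast
qed

lemma grad_sum:
  assumes "finite I" "\<And>i. i \<in> I \<Longrightarrow> smooth (p i)"
  shows "grad (\<lambda>x. \<Sum>i\<in>I. p i x) x = (\<Sum>i\<in>I. grad (p i) x)"
proof (rule grad_eqI)
  show "GDERIV (\<lambda>x. \<Sum>i\<in>I. p i x) x :> (\<Sum>i\<in>I. grad (p i) x)"
    using assms
  proof (induction I rule: finite_induct)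
    case (insert i I)
    then show ?case by (simp add: GDERIV_add smooth_GDERIV)
  qed (simp add: GDERIV_const)
qed

text \<open>Since the \<open>C\<^sub>i\<close> have positive distance from each other, near a boundary point of \<open>K\<close> only one of them is
  visible, and its graph representation is one of \<open>K\<close>.\<close>

lemma lipschitz_domains_local_graph:
  fixes C :: "nat \<Rightarrow> (real^2) set"
  assumes lip: "\<And>i. i < N \<Longrightarrow> lipschitz_domain (C i)"
    and sep: "\<And>i j. i < N \<Longrightarrow> j < N \<Longrightarrow> i \<noteq> j \<Longrightarrow> setdist (C i) (C j) > 0"
    and K: "K = closure (\<Union>i<N. C i)" and \<Omega>: "open \<Omega>" "K \<subseteq> \<Omega>" and x0: "x0 \<in> frontier K"
  shows "\<exists>r>0. \<exists>i<N. \<exists>e1 e2 \<gamma> L. norm e1 = 1 \<and> norm e2 = 1 \<and> e1 \<bullet> e2 = 0 \<and> L-lipschitz_on UNIV \<gamma> \<and>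
    C i \<inter> ball x0 r = {x \<in> ball x0 r. \<gamma> (x \<bullet> e1) < x \<bullet> e2} \<and> ball x0 r \<subseteq> \<Omega>
        \<and> frontier K \<inter> ball x0 r \<subseteq> closure (C i)"
proof -
  have K': "K = (\<Union>i<N. closure (C i))"
  proof
    have "closed (\<Union>i<N. closure (C i))" by (intro closed_UN) auto
    then show "K \<subseteq> (\<Union>i<N. closure (C i))"
      unfolding K by (intro closure_minimal UN_mono closure_subset order_refl)
    show "(\<Union>i<N. closure (C i)) \<subseteq> K" unfolding K by (intro UN_least closure_mono) auto
  qed
  have fK: "frontier K \<subseteq> K" using K by (simp add: frontier_subset_closed)
  have op: "open (C i)" if "i < N" for i using lip[OF that] unfolding lipschitz_domain_def by blast
  obtain i where i: "i < N" "x0 \<in> closure (C i)" using x0 fK K' by blast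
  have "C i \<subseteq> K" using i(1) K' closure_subset by blast
  then have "C i \<subseteq> interior K" using op[OF i(1)] by (rule interior_maximal)
  then have "x0 \<notin> C i" using x0 unfolding frontier_def by blast
  then have "x0 \<in> frontier (C i)" using i op[OF i(1)] by (simp add: frontier_def interior_open)
  then obtain r0 e1 e2 \<gamma> L where r0: "r0 > 0" "norm e1 = 1" "norm e2 = 1" "e1 \<bullet> e2 = 0" "L-lipschitz_on UNIV \<gamma>"
    "C i \<inter> ball x0 r0 = {x \<in> ball x0 r0. \<gamma> (x \<bullet> e1) < x \<bullet> e2}"
    using lip[OF i(1)] unfolding lipschitz_domain_def by blast
  define W where "W = \<Omega> - (\<Union>j\<in>{..<N} - {i}. closure (C j))"
  have "open W" unfolding W_def using \<Omega>(1) by (intro open_Diff closed_UN) auto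
  moreover have "x0 \<in> W"
  proof -
    have "x0 \<notin> closure (C j)" if "j < N" "j \<noteq> i" for j
    proof
      assume "x0 \<in> closure (C j)"
      then have "setdist (closure (C i)) (closure (C j)) = 0" using i(2) by (intro setdist_eq_0I)
      then have "setdist (C i) (C j) = 0" by simp
      then show False using sep[OF i(1) that(1)] that(2) by simp
    qed
    then show ?thesis using x0 fK \<Omega>(2) unfolding W_def by blast
  qed
  ultimately obtain r1 where r1: "r1 > 0" "ball x0 r1 \<subseteq> W" by (rule openE)
  define r where "r = min r0 r1"
  have sub: "ball x0 r \<subseteq> ball x0 r0" "ball x0 r \<subseteq> W" using r1 unfolding r_def by auto
  have "C i \<inter> ball x0 r = {x \<in> ball x0 r. \<gamma> (x \<bullet> e1) < x \<bullet> e2}" using r0(6) sub(1) by blast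
  moreover have "frontier K \<inter> ball x0 r \<subseteq> closure (C i)"
  proof
    fix x assume x: "x \<in> frontier K \<inter> ball x0 r"
    then obtain j where "j < N" "x \<in> closure (C j)" using fK K' by blast
    then show "x \<in> closure (C i)" using x sub(2) unfolding W_def by (cases "j = i") auto
  qed
  moreover have "ball x0 r \<subseteq> \<Omega>" "r > 0" using sub(2) r0(1) r1(1) unfolding W_def r_def by auto
  ultimately show ?thesis using i(1) r0(2-5) by blast
qed

lemma W12_sq_uminus: "W12_sq U (\<lambda>x. (-1) * u x) (\<lambda>x. (-1) *\<^sub>R g x) = W12_sq U u g"
proof -
  have "(indicator U x * ((-1) * u x))\<^sup>2 = (indicator U x * u x)\<^sup>2"
    "norm (indicator U x *\<^sub>R ((-1) *\<^sub>R g x)) = norm (indicator U x *\<^sub>R g x)" for x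
    by (simp_all add: indicator_def)
  then show ?thesis unfolding W12_sq_def by (simp only:)
qed

text \<open>A partition of unity splits \<open>h\<close> into local pieces and a remainder \<open>(1 - P) h\<close> with \<open>P = 1\<close>
  on the boundary of \<open>K\<close>.  The continuous approximations \<open>\<psi>\<^sub>n\<close> serve the remainder, which reaches up to the
      outer
  boundary of \<open>G\<close>.\<close>

lemma vanishing_approx_complement:
  fixes C :: "nat \<Rightarrow> (real^2) set" and h :: "real^2 \<Rightarrow> real"
  assumes lip: "\<And>i. i < N \<Longrightarrow> lipschitz_domain (C i)"
    and sep: "\<And>i j. i < N \<Longrightarrow> j < N \<Longrightarrow> i \<noteq> j \<Longrightarrow> setdist (C i) (C j) > 0"
    and K: "K = closure (\<Union>i<N. C i)" "compact K" and \<Omega>: "open \<Omega>" "K \<subseteq> \<Omega>" and G: "G = \<Omega> - K"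
    and h: "sobolev \<Omega> h g" "\<And>x. x \<in> (\<Union>i<N. C i) \<Longrightarrow> h x = 0"
    and \<psi>: "\<And>n::nat. sobolev G (\<psi> n) (\<gamma> n)" "\<And>n. continuous_on (closure G) (\<psi> n)"
    and lim: "(\<lambda>n. W12_sq G (\<lambda>x. \<psi> n x - h x) (\<lambda>x. \<gamma> n x - g x)) \<longlonglongrightarrow> 0"
  shows "vanishing_approx G (frontier K) h g"
proof -
  have Go: "open G" "G \<subseteq> \<Omega>" using \<Omega>(1) compact_imp_closed[OF K(2)] unfolding G by (auto intro: open_Diff)
  have hG: "sobolev G h g" by (rule sobolev_restrict[OF h(1) Go(2,1)])
  have "\<exists>r>0. \<forall>p. test_function (ball x0 r) p \<longrightarrow>
      vanishing_approx G (frontier K) (\<lambda>x. p x * h x) (\<lambda>x. p x *\<^sub>R g x + h x *\<^sub>R grad p x)" if x0: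
          "x0 \<in> frontier K" for x0
  proof -
    obtain r i e1 e2 L and \<gamma> :: "real \<Rightarrow> real" where *: "r > 0" "i < N" "norm e1 = 1" "norm e2 = 1" "e1 \<bullet> e2
        = 0" "L-lipschitz_on UNIV \<gamma>"
      "C i \<inter> ball x0 r = {x \<in> ball x0 r. \<gamma> (x \<bullet> e1) < x \<bullet> e2}" "ball x0 r \<subseteq> \<Omega>"
          "frontier K \<inter> ball x0 r \<subseteq> closure (C i)"
    proof -
      have "\<exists>r>0. \<exists>i<N. \<exists>e1 e2 \<gamma> L. norm e1 = 1 \<and> norm e2 = 1 \<and> e1 \<bullet> e2 = 0 \<and> L-lipschitz_on UNIV \<gamma> \<and>
        C i \<inter> ball x0 r = {x \<in> ball x0 r. \<gamma> (x \<bullet> e1) < x \<bullet> e2} \<and> ball x0 r \<subseteq> \<Omega>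
            \<and> frontier K \<inter> ball x0 r \<subseteq> closure (C i)"
        by (rule lipschitz_domains_local_graph[OF _ _ K(1) \<Omega> x0]) (use lip sep in auto)
      then show thesis by (elim exE conjE) (rule that)
    qed
    have Ci: "open (C i)" using lip[OF *(2)] unfolding lipschitz_domain_def by blast
    have hC: "h x = 0" if "x \<in> C i" for x using h(2) that *(2) by blast
    show ?thesis
      using *(1) local_vanishing_approx[OF \<Omega>(1) Go h(1) hC Ci *(7,3-6,8,9)] by blast
  qed
  then have "\<forall>x0\<in>frontier K. \<exists>r. r > 0 \<and> (\<forall>p. test_function (ball x0 r) p \<longrightarrow>
      vanishing_approx G (frontier K) (\<lambda>x. p x * h x) (\<lambda>x. p x *\<^sub>R g x + h x *\<^sub>R grad p x))" by blast
  from bchoice[OF this] obtain r where r: "\<forall>x0\<in>frontier K. r x0 > 0"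
    "\<And>x0 p. x0 \<in> frontier K \<Longrightarrow> test_function (ball x0 (r x0)) p \<Longrightarrow>
      vanishing_approx G (frontier K) (\<lambda>x. p x * h x) (\<lambda>x. p x *\<^sub>R g x + h x *\<^sub>R grad p x)" by blast
  have cK: "compact (frontier K)" using compact_frontier[OF K(2)] .
  obtain I p V where I: "finite I" "I \<subseteq> frontier K" "frontier K \<subseteq> V" "\<forall>x\<in>I. test_function (ball x (r x)) (p x)"
     "\<forall>z\<in>V. (\<Sum>x\<in>I. p x z) = 1"
    using smooth_partition_of_unity[OF cK r(1)] by (elim exE conjE)
  define P where "P z = (\<Sum>x\<in>I. p x z)" for z
  have tp: "test_function UNIV (p x)" if "x \<in> I" for x
    using I(4) that test_function_mono[of _ "p x" UNIV] by blast
  have P: "test_function UNIV P" unfolding P_def[abs_def] by (rule test_function_sum[OF I(1) tp])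
  have gP: "grad P z = (\<Sum>x\<in>I. grad (p x) z)" for z
    unfolding P_def[abs_def] by (rule grad_sum[OF I(1)]) (use tp test_functionD(1) in blast)
  have local: "vanishing_approx G (frontier K) (\<lambda>z. \<Sum>x\<in>I. p x z * h z) (\<lambda>z. \<Sum>x\<in>I. p x z *\<^sub>R g z
      + h z *\<^sub>R grad (p x) z)"
    by (rule vanishing_approx_sum[OF I(1)]) (use I(2,4) r(2) in blast)
  \<comment> \<open>What is left after subtracting the local pieces is approximated by \<open>(1 - P) \<psi>\<^sub>n\<close>.\<close>
  have rest: "vanishing_approx G (frontier K) (\<lambda>z. h z - P z * h z) (\<lambda>z. g z - (P z *\<^sub>R g z
      + h z *\<^sub>R grad P z))"
    unfolding vanishing_approx_def
  proof (intro conjI allI impI)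
    note mult = sobolev_mult_test_function[OF _ P Go(1)]
    show "sobolev G (\<lambda>z. h z - P z * h z) (\<lambda>z. g z - (P z *\<^sub>R g z + h z *\<^sub>R grad P z))"
      by (rule sobolev_diff[OF hG mult[OF hG]])
    obtain B where B: "B \<ge> 0" "\<And>u g. sobolev G u g \<Longrightarrow> W12_sq G (\<lambda>x. P x * u x) (\<lambda>x. P x *\<^sub>R g x
        + u x *\<^sub>R grad P x) \<le> B * W12_sq G u g"
      using W12_sq_mult_test_function[OF P Go(1)] by blast
    fix \<epsilon> :: real assume "\<epsilon> > 0"
    then have "\<epsilon> / (2 + 2 * B) > 0" using B(1) by simp
    with order_tendstoD(2)[OF lim this] obtain n where n: "W12_sq G (\<lambda>x. \<psi> n x - h x) (\<lambda>x. \<gamma> n x - g x)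
        < \<epsilon> / (2 + 2 * B)"
      using eventually_happens'[OF sequentially_bot] by blast
    note d = sobolev_diff[OF \<psi>(1)[of n] hG]
    note Pd = mult[OF d]
    have "W12_sq G (\<lambda>x. (\<psi> n x - h x) + (-1) * (P x * (\<psi> n x - h x)))
        (\<lambda>x. (\<gamma> n x - g x) + (-1) *\<^sub>R (P x *\<^sub>R (\<gamma> n x - g x) + (\<psi> n x - h x) *\<^sub>R grad P x)) \<le>
      2 * W12_sq G (\<lambda>x. \<psi> n x - h x) (\<lambda>x. \<gamma> n x - g x) +
      2 * W12_sq G (\<lambda>x. P x * (\<psi> n x - h x)) (\<lambda>x. P x *\<^sub>R (\<gamma> n x - g x) + (\<psi> n x - h x) *\<^sub>R grad P x)"
      using W12_sq_add[OF d sobolev_cmult[OF Pd, of "-1"]] unfolding W12_sq_uminus .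
    also have "\<dots> < \<epsilon>" using B(2)[OF d] n B(1) by (simp add: field_simps)
    finally have close: "W12_sq G (\<lambda>x. (\<psi> n x - P x * \<psi> n x) - (h x - P x * h x))
        (\<lambda>x. (\<gamma> n x - (P x *\<^sub>R \<gamma> n x + \<psi> n x *\<^sub>R grad P x)) - (g x - (P x *\<^sub>R g x + h x *\<^sub>R grad P x))) < \<epsilon>"
      by (simp add: algebra_simps)
    have "continuous_on (closure G) P" using smooth_continuous[OF test_functionD(1)[OF P]] by
        (rule continuous_on_subset) simp
    then have "continuous_on (closure G) (\<lambda>x. \<psi> n x - P x * \<psi> n x)" using \<psi>(2)[of n] by
        (intro continuous_intros)
    moreover have "\<forall>x\<in>frontier K. \<psi> n x - P x * \<psi> n x = 0" using I(3,5) unfolding P_def by auto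
    ultimately show "\<exists>\<eta> \<gamma>'. sobolev G \<eta> \<gamma>' \<and> continuous_on (closure G) \<eta> \<and> (\<forall>x\<in>frontier K. \<eta> x = 0) \<and>
       W12_sq G (\<lambda>x. \<eta> x - (h x - P x * h x)) (\<lambda>x. \<gamma>' x - (g x - (P x *\<^sub>R g x + h x *\<^sub>R grad P x))) < \<epsilon>"
      using close sobolev_diff[OF \<psi>(1)[of n] mult[OF \<psi>(1)[of n]]] by blast
  qed
  have "(\<lambda>z. (\<Sum>x\<in>I. p x z * h z) + (h z - P z * h z)) = h"
    by (simp add: P_def sum_distrib_right)
  moreover have "(\<lambda>z. (\<Sum>x\<in>I. p x z *\<^sub>R g z + h z *\<^sub>R grad (p x) z) + (g z - (P z *\<^sub>R g z
      + h z *\<^sub>R grad P z))) = g"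
    unfolding gP by (simp add: P_def scaleR_sum_left scaleR_sum_right sum.distrib)
  ultimately show ?thesis using vanishing_approx_add[OF local rest] by simp
qed

section \<open>Traces\<close>

text \<open>The definition of the trace in terms of explicit gradients, which makes the algebra of \<open>W12_sq\<close>
  available.\<close>

lemma has_trace_sobolevD:
  assumes "has_trace U S u \<tau>" "open U" "sobolev U u g"
  shows "\<exists>\<phi> \<gamma>. (\<forall>n::nat. sobolev U (\<phi> n) (\<gamma> n) \<and> continuous_on (closure U) (\<phi> n)) \<and>
    (\<lambda>n. W12_sq U (\<lambda>x. \<phi> n x - u x) (\<lambda>x. \<gamma> n x - g x)) \<longlonglongrightarrow> 0 \<and>
    (\<lambda>n. \<integral>\<^sup>+x\<in>S. ennreal ((\<phi> n x - \<tau> x)\<^sup>2) \<partial>hausdorff1) \<longlonglongrightarrow> 0"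
proof -
  obtain \<phi> where \<phi>: "\<forall>n::nat. \<phi> n \<in> W1p 2 U \<and> continuous_on (closure U) (\<phi> n)"
    "(\<lambda>n. W1p_norm 2 U (\<lambda>x. \<phi> n x - u x)) \<longlonglongrightarrow> 0"
    "(\<lambda>n. \<integral>\<^sup>+x\<in>S. ennreal ((\<phi> n x - \<tau> x)\<^sup>2) \<partial>hausdorff1) \<longlonglongrightarrow> 0"
    using assms(1) unfolding has_trace_def by (elim exE conjE)
  have "\<forall>n. \<exists>\<gamma>. sobolev U (\<phi> n) \<gamma>" using \<phi>(1) W1p_2_iff by blast
  from choice[OF this] obtain \<gamma> where \<gamma>: "\<And>n. sobolev U (\<phi> n) (\<gamma> n)" by blast
  have "(\<lambda>n. (W1p_norm 2 U (\<lambda>x. \<phi> n x - u x))\<^sup>2) \<longlonglongrightarrow> 0\<^sup>2" by (intro tendsto_intros \<phi>(2))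
  then have "(\<lambda>n. W12_sq U (\<lambda>x. \<phi> n x - u x) (\<lambda>x. \<gamma> n x - g x)) \<longlonglongrightarrow> 0"
    unfolding W1p_norm_2_eq[OF assms(2) sobolev_diff[OF \<gamma> assms(3)]] by (simp add: W12_sq_nonneg)
  with \<phi> \<gamma> show ?thesis by blast
qed

lemma has_trace_sobolevI:
  assumes "open U" "sobolev U u g" "set_borel_measurable borel S \<tau>"
    "\<And>n::nat. sobolev U (\<phi> n) (\<gamma> n)" "\<And>n. continuous_on (closure U) (\<phi> n)"
    "(\<lambda>n. W12_sq U (\<lambda>x. \<phi> n x - u x) (\<lambda>x. \<gamma> n x - g x)) \<longlonglongrightarrow> 0"
    "(\<lambda>n. \<integral>\<^sup>+x\<in>S. ennreal ((\<phi> n x - \<tau> x)\<^sup>2) \<partial>hausdorff1) \<longlonglongrightarrow> 0"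
  shows "has_trace U S u \<tau>"
proof -
  have "(\<lambda>n. sqrt (W12_sq U (\<lambda>x. \<phi> n x - u x) (\<lambda>x. \<gamma> n x - g x))) \<longlonglongrightarrow> sqrt 0"
    using assms(6) by (rule tendsto_real_sqrt)
  then have "(\<lambda>n. W1p_norm 2 U (\<lambda>x. \<phi> n x - u x)) \<longlonglongrightarrow> 0"
    unfolding W1p_norm_2_eq[OF assms(1) sobolev_diff[OF assms(4) assms(2)]] by simp
  moreover have "u \<in> W1p 2 U" "\<And>n. \<phi> n \<in> W1p 2 U" using assms(2,4) W1p_2_iff by blast+
  ultimately show ?thesis using assms(3,5,7) unfolding has_trace_def by blast
qed

context truncation
begin

lemma set_borel_measurable_compose:
  assumes "set_borel_measurable borel S \<tau>"
  shows "set_borel_measurable borel S (\<lambda>x. \<beta> (\<tau> x))"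
proof -
  have "indicator S x *\<^sub>R \<beta> (\<tau> x) = \<beta> (indicator S x *\<^sub>R \<tau> x)" for x
    using at_0 by (simp add: indicator_def)
  then show ?thesis
    using assms measurable_compose[OF _ measurable_\<beta>] unfolding set_borel_measurable_def by simp
qed

lemma nn_integral_compose_tendsto:
  assumes "(\<lambda>n::nat. \<integral>\<^sup>+x\<in>S. ennreal ((\<phi> n x - \<tau> x)\<^sup>2) \<partial>M) \<longlonglongrightarrow> 0"
  shows "(\<lambda>n. \<integral>\<^sup>+x\<in>S. ennreal ((\<beta> (\<phi> n x) - \<beta> (\<tau> x))\<^sup>2) \<partial>M) \<longlonglongrightarrow> 0"
proof (rule tendsto_sandwich[OF _ _ tendsto_const assms])
  show "\<forall>\<^sub>F n in sequentially. (\<integral>\<^sup>+x\<in>S. ennreal ((\<beta> (\<phi> n x) - \<beta> (\<tau> x))\<^sup>2) \<partial>M) \<le> (\<integral>\<^sup>+x\<in>S. ennreal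
      ((\<phi> n x - \<tau> x)\<^sup>2) \<partial>M)"
    using lipschitz by (intro always_eventually allI nn_integral_mono mult_right_mono ennreal_leI)
        (auto simp: abs_le_square_iff)
qed simp

lemma has_trace_compose:
  assumes tr: "has_trace U S u \<tau>" and U: "open U"
  shows "has_trace U S (\<lambda>x. \<beta> (u x)) (\<lambda>x. \<beta> (\<tau> x))"
proof -
  have "u \<in> W1p 2 U" and \<tau>: "set_borel_measurable borel S \<tau>" using tr unfolding has_trace_def by auto
  then obtain g where g: "sobolev U u g" using W1p_2_iff by blast
  obtain \<phi> \<gamma> where *: "\<And>n::nat. sobolev U (\<phi> n) (\<gamma> n)" "\<And>n. continuous_on (closure U) (\<phi> n)"
    "(\<lambda>n. W12_sq U (\<lambda>x. \<phi> n x - u x) (\<lambda>x. \<gamma> n x - g x)) \<longlonglongrightarrow> 0"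
    "(\<lambda>n. \<integral>\<^sup>+x\<in>S. ennreal ((\<phi> n x - \<tau> x)\<^sup>2) \<partial>hausdorff1) \<longlonglongrightarrow> 0"
    using has_trace_sobolevD[OF tr U g] by auto
  obtain r :: "nat \<Rightarrow> nat" where r: "strict_mono r"
    "(\<lambda>n. W12_sq U (\<lambda>x. \<beta> (\<phi> (r n) x) - \<beta> (u x)) (\<lambda>x. \<beta>' (\<phi> (r n) x) *\<^sub>R \<gamma> (r n) x - \<beta>' (u x) *\<^sub>R g x)) \<longlonglongrightarrow> 0"
    using compose_tendsto[OF U g *(1,3)] by blast
  have "(\<lambda>n. \<integral>\<^sup>+x\<in>S. ennreal ((\<phi> (r n) x - \<tau> x)\<^sup>2) \<partial>hausdorff1) \<longlonglongrightarrow> 0"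
    using LIMSEQ_subseq_LIMSEQ[OF *(4) r(1)] by (simp add: o_def)
  note nn = nn_integral_compose_tendsto[OF this]
  show ?thesis
    by (rule has_trace_sobolevI[OF U sobolev_chain_rule[OF g U] set_borel_measurable_compose[OF \<tau>]
          sobolev_chain_rule[OF *(1) U] continuous_on_compose2[OF cont *(2)] r(2) nn]) simp
qed

text \<open>If \<open>f - \<beta> (f)\<close> can be approximated by functions vanishing on \<open>S\<close>, adding these to the truncated
  approximations of \<open>f\<close> shows that \<open>f\<close> itself has the truncated trace.\<close>

lemma has_trace_truncated:
  assumes tr: "has_trace U S f \<tau>" and U: "open U" and f: "sobolev U f g"
    and van: "vanishing_approx U S (\<lambda>x. f x - \<beta> (f x)) (\<lambda>x. g x - \<beta>' (f x) *\<^sub>R g x)"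
  shows "has_trace U S f (\<lambda>x. \<beta> (\<tau> x))"
proof -
  have \<tau>: "set_borel_measurable borel S \<tau>" using tr unfolding has_trace_def by auto
  note \<beta>f = sobolev_chain_rule[OF f U]
  obtain \<phi> \<gamma> where *: "\<And>n::nat. sobolev U (\<phi> n) (\<gamma> n)" "\<And>n. continuous_on (closure U) (\<phi> n)"
    "(\<lambda>n. W12_sq U (\<lambda>x. \<phi> n x - \<beta> (f x)) (\<lambda>x. \<gamma> n x - \<beta>' (f x) *\<^sub>R g x)) \<longlonglongrightarrow> 0"
    "(\<lambda>n. \<integral>\<^sup>+x\<in>S. ennreal ((\<phi> n x - \<beta> (\<tau> x))\<^sup>2) \<partial>hausdorff1) \<longlonglongrightarrow> 0"
    using has_trace_sobolevD[OF has_trace_compose[OF tr U] U \<beta>f] by auto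
  have "\<forall>n. \<exists>\<eta> \<gamma>'. sobolev U \<eta> \<gamma>' \<and> continuous_on (closure U) \<eta> \<and> (\<forall>x\<in>S. \<eta> x = 0) \<and>
       W12_sq U (\<lambda>x. \<eta> x - (f x - \<beta> (f x))) (\<lambda>x. \<gamma>' x - (g x - \<beta>' (f x) *\<^sub>R g x)) < inverse (real (Suc n))"
    using van unfolding vanishing_approx_def by simp
  then obtain \<eta> \<gamma>' where \<eta>: "\<And>n. sobolev U (\<eta> n) (\<gamma>' n)" "\<And>n. continuous_on (closure U) (\<eta> n)" "\<And>n x. x \<in> S
      \<Longrightarrow> \<eta> n x = 0"
       "\<And>n. W12_sq U (\<lambda>x. \<eta> n x - (f x - \<beta> (f x))) (\<lambda>x. \<gamma>' n x - (g x - \<beta>' (f x) *\<^sub>R g x)) < inverse (real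
           (Suc n))"
    by (metis (no_types))
  define a where "a n = W12_sq U (\<lambda>x. \<phi> n x - \<beta> (f x)) (\<lambda>x. \<gamma> n x - \<beta>' (f x) *\<^sub>R g x)" for n
  define b where "b n = W12_sq U (\<lambda>x. \<eta> n x - (f x - \<beta> (f x))) (\<lambda>x. \<gamma>' n x - (g x - \<beta>' (f x) *\<^sub>R g x))" for n
  have "b \<longlonglongrightarrow> 0"
    by (rule tendsto_sandwich[OF _ _ tendsto_const LIMSEQ_inverse_real_of_nat])
      (use \<eta>(4) in \<open>auto intro!: always_eventually W12_sq_nonneg less_imp_le simp: b_def simp del: of_nat_Suc\<close>)
  then have "(\<lambda>n. 2 * a n + 2 * b n) \<longlonglongrightarrow> 2 * 0 + 2 * 0"
    unfolding a_def by (intro tendsto_intros *(3))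
  then have up: "(\<lambda>n. 2 * a n + 2 * b n) \<longlonglongrightarrow> 0" by simp
  have bound: "W12_sq U (\<lambda>x. (\<phi> n x + \<eta> n x) - f x) (\<lambda>x. (\<gamma> n x + \<gamma>' n x) - g x) \<le> 2 * a n + 2 * b n" for n
    using W12_sq_add[OF sobolev_diff[OF *(1)[of n] \<beta>f] sobolev_diff[OF \<eta>(1)[of n] sobolev_diff[OF f \<beta>f]]]
    unfolding a_def b_def by (simp add: algebra_simps)
  have lim: "(\<lambda>n. W12_sq U (\<lambda>x. (\<phi> n x + \<eta> n x) - f x) (\<lambda>x. (\<gamma> n x + \<gamma>' n x) - g x)) \<longlonglongrightarrow> 0"
    by (rule tendsto_sandwich[OF _ _ tendsto_const up]) (auto intro!: always_eventually bound W12_sq_nonneg)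
  have "(\<integral>\<^sup>+x\<in>S. ennreal (((\<phi> n x + \<eta> n x) - \<beta> (\<tau> x))\<^sup>2) \<partial>hausdorff1) = (\<integral>\<^sup>+x\<in>S. ennreal ((\<phi> n x - \<beta>
      (\<tau> x))\<^sup>2) \<partial>hausdorff1)" for n
    by (rule nn_integral_cong) (use \<eta>(3) in \<open>auto simp: indicator_def\<close>)
  then have nn: "(\<lambda>n. \<integral>\<^sup>+x\<in>S. ennreal (((\<phi> n x + \<eta> n x) - \<beta> (\<tau> x))\<^sup>2) \<partial>hausdorff1) \<longlonglongrightarrow> 0"
    using *(4) by simp
  show ?thesis
    by (rule has_trace_sobolevI[OF U f set_borel_measurable_compose[OF \<tau>] sobolev_add[OF *(1) \<eta>(1)]
          continuous_on_add[OF *(2) \<eta>(2)] lim nn])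
qed

end

section \<open>The energy and its minimisers\<close>

lemma quadratic_form_measurable:
  fixes A :: "real^'n \<Rightarrow> real^'n^'n" and q :: "real^'n \<Rightarrow> real^'n"
  assumes "continuous_on UNIV A" "q \<in> borel_measurable lebesgue"
  shows "(\<lambda>x. (A x *v q x) \<bullet> q x) \<in> borel_measurable lebesgue"
proof -
  have [measurable]: "(\<lambda>x. q x $ i) \<in> borel_measurable lebesgue" for i
    using measurable_compose[OF assms(2) borel_measurable_continuous_onI[of "\<lambda>v. v $ i"]]
    by (simp add: continuous_on_component)
  have [measurable]: "(\<lambda>x. A x $ i $ j) \<in> borel_measurable lebesgue" for i j
    using assms(1) by (intro measurable_completion) (simp add: borel_measurable_continuous_onI
        continuous_on_component)
  have "(\<lambda>x. (A x *v q x) \<bullet> q x) = (\<lambda>x. \<Sum>i\<in>UNIV. (\<Sum>j\<in>UNIV. A x $ i $ j * q x $ j) * q x $ i)"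
    by (simp add: inner_vec_def matrix_vector_mult_def)
  then show ?thesis by simp
qed

text \<open>The integrand of \<open>J\<^sub>w\<close> for a fixed \<open>w\<close>.  Its measurability rests on the continuity of the gradient of the
  smoothed function.\<close>

locale diffusion =
  fixes D :: "real^2 \<Rightarrow> real^2^2" and \<sigma> c1 c2 lam :: real and G :: "(real^2) set" and w :: "real^2 \<Rightarrow> real"
  assumes D: "continuous_on UNIV D" and \<sigma>: "\<sigma> > 0" and c1: "c1 > 0" and lam: "lam > 0"
    and lower: "\<And>p q. c1 * (1 + (norm p)\<^sup>2 / lam\<^sup>2) powr (- 1 / 2) * (norm q)\<^sup>2 \<le> (D p *v q) \<bullet> q"
    and upper: "\<And>p q. (D p *v q) \<bullet> q \<le> c2 * (norm q)\<^sup>2"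
    and open_G: "open G" and w: "set_integrable lebesgue G w"
begin

abbreviation A :: "real^2 \<Rightarrow> real^2^2" where
  "A x \<equiv> D (grad (smoothed \<sigma> G w) x)"

lemma A_continuous: "continuous_on UNIV A"
  by (rule continuous_on_compose2[OF D smoothed_gradient_continuous[OF \<sigma> w]]) simp

lemma form_nonneg: "0 \<le> (A x *v q) \<bullet> q"
  by (rule order_trans[OF _ lower]) (use c1 in \<open>auto intro!: mult_nonneg_nonneg\<close>)

lemma form_eq:
  "indicator G x *\<^sub>R ((A x *v g x) \<bullet> g x) = (A x *v (indicator G x *\<^sub>R g x)) \<bullet> (indicator G x *\<^sub>R g x)"
  by (auto simp: indicator_def)

lemma form_integrable:
  assumes "sobolev G v g"
  shows "integrable lebesgue (\<lambda>x. indicator G x *\<^sub>R ((A x *v g x) \<bullet> g x))"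
  unfolding form_eq
proof (rule Bochner_Integration.integrable_bound)
  note S = sobolevD(2)[OF assms]
  show "integrable lebesgue (\<lambda>x. c2 * (norm (indicator G x *\<^sub>R g x))\<^sup>2)"
    using square_integrableD(2)[OF S] by (rule integrable_mult_right)
  show "(\<lambda>x. (A x *v (indicator G x *\<^sub>R g x)) \<bullet> (indicator G x *\<^sub>R g x)) \<in> borel_measurable lebesgue"
    by (rule quadratic_form_measurable[OF A_continuous square_integrableD(1)[OF S]])
  show "AE x in lebesgue. norm ((A x *v (indicator G x *\<^sub>R g x)) \<bullet> (indicator G x *\<^sub>R g x)) \<le> norm (c2 *
      (norm (indicator G x *\<^sub>R g x))\<^sup>2)"
  proof (rule AE_I2)
    fix x
    show "norm ((A x *v (indicator G x *\<^sub>R g x)) \<bullet> (indicator G x *\<^sub>R g x)) \<le> norm (c2 * (norm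
        (indicator G x *\<^sub>R g x))\<^sup>2)"
      using form_nonneg[of x "indicator G x *\<^sub>R g x"] upper[of "grad (smoothed \<sigma> G w) x"
          "indicator G x *\<^sub>R g x"]
      unfolding real_norm_def by linarith
  qed
qed

lemma energy_eq:
  assumes "sobolev G v g"
  shows "energy D \<sigma> G w v = (LINT x|lebesgue. indicator G x *\<^sub>R ((A x *v g x) \<bullet> g x))"
  unfolding energy_def set_lebesgue_integral_def
proof (rule integral_cong_AE)
  have "v \<in> W1p 2 G" using assms W1p_2_iff by blast
  from form_integrable[OF sobolev_wgrad[OF open_G this]]
  show "(\<lambda>x. indicator G x *\<^sub>R ((A x *v wgrad G v x) \<bullet> wgrad G v x)) \<in> borel_measurable lebesgue"
    by (rule borel_measurable_integrable)
  show "(\<lambda>x. indicator G x *\<^sub>R ((A x *v g x) \<bullet> g x)) \<in> borel_measurable lebesgue"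
    using form_integrable[OF assms] by (rule borel_measurable_integrable)
  show "AE x in lebesgue. indicator G x *\<^sub>R ((A x *v wgrad G v x) \<bullet> wgrad G v x) = indicator G x *\<^sub>R
      ((A x *v g x) \<bullet> g x)"
    using wgrad_eq[OF open_G assms] by (rule eventually_mono) (auto simp: indicator_def)
qed

text \<open>The gradient is multiplied by \<open>\<beta>' (u)\<close>, so the quadratic form is multiplied by a factor at most \<open>1\<close>.\<close>

lemma energy_compose_le:
  assumes "truncation \<beta> \<beta>'" and u: "sobolev G u g"
  shows "energy D \<sigma> G w (\<lambda>x. \<beta> (u x)) \<le> energy D \<sigma> G w u"
  unfolding energy_eq[OF u] energy_eq[OF truncation.sobolev_chain_rule[OF assms open_G]]
proof (rule integral_mono_AE')
  interpret truncation \<beta> \<beta>' by fact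
  show "integrable lebesgue (\<lambda>x. indicator G x *\<^sub>R ((A x *v g x) \<bullet> g x))" by (rule form_integrable[OF u])
  show "AE x in lebesgue. indicator G x *\<^sub>R ((A x *v (\<beta>' (u x) *\<^sub>R g x)) \<bullet> (\<beta>' (u x) *\<^sub>R g x))
      \<le> indicator G x *\<^sub>R ((A x *v g x) \<bullet> g x)"
  proof (rule AE_I2)
    fix x
    have "(\<beta>' (u x))\<^sup>2 \<le> 1" using deriv_le_1[of "u x"] by (simp add: abs_square_le_1)
    then have "(\<beta>' (u x))\<^sup>2 * ((A x *v g x) \<bullet> g x) \<le> 1 * ((A x *v g x) \<bullet> g x)"
      by (intro mult_right_mono form_nonneg)
    moreover have "(A x *v (\<beta>' (u x) *\<^sub>R g x)) \<bullet> (\<beta>' (u x) *\<^sub>R g x) = (\<beta>' (u x))\<^sup>2 * ((A x *v g x) \<bullet> g x)"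
      by (simp add: matrix_vector_mult_scaleR power2_eq_square)
    ultimately show "indicator G x *\<^sub>R ((A x *v (\<beta>' (u x) *\<^sub>R g x)) \<bullet> (\<beta>' (u x) *\<^sub>R g x))
        \<le> indicator G x *\<^sub>R ((A x *v g x) \<bullet> g x)"
      by (simp add: indicator_def)
  qed
qed (auto intro!: AE_I2 mult_nonneg_nonneg form_nonneg)

lemma energy_le:
  assumes "sobolev G v g"
  shows "energy D \<sigma> G w v \<le> c2 * (LINT x|lebesgue. (norm (indicator G x *\<^sub>R g x))\<^sup>2)"
proof -
  have "energy D \<sigma> G w v \<le> (LINT x|lebesgue. c2 * (norm (indicator G x *\<^sub>R g x))\<^sup>2)"
    unfolding energy_eq[OF assms]
  proof (rule integral_mono)
    show "integrable lebesgue (\<lambda>x. c2 * (norm (indicator G x *\<^sub>R g x))\<^sup>2)"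
      using square_integrableD(2)[OF sobolevD(2)[OF assms]] by (rule integrable_mult_right)
    show "indicator G x *\<^sub>R ((A x *v g x) \<bullet> g x) \<le> c2 * (norm (indicator G x *\<^sub>R g x))\<^sup>2" for x
      unfolding form_eq by (rule upper)
  qed (rule form_integrable[OF assms])
  then show ?thesis by simp
qed

text \<open>A bound \<open>M\<close> on the smoothed gradient turns the degenerate ellipticity into a uniform one.\<close>

lemma energy_ge:
  assumes v: "sobolev G v g" and M: "\<And>x. norm (grad (smoothed \<sigma> G w) x) \<le> M"
  shows "c1 * (1 + M\<^sup>2 / lam\<^sup>2) powr (- 1 / 2) * (LINT x|lebesgue. (norm (indicator G x *\<^sub>R g x))\<^sup>2)
      \<le> energy D \<sigma> G w v"
proof -
  define c where "c = c1 * (1 + M\<^sup>2 / lam\<^sup>2) powr (- 1 / 2)"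
  have "(LINT x|lebesgue. c * (norm (indicator G x *\<^sub>R g x))\<^sup>2) \<le> energy D \<sigma> G w v"
    unfolding energy_eq[OF v]
  proof (rule integral_mono)
    show "integrable lebesgue (\<lambda>x. c * (norm (indicator G x *\<^sub>R g x))\<^sup>2)"
      using square_integrableD(2)[OF sobolevD(2)[OF v]] by (rule integrable_mult_right)
    fix x
    define p where "p = grad (smoothed \<sigma> G w) x"
    have "(norm p)\<^sup>2 \<le> M\<^sup>2" using M[of x] unfolding p_def by (intro power_mono) auto
    then have "1 + (norm p)\<^sup>2 / lam\<^sup>2 \<le> 1 + M\<^sup>2 / lam\<^sup>2" by (intro add_left_mono divide_right_mono) auto
    then have "(1 + M\<^sup>2 / lam\<^sup>2) powr (- 1 / 2) \<le> (1 + (norm p)\<^sup>2 / lam\<^sup>2) powr (- 1 / 2)"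
      by (intro powr_mono2') (auto intro: add_pos_nonneg)
    then have "c \<le> c1 * (1 + (norm p)\<^sup>2 / lam\<^sup>2) powr (- 1 / 2)" using c1 unfolding c_def by simp
    then have "c * (norm (indicator G x *\<^sub>R g x))\<^sup>2 \<le> c1 * (1 + (norm p)\<^sup>2 / lam\<^sup>2) powr (- 1 / 2) * (norm
        (indicator G x *\<^sub>R g x))\<^sup>2"
      by (rule mult_right_mono) simp
    also have "\<dots> \<le> indicator G x *\<^sub>R ((A x *v g x) \<bullet> g x)" unfolding form_eq p_def by (rule lower)
    finally show "c * (norm (indicator G x *\<^sub>R g x))\<^sup>2 \<le> indicator G x *\<^sub>R ((A x *v g x) \<bullet> g x)" .
  qed (rule form_integrable[OF v])
  then show ?thesis unfolding c_def by simp
qed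

end

section \<open>Boundedness of the fixed points\<close>

text \<open>The difference \<open>f - \<beta> (f)\<close> vanishes on each \<open>C\<^sub>i\<close>.  Its approximations that are continuous up
  to the boundary of \<open>G\<close> come from those that define the trace of \<open>f\<close>.\<close>

lemma (in truncation) vanishing_approx_truncation_defect:
  fixes C :: "nat \<Rightarrow> (real^2) set" and f :: "real^2 \<Rightarrow> real"
  assumes lip: "\<And>i. i < N \<Longrightarrow> lipschitz_domain (C i)"
    and sep: "\<And>i j. i < N \<Longrightarrow> j < N \<Longrightarrow> i \<noteq> j \<Longrightarrow> setdist (C i) (C j) > 0"
    and K: "K = closure (\<Union>i<N. C i)" "compact K" and \<Omega>: "open \<Omega>" "K \<subseteq> \<Omega>" and G: "G = \<Omega> - K"
    and f: "sobolev \<Omega> f g" "\<And>x. x \<in> (\<Union>i<N. C i) \<Longrightarrow> \<beta> (f x) = f x"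
    and tr: "has_trace G S f \<tau>"
  shows "vanishing_approx G (frontier K) (\<lambda>x. f x - \<beta> (f x)) (\<lambda>x. g x - \<beta>' (f x) *\<^sub>R g x)"
proof -
  have Go: "open G" "G \<subseteq> \<Omega>" using \<Omega>(1) compact_imp_closed[OF K(2)] unfolding G by (auto intro: open_Diff)
  have fG: "sobolev G f g" by (rule sobolev_restrict[OF f(1) Go(2,1)])
  obtain \<psi> \<gamma> where \<psi>: "\<And>n::nat. sobolev G (\<psi> n) (\<gamma> n)" "\<And>n. continuous_on (closure G) (\<psi> n)"
    "(\<lambda>n. W12_sq G (\<lambda>x. \<psi> n x - f x) (\<lambda>x. \<gamma> n x - g x)) \<longlonglongrightarrow> 0"
    using has_trace_sobolevD[OF tr Go(1) fG] by auto
  obtain r :: "nat \<Rightarrow> nat" where r: "strict_mono r"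
    "(\<lambda>n. W12_sq G (\<lambda>x. \<beta> (\<psi> (r n) x) - \<beta> (f x)) (\<lambda>x. \<beta>' (\<psi> (r n) x) *\<^sub>R \<gamma> (r n) x - \<beta>' (f x) *\<^sub>R g x)) \<longlonglongrightarrow> 0"
    using compose_tendsto[OF Go(1) fG \<psi>(1,3)] by blast
  have lim1: "(\<lambda>n. W12_sq G (\<lambda>x. \<psi> (r n) x - f x) (\<lambda>x. \<gamma> (r n) x - g x)) \<longlonglongrightarrow> 0"
    using LIMSEQ_subseq_LIMSEQ[OF \<psi>(3) r(1)] by (simp add: o_def)
  show ?thesis
  proof (rule vanishing_approx_complement[OF lip sep K \<Omega> G])
    show "sobolev \<Omega> (\<lambda>x. f x - \<beta> (f x)) (\<lambda>x. g x - \<beta>' (f x) *\<^sub>R g x)"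
      by (rule sobolev_diff[OF f(1) sobolev_chain_rule[OF f(1) \<Omega>(1)]])
    show "f x - \<beta> (f x) = 0" if "x \<in> (\<Union>i<N. C i)" for x using f(2)[OF that] by simp
    show "sobolev G (\<lambda>x. \<psi> (r n) x - \<beta> (\<psi> (r n) x)) (\<lambda>x. \<gamma> (r n) x - \<beta>' (\<psi> (r n) x) *\<^sub>R \<gamma> (r n) x)" for n
      by (rule sobolev_diff[OF \<psi>(1) sobolev_chain_rule[OF \<psi>(1) Go(1)]])
    show "continuous_on (closure G) (\<lambda>x. \<psi> (r n) x - \<beta> (\<psi> (r n) x))" for n
      by (rule continuous_on_diff[OF \<psi>(2) continuous_on_compose2[OF cont \<psi>(2)]]) simp
    define a where "a n = W12_sq G (\<lambda>x. \<psi> (r n) x - f x) (\<lambda>x. \<gamma> (r n) x - g x)" for n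
    define b where "b n = W12_sq G (\<lambda>x. \<beta> (\<psi> (r n) x) - \<beta> (f x)) (\<lambda>x. \<beta>' (\<psi> (r n) x) *\<^sub>R \<gamma> (r n) x - \<beta>'
        (f x) *\<^sub>R g x)" for n
    have bound: "W12_sq G (\<lambda>x. (\<psi> (r n) x - \<beta> (\<psi> (r n) x)) - (f x - \<beta> (f x)))
       (\<lambda>x. (\<gamma> (r n) x - \<beta>' (\<psi> (r n) x) *\<^sub>R \<gamma> (r n) x) - (g x - \<beta>' (f x) *\<^sub>R g x)) \<le> 2 * a n + 2 * b n" for n
    proof -
      note d = sobolev_diff[OF sobolev_chain_rule[OF \<psi>(1)[of "r n"] Go(1)] sobolev_chain_rule[OF fG Go(1)]]
      show ?thesis
        using W12_sq_add[OF sobolev_diff[OF \<psi>(1)[of "r n"] fG] sobolev_cmult[OF d, of "-1"]]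
        unfolding W12_sq_uminus a_def b_def by (simp add: algebra_simps)
    qed
    have "(\<lambda>n. 2 * a n + 2 * b n) \<longlonglongrightarrow> 2 * 0 + 2 * 0"
      unfolding a_def b_def by (intro tendsto_intros lim1 r(2))
    then have up: "(\<lambda>n. 2 * a n + 2 * b n) \<longlonglongrightarrow> 0" by simp
    show "(\<lambda>n. W12_sq G (\<lambda>x. (\<psi> (r n) x - \<beta> (\<psi> (r n) x)) - (f x - \<beta> (f x)))
       (\<lambda>x. (\<gamma> (r n) x - \<beta>' (\<psi> (r n) x) *\<^sub>R \<gamma> (r n) x) - (g x - \<beta>' (f x) *\<^sub>R g x))) \<longlonglongrightarrow> 0"
      by (rule tendsto_sandwich[OF _ _ tendsto_const up]) (auto intro!: always_eventually bound W12_sq_nonneg)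
  qed
qed

theorem proposition3p1:
  fixes \<Omega> K G :: "(real^2) set" and C :: "nat \<Rightarrow> (real^2) set" and N :: nat
    and f :: "real^2 \<Rightarrow> real" and D :: "real^2 \<Rightarrow> real^2^2"
    and lam c1 c2 \<sigma> :: real
  assumes "lipschitz_domain \<Omega>"
    and "N \<ge> 1"
    and "\<And>i. i < N \<Longrightarrow> lipschitz_domain (C i) \<and> C i \<subseteq> \<Omega> \<and> C i \<noteq> \<Omega>"
    and "\<And>i j. i < N \<Longrightarrow> j < N \<Longrightarrow> i \<noteq> j \<Longrightarrow> C i \<inter> C j = {} \<and> setdist (C i) (C j) > 0"
    and "K = closure (\<Union>i<N. C i)"
    and "compact K" and "K \<subseteq> \<Omega>"
    and "G = \<Omega> - K"
    and "f \<in> W1p 2 (\<Union>i<N. C i)"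
    and "\<And>x. x \<in> (\<Union>i<N. C i) \<Longrightarrow> 0 \<le> f x \<and> f x \<le> 1"
    and "f \<in> W1p 2 \<Omega>"
    and "continuous_on UNIV D"
    and "\<And>p. transpose (D p) = D p"
    and "lam > 0" and "c1 > 0" and "c2 > 0"
    and "\<And>p q. c1 * (1 + (norm p)\<^sup>2 / lam\<^sup>2) powr (- 1 / 2) * (norm q)\<^sup>2 \<le> (D p *v q) \<bullet> q"
    and "\<And>p q. (D p *v q) \<bullet> q \<le> c2 * (norm q)\<^sup>2"
    and "\<sigma> > 0"
  shows "bounded_in_W1p 2 G (T_fixed_points D \<sigma> G K f)"
proof -
  have \<Omega>: "open \<Omega>" "bounded \<Omega>" using assms(1) unfolding lipschitz_domain_def by auto
  have G: "open G" "G \<subseteq> \<Omega>" using \<Omega>(1) compact_imp_closed[OF assms(6)] unfolding assms(8) by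
      (auto intro: open_Diff)
  have bG: "bounded G" using bounded_subset[OF \<Omega>(2) G(2)] .
  have fin: "emeasure lebesgue G < \<infinity>" using emeasure_bounded_finite[OF bG] G(1) by simp
  have GL: "G \<in> sets lebesgue" using G(1) by simp
  have sf: "sobolev \<Omega> f (wgrad \<Omega> f)" by (rule sobolev_wgrad[OF \<Omega>(1) assms(11)])
  define gf where "gf = wgrad \<Omega> f"
  have sfG: "sobolev G f gf" unfolding gf_def by (rule sobolev_restrict[OF sf G(2,1)])
  define Ef where "Ef = (LINT x|lebesgue. (norm (indicator G x *\<^sub>R gf x))\<^sup>2)"
  \<comment> \<open>The bound on the smoothed gradient of any \<open>u\<close> with \<open>\<bar>u\<bar> \<le> 3\<close>, where \<open>3\<close> is the bound on \<open>trunc\<close>;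
    \<open>c\<close> is the resulting ellipticity constant.\<close>
  define M where "M = 1 / (pi * \<sigma> ^ 3) * (3 * measure lebesgue G)"
  define c where "c = c1 * (1 + M\<^sup>2 / lam\<^sup>2) powr (- 1 / 2)"
  have c: "c > 0"
  proof -
    have "1 + M\<^sup>2 / lam\<^sup>2 > 0" by (intro add_pos_nonneg) auto
    then show ?thesis using assms(15) unfolding c_def by simp
  qed
  have main: "u \<in> W1p 2 G \<and> W1p_norm 2 G u \<le> sqrt (9 * measure lebesgue G + c2 * Ef / c)"
    if u: "u \<in> T_fixed_points D \<sigma> G K f" for u
  proof -
    have u1: "u \<in> W1p 1 G" and umin: "u \<in> minimisers D \<sigma> G K f u"
      and uniq: "\<And>v. v \<in> minimisers D \<sigma> G K f u \<Longrightarrow> AE x in lebesgue. x \<in> G \<longrightarrow> v x = u x"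
      using u unfolding T_fixed_points_def T_eq_def by auto
    have uL1: "set_integrable lebesgue G u"
    proof -
      have "set_borel_measurable lebesgue G u" "set_integrable lebesgue G (\<lambda>x. norm (u x) ^ 1)"
        using u1 unfolding W1p_def L_p_def by auto
      then show ?thesis
        unfolding set_borel_measurable_def set_integrable_def
        by (intro Bochner_Integration.integrable_bound[of lebesgue "\<lambda>x. indicator G x *\<^sub>R norm (u x) ^ 1"
            "\<lambda>x. indicator G x *\<^sub>R u x"])
            (auto simp: abs_mult)
    qed
    have uad: "u \<in> admissible G K f" and ule: "\<And>v. v \<in> admissible G K f \<Longrightarrow> energy D \<sigma> G u u \<le> energy D \<sigma> G u v"
      using umin unfolding minimisers_def by auto
    obtain \<tau> where \<tau>: "has_trace G (frontier K) u \<tau>" "has_trace G (frontier K) f \<tau>"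
      and u2: "u \<in> W1p 2 G" using uad unfolding admissible_def trace_eq_def by auto
    define gu where "gu = wgrad G u"
    have su: "sobolev G u gu" unfolding gu_def by (rule sobolev_wgrad[OF G(1) u2])
    interpret diffusion D \<sigma> c1 c2 lam G u
      by unfold_locales (use assms(12,14,15,17,18,19) G(1) uL1 in auto)
    have van: "vanishing_approx G (frontier K) (\<lambda>x. f x - trunc (f x)) (\<lambda>x. gf x - trunc' (f x) *\<^sub>R gf x)"
    proof (rule trunc.vanishing_approx_truncation_defect[OF _ _ assms(5,6) \<Omega>(1) assms(7,8) sf[folded gf_def]
        _ \<tau>(2)])
      show "trunc (f x) = f x" if "x \<in> (\<Union>i<N. C i)" for x using assms(10)[OF that] by (simp add: trunc_eq)
    qed (use assms(3,4) in auto)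
    \<comment> \<open>The truncation of \<open>u\<close> is a second minimiser, hence equal to \<open>u\<close>; this bounds \<open>u\<close> by \<open>3\<close>.\<close>
    define v where "v x = trunc (u x)" for x
    have vad: "v \<in> admissible G K f"
      unfolding admissible_def trace_eq_def
    proof (intro CollectI conjI exI)
      show "has_trace G (frontier K) v (\<lambda>x. trunc (\<tau> x))"
        unfolding v_def[abs_def] by (rule trunc.has_trace_compose[OF \<tau>(1) G(1)])
      then show "v \<in> W1p 2 G" unfolding has_trace_def by blast
      show "has_trace G (frontier K) f (\<lambda>x. trunc (\<tau> x))"
        by (rule trunc.has_trace_truncated[OF \<tau>(2) G(1) sfG van])
    qed
    have "energy D \<sigma> G u v \<le> energy D \<sigma> G u u"
      unfolding v_def[abs_def] by (rule energy_compose_le[OF trunc.truncation_axioms su])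
    then have "v \<in> minimisers D \<sigma> G K f u"
      using vad ule unfolding minimisers_def by (auto intro: order_trans)
    from uniq[OF this] have ub: "AE x in lebesgue. \<bar>indicator G x * u x\<bar> \<le> 3 * indicator G x"
    proof (rule eventually_mono)
      fix x assume "x \<in> G \<longrightarrow> v x = u x"
      then show "\<bar>indicator G x * u x\<bar> \<le> 3 * indicator G x"
        using trunc_bounded[of "u x"] by (cases "x \<in> G") (auto simp: v_def)
    qed
    have iG: "integrable lebesgue (\<lambda>x. indicator G x :: real)" using fin GL by simp
    have "(LINT x|lebesgue. \<bar>indicator G x * u x\<bar>) \<le> (LINT x|lebesgue. 3 * indicator G x)"
      using uL1 ub iG by (intro integral_mono_AE) (auto simp: set_integrable_def)
    also have "\<dots> = 3 * measure lebesgue G" using GL by simp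
    finally have L1: "(LINT x|lebesgue. \<bar>indicator G x * u x\<bar>) \<le> 3 * measure lebesgue G" .
    have "norm (grad (smoothed \<sigma> G u) x) \<le> M" for x
      unfolding M_def
      by (rule order_trans[OF smoothed_gradient_bound[OF assms(19) uL1] mult_left_mono[OF L1]])
          (use assms(19) in simp)
    from energy_ge[OF su this]
    have "c * (LINT x|lebesgue. (norm (indicator G x *\<^sub>R gu x))\<^sup>2) \<le> energy D \<sigma> G u u"
      unfolding c_def .
    also have "\<dots> \<le> energy D \<sigma> G u f"
    proof (rule ule)
      have "f \<in> W1p 2 G" using sfG W1p_2_iff by blast
      then show "f \<in> admissible G K f" using \<tau>(2) unfolding admissible_def trace_eq_def by blast
    qed
    also have "\<dots> \<le> c2 * Ef" unfolding Ef_def by (rule energy_le[OF sfG])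
    finally have grad: "(LINT x|lebesgue. (norm (indicator G x *\<^sub>R gu x))\<^sup>2) \<le> c2 * Ef / c"
      using c by (simp add: field_simps)
    have "(LINT x|lebesgue. (indicator G x * u x)\<^sup>2) \<le> (LINT x|lebesgue. 9 * indicator G x)"
    proof (rule integral_mono_AE)
      show "integrable lebesgue (\<lambda>x. (indicator G x * u x)\<^sup>2)"
        using square_integrableD(2)[OF sobolevD(1)[OF su]] by simp
      show "AE x in lebesgue. (indicator G x * u x)\<^sup>2 \<le> 9 * indicator G x"
        using ub
      proof (rule eventually_mono)
        fix x assume "\<bar>indicator G x * u x\<bar> \<le> 3 * indicator G x"
        then have "\<bar>indicator G x * u x\<bar>\<^sup>2 \<le> (3 * indicator G x)\<^sup>2" by (rule power_mono) simp
        then show "(indicator G x * u x)\<^sup>2 \<le> 9 * indicator G x" by (cases "x \<in> G") simp_all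
      qed
    qed (use iG in simp)
    also have "\<dots> = 9 * measure lebesgue G" using GL by simp
    finally have "W12_sq G u gu \<le> 9 * measure lebesgue G + c2 * Ef / c"
      using grad unfolding W12_sq_def by linarith
    then show ?thesis using u2 unfolding W1p_norm_2_eq[OF G(1) su] by simp
  qed
  then show ?thesis unfolding bounded_in_W1p_def by blast
qed

end
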